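(* Let $m\ge1$, $n\ge m+2$, and let $\mathbf r=(r_1,\dots,r_n)$ be positive real numbers. On $M^0_{\mathbf r}$ the angle variables Poisson commute: $$\{\theta_{ij},\theta_{kl}\}=0\qquad\text{for all }(i,j),(k,l)\in\mathcal I.$$
   Context: $(\cdot,\cdot)$ is the standard Hermitian inner product on $\mathbb C^{m+1}$, linear in the first argument; for a unit vector $w$, $w\otimes w^*$ is the projection $v\mapsto(v,w)w$; $\mathcal O_r=\{r\,w\otimes w^*:\|w\|=1\}\subset\mathcal H_{m+1}$ (Hermitian matrices). $\Lambda=\frac1{m+1}\sum_{i=1}^n r_i$, $\widetilde N_{\mathbf r}=\prod_i\mathcal O_{r_i}$, $\widetilde M_{\mathbf r}=\{\mathbf e\in\widetilde N_{\mathbf r}:\sum_ie_i=\Lambda\mathbb I\}$, $M_{\mathbf r}=\widetilde M_{\mathbf r}/U(m+1)$ (simultaneous conjugation). For $\mathbf e\in\widetilde M_{\mathbf r}$ write $e_k=r_k\,w_k\otimes w_k^*$ with $\|w_k\|=1$ and $A_i=e_1+\cdots+e_{i+1}$; let $\lambda_{ij}$ ($0\le i\le n-1$, $1\le j\le i+1$) be the $j$-th largest eigenvalue of $A_i$ if $j\le m+1$, and $0$ if $j\ge m+2$. These satisfy $\lambda_{ij}\ge\lambda_{i-1,j}\ge\lambda_{i,j+1}$. The entry $(i,j)$ is forced to be $0$ if $j\ge m+2$ and forced to be $\Lambda$ if $j\le m+2+i-n$; otherwise unforced. $\mathcal I=\{(i,j):1\le i\le n-3,\ \max(1,m+3+i-n)\le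 j\le\min(i,m)\}$ (the $(i,j)$ for which both $\lambda_{ij}$ and $\lambda_{i,j+1}$ are unforced). $\widetilde M_{\mathbf r}^0$ is the open subset of $\widetilde M_{\mathbf r}$ where each interlacing inequality is strict except when both members are forced to be $\Lambda$ or both forced to be $0$; $M_{\mathbf r}^0$ is its image in $M_{\mathbf r}$, a smooth symplectic manifold. On it the unforced eigenvalues are simple. Angle variables: for $(i,j)\in\mathcal I$, let $u_{ij}$ be a unit $\lambda_{ij}$-eigenvector of $A_i$, and $\theta_{ij}=\arg\big[(w_{i+1},u_{ij})(u_{ij},w_{i+2})(w_{i+2},u_{i,j+1})(u_{i,j+1},w_{i+1})\big]\in\mathbb R/2\pi\mathbb Z$; the bracketed quantity is nonzero on $\widetilde M^0_{\mathbf r}$, independent of the phases of the vectors, and $U(m+1)$-invariant. Poisson bracket: on $\widetilde N_{\mathbf r}$, $\{f,g\}(\mathbf e)=\sum_s\operatorname{Im}\operatorname{Tr}(e_s[\nabla_sf,\nabla_sg])$, where $\nabla_sf\in\mathfrak u(m+1)$ is defined by $\operatorname{Im}\operatorname{Tr}(\nabla_sf\,Y)=\frac d{dt}|_{t=0}f(\dots,e_s+tY,\dots)$ (for a local extension of $f$). $M_{\mathbf r}$ is the symplectic quotient of $\widetilde N_{\mathbf r}$ at $\Lambda\mathbb I$ and the bracket on $M^0_{\mathbf r}$ is the reduced one (extend to $U(m+1)$-invariant functions on an open subset of $\widetilde N_{\mathbf r}$, take the bracket, restrict). *)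

theory Defs
  imports
    "HOL-Analysis.Analysis"
    "HOL-Computational_Algebra.Polynomial"
    "HOL-Library.Real_Mod"
begin

text \<open>
  Throughout, \<open>'d\<close> indexes the coordinates of \<open>\<complex>\<^sup>m\<^sup>+\<^sup>1\<close>; the theorem assumes \<open>CARD('d) = m + 1\<close>.
  An \<open>n\<close>-tuple of matrices is a function on \<open>nat\<close> that is extensional on \<open>{1..n}\<close>; topological
  notions refer to the product topology.
\<close>

type_synonym 'd config = "nat \<Rightarrow> complex ^ 'd ^ 'd"

subsection \<open>Hermitian linear algebra\<close>

definition hinner :: "complex ^ 'd \<Rightarrow> complex ^ 'd \<Rightarrow> complex" where
  "hinner v w = (\<Sum>i\<in>UNIV. v $ i * cnj (w $ i))"

definition adj :: "complex ^ 'd ^ 'd \<Rightarrow> complex ^ 'd ^ 'd" where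
  "adj A = (\<chi> i j. cnj (A $ j $ i))"

definition hermitian :: "complex ^ 'd ^ 'd \<Rightarrow> bool" where
  "hermitian A \<longleftrightarrow> adj A = A"

definition skew_hermitian :: "complex ^ 'd ^ 'd \<Rightarrow> bool" where
  "skew_hermitian A \<longleftrightarrow> adj A = - A"

definition unitary :: "complex ^ 'd ^ 'd \<Rightarrow> bool" where
  "unitary U \<longleftrightarrow> adj U ** U = mat 1 \<and> U ** adj U = mat 1"

definition rank_one :: "complex ^ 'd \<Rightarrow> complex ^ 'd ^ 'd" where
  "rank_one w = (\<chi> i j. w $ i * cnj (w $ j))"

lemma rank_one_mult: "rank_one w *v v = hinner v w *s w"
  by (simp add: vec_eq_iff rank_one_def hinner_def matrix_vector_mult_def sum_distrib_left
      mult_ac)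

definition commutator :: "complex ^ 'd ^ 'd \<Rightarrow> complex ^ 'd ^ 'd \<Rightarrow> complex ^ 'd ^ 'd" where
  "commutator X Y = X ** Y - Y ** X"

definition charpoly :: "complex ^ 'd ^ 'd \<Rightarrow> complex poly" where
  "charpoly A = det (mat [:0, 1:] - (\<chi> i j. [:A $ i $ j:]))"

text \<open>The eigenvalues of a Hermitian matrix with multiplicity, in weakly decreasing order.\<close>

definition eigvals :: "complex ^ 'd ^ 'd \<Rightarrow> real list" where
  "eigvals A = (THE xs. sorted (rev xs) \<and>
     charpoly A = prod_list (map (\<lambda>x. [:- complex_of_real x, 1:]) xs))"

subsection \<open>The spaces of configurations\<close>

definition coadj_orbit :: "real \<Rightarrow> (complex ^ 'd ^ 'd) set" where
  "coadj_orbit \<rho> = {\<rho> *\<^sub>R rank_one w | w. norm w = 1}"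

definition Lam :: "nat \<Rightarrow> nat \<Rightarrow> (nat \<Rightarrow> real) \<Rightarrow> real" where
  "Lam m n r = (\<Sum>i=1..n. r i) / real (m + 1)"

definition Herm_n :: "nat \<Rightarrow> ('d::finite) config set" where
  "Herm_n n = (\<Pi>\<^sub>E i\<in>{1..n}. {A. hermitian A})"

definition N_tilde :: "nat \<Rightarrow> (nat \<Rightarrow> real) \<Rightarrow> ('d::finite) config set" where
  "N_tilde n r = (\<Pi>\<^sub>E i\<in>{1..n}. coadj_orbit (r i))"

definition M_tilde :: "nat \<Rightarrow> nat \<Rightarrow> (nat \<Rightarrow> real) \<Rightarrow> ('d::finite) config set" where
  "M_tilde m n r = {e \<in> N_tilde n r. (\<Sum>i=1..n. e i) = Lam m n r *\<^sub>R mat 1}"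

definition conj_by :: "nat \<Rightarrow> complex ^ 'd ^ 'd \<Rightarrow> ('d::finite) config \<Rightarrow> 'd config" where
  "conj_by n U e = (\<lambda>i\<in>{1..n}. U ** e i ** adj U)"

definition U_orbit :: "nat \<Rightarrow> ('d::finite) config \<Rightarrow> 'd config set" where
  "U_orbit n e = {conj_by n U e | U. unitary U}"

definition partial_sum :: "('d::finite) config \<Rightarrow> nat \<Rightarrow> complex ^ 'd ^ 'd" where
  "partial_sum e i = (\<Sum>k=1..i+1. e k)"

definition lam :: "nat \<Rightarrow> ('d::finite) config \<Rightarrow> nat \<Rightarrow> nat \<Rightarrow> real" where
  "lam m e i j = (if j \<le> m + 1 then eigvals (partial_sum e i) ! (j - 1) else 0)"

definition forced_0 :: "nat \<Rightarrow> nat \<Rightarrow> nat \<Rightarrow> nat \<Rightarrow> bool" where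
  "forced_0 m n i j \<longleftrightarrow> j \<ge> m + 2"

definition forced_Lam :: "nat \<Rightarrow> nat \<Rightarrow> nat \<Rightarrow> nat \<Rightarrow> bool" where
  "forced_Lam m n i j \<longleftrightarrow> int j \<le> int m + 2 + int i - int n"

definition both_forced :: "nat \<Rightarrow> nat \<Rightarrow> nat \<Rightarrow> nat \<Rightarrow> nat \<Rightarrow> nat \<Rightarrow> bool" where
  "both_forced m n i j i' j' \<longleftrightarrow>
     (forced_Lam m n i j \<and> forced_Lam m n i' j') \<or> (forced_0 m n i j \<and> forced_0 m n i' j')"

definition angle_index :: "nat \<Rightarrow> nat \<Rightarrow> (nat \<times> nat) set" where
  "angle_index m n = {(i, j). 1 \<le> i \<and> int i \<le> int n - 3 \<and>
     max 1 (int m + 3 + int i - int n) \<le> int j \<and> j \<le> min i m}"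

definition M_tilde0 :: "nat \<Rightarrow> nat \<Rightarrow> (nat \<Rightarrow> real) \<Rightarrow> ('d::finite) config set" where
  "M_tilde0 m n r = {e \<in> M_tilde m n r. \<forall>i\<in>{1..n-1}. \<forall>j\<in>{1..i}.
     (\<not> both_forced m n i j (i - 1) j \<longrightarrow> lam m e i j > lam m e (i - 1) j) \<and>
     (\<not> both_forced m n (i - 1) j i (j + 1) \<longrightarrow> lam m e (i - 1) j > lam m e i (j + 1))}"

definition M0 :: "nat \<Rightarrow> nat \<Rightarrow> (nat \<Rightarrow> real) \<Rightarrow> ('d::finite) config set set" where
  "M0 m n r = U_orbit n ` M_tilde0 m n r"

subsection \<open>Angle variables\<close>

text \<open>
  Elements of \<open>\<real> / 2\<pi>\<int>\<close> are represented by their cosets in \<open>\<real>\<close>. For \<open>p\<close> in \<open>M0 m n r\<close> and \<open>(i, j)\<close>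
  in \<open>angle_index m n\<close> the set below is a single coset, since the bracketed quantity depends
  neither on the representative \<open>e\<close> nor on the phases of the four unit vectors.
\<close>

definition angle_var ::
  "nat \<Rightarrow> (nat \<Rightarrow> real) \<Rightarrow> nat \<Rightarrow> nat \<Rightarrow> ('d::finite) config set \<Rightarrow> real set" where
  "angle_var m r i j p = {t. \<exists>e\<in>p. \<exists>w w' u u'.
     norm w = 1 \<and> e (i + 1) = r (i + 1) *\<^sub>R rank_one w \<and>
     norm w' = 1 \<and> e (i + 2) = r (i + 2) *\<^sub>R rank_one w' \<and>
     norm u = 1 \<and> partial_sum e i *v u = lam m e i j *\<^sub>R u \<and>
     norm u' = 1 \<and> partial_sum e i *v u' = lam m e i (j + 1) *\<^sub>R u' \<and>
     [t = Arg (hinner w u * hinner u w' * hinner w' u' * hinner u' w)] (rmod (2 * pi))}"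

subsection \<open>Poisson brackets\<close>

text \<open>
  \<open>C\<^sup>\<infinity>\<close> functions on a relatively open subset \<open>W\<close> of \<open>Herm_n n\<close>: all iterated partial derivatives,
  in the directions of Hermitian changes of a single component, exist and are continuous on \<open>W\<close>.
\<close>

coinductive smooth_on :: "nat \<Rightarrow> ('d::finite) config set \<Rightarrow> ('d config \<Rightarrow> real) \<Rightarrow> bool"
  for n :: nat and W :: "'d config set" where
  "continuous_on W F \<Longrightarrow>
   (\<forall>s\<in>{1..n}. \<forall>Y. hermitian Y \<longrightarrow>
      (\<exists>D. (\<forall>e\<in>W. ((\<lambda>t. F (e(s := e s + t *\<^sub>R Y))) has_real_derivative D e) (at 0)) \<and>
           smooth_on n W D)) \<Longrightarrow>
   smooth_on n W F"

definition local_extension ::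
  "nat \<Rightarrow> ('d::finite) config set \<Rightarrow> ('d config \<Rightarrow> real) \<Rightarrow> 'd config \<Rightarrow> ('d config \<Rightarrow> real) \<Rightarrow> bool" where
  "local_extension n V f e F \<longleftrightarrow>
     (\<exists>W. openin (top_of_set (Herm_n n)) W \<and> e \<in> W \<and> smooth_on n W F \<and> (\<forall>x\<in>W \<inter> V. F x = f x))"

definition gradient :: "(('d::finite) config \<Rightarrow> real) \<Rightarrow> 'd config \<Rightarrow> nat \<Rightarrow> complex ^ 'd ^ 'd" where
  "gradient F e s = (THE X. skew_hermitian X \<and> (\<forall>Y. hermitian Y \<longrightarrow>
     ((\<lambda>t. F (e(s := e s + t *\<^sub>R Y))) has_real_derivative Im (trace (X ** Y))) (at 0)))"

text \<open>
  The bracket at \<open>e\<close> of two smooth functions defined on a relatively open subset \<open>V\<close> of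
  \<open>N_tilde n r\<close>; its value does not depend on the local extensions \<open>F\<close>, \<open>G\<close>.
\<close>

definition bracket ::
  "nat \<Rightarrow> ('d::finite) config set \<Rightarrow> ('d config \<Rightarrow> real) \<Rightarrow> ('d config \<Rightarrow> real) \<Rightarrow> 'd config \<Rightarrow> real" where
  "bracket n V f g e = (THE c. \<exists>F G. local_extension n V f e F \<and> local_extension n V g e G \<and>
     c = (\<Sum>s=1..n. Im (trace (e s ** commutator (gradient F e s) (gradient G e s)))))"

text \<open>
  \<open>f\<close> is a smooth \<open>U(m+1)\<close>-invariant function on the \<open>U(m+1)\<close>-stable open subset \<open>V\<close> of \<open>N_tilde n r\<close>
  whose restriction to \<open>M_tilde0 m n r\<close> is a real-valued lift of the \<open>\<real> / 2\<pi>\<int>\<close>-valued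
  function \<open>\<phi>\<close> on \<open>M0 m n r\<close>.
\<close>

definition invariant_extension ::
  "nat \<Rightarrow> nat \<Rightarrow> (nat \<Rightarrow> real) \<Rightarrow> (('d::finite) config set \<Rightarrow> real set) \<Rightarrow> 'd config set \<Rightarrow>
   ('d config \<Rightarrow> real) \<Rightarrow> bool" where
  "invariant_extension m n r \<phi> V f \<longleftrightarrow>
     openin (top_of_set (N_tilde n r)) V \<and>
     (\<forall>x\<in>V. \<forall>U. unitary U \<longrightarrow> conj_by n U x \<in> V \<and> f (conj_by n U x) = f x) \<and>
     (\<forall>x\<in>V. \<exists>F. local_extension n V f x F) \<and>
     (\<forall>x\<in>V \<inter> M_tilde0 m n r. f x \<in> \<phi> (U_orbit n x))"

text \<open>
  The reduced bracket at \<open>p\<close>. Equating it with a value amounts to asserting that invariant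
  extensions exist around the orbit \<open>p\<close> and that all of them yield this value.
\<close>

definition reduced_bracket ::
  "nat \<Rightarrow> nat \<Rightarrow> (nat \<Rightarrow> real) \<Rightarrow> (('d::finite) config set \<Rightarrow> real set) \<Rightarrow> ('d config set \<Rightarrow> real set) \<Rightarrow>
   'd config set \<Rightarrow> real" where
  "reduced_bracket m n r \<phi> \<psi> p = (THE c. \<exists>e\<in>p. \<exists>V f g. e \<in> V \<and>
     invariant_extension m n r \<phi> V f \<and> invariant_extension m n r \<psi> V g \<and>
     c = bracket n V f g e)"

end

theory Submission
  imports Defs
begin

text \<open>
  Write \<open>P\<close>, \<open>P'\<close> for the spectral projections of \<open>A = e\<^sub>1 + \<dots> + e\<^sub>i\<^sub>+\<^sub>1\<close> at its eigenvalues number \<open>j\<close> and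
  \<open>j + 1\<close>. Up to a positive factor the bracketed quantity is the invariant function
  \<open>Tr (P e\<^sub>i\<^sub>+\<^sub>1 P' e\<^sub>i\<^sub>+\<^sub>2)\<close>, so a branch of its argument is an invariant extension of \<open>\<theta>\<^sub>i\<^sub>j\<close>. Perturbation theory
  shows that it is smooth, and that its gradient is a difference of two terms of the same shape, one
  for \<open>e\<^sub>i\<^sub>+\<^sub>1\<close> and one for \<open>e\<^sub>i\<^sub>+\<^sub>2\<close>, each of which is equivariant under conjugations that fix the phases
  of the eigenvectors. Equivariance reduces \<open>{\<theta>\<^sub>i\<^sub>j, \<theta>\<^sub>k\<^sub>l}\<close> to finitely many pairings of a matrix with a
  commutator. All matrices in such a pairing are fixed by complex conjugation in a suitable eigenbasis
  of \<open>A\<close>, hence the trace is real and its imaginary part vanishes.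

  For arbitrary invariant extensions one uses that the Hamiltonian vector field of an invariant function
  is tangent to the momentum level, and that the momentum map is submersive on \<open>M_tilde0\<close>, because
  strict interlacing makes the configuration irreducible.
\<close>

subsection \<open>Matrix algebra\<close>

text \<open>With unit eigenvectors u and u' for the two eigenvalues, the angle is the difference of
  \<beta>(e) = arg (e u', u) at the two orbit variables. A single \<beta> is not a function of the
  configuration, because it depends on the phases of u and u'. Its derivative still makes sense if
  the eigenvectors are moved with no component along themselves. The price is a defect Im Tr (P H) -
  Im Tr (P' H) under conjugation by H, which does not depend on e and so cancels in the difference.

  The obstacle is that one choice of phases makes the partial sum and one orbit variable real, but
  in general not both orbit variables at once. For two angles of one level the terms mixing the two
  variables must be removed before reality is used. Equivariance does this with H itself a
  derivative of some \<beta>: such an H has no diagonal part in the eigenbasis, so the defect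
  vanishes.

  The reduced bracket is a definite description over all invariant extensions, and these lift the
  angle only modulo 2 pi and only on the momentum level. Existence of an extension and independence
  of its choice are therefore part of the claim.\<close>

lemma matrix_diff_ldistrib: "A ** (B - C) = A ** B - A ** (C :: 'a::comm_ring_1 ^ 'n ^ 'm)"
  by (simp add: vec_eq_iff matrix_matrix_mult_def sum_subtractf algebra_simps)

lemma matrix_diff_rdistrib: "(B - C) ** A = B ** A - (C :: 'a::comm_ring_1 ^ 'n ^ 'm) ** A"
  by (simp add: vec_eq_iff matrix_matrix_mult_def sum_subtractf algebra_simps)

lemma matrix_add_rdistrib: "(B + C) ** A = B ** A + (C :: 'a::comm_ring_1 ^ 'n ^ 'm) ** A"
  by (simp add: vec_eq_iff matrix_matrix_mult_def sum.distrib algebra_simps)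

lemma matrix_minus_left: "(- A) ** B = - (A ** (B :: 'a::comm_ring_1 ^ 'n ^ 'm))"
  by (simp add: vec_eq_iff matrix_matrix_mult_def sum_negf)

lemma matrix_minus_right: "A ** (- B) = - (A ** (B :: 'a::comm_ring_1 ^ 'n ^ 'm))"
  by (simp add: vec_eq_iff matrix_matrix_mult_def sum_negf)

lemma matrix_scaleR_left: "(c *\<^sub>R A) ** B = c *\<^sub>R (A ** (B :: 'a::real_algebra_1 ^ 'n ^ 'm))"
  by (simp add: vec_eq_iff matrix_matrix_mult_def scaleR_sum_right)

lemma matrix_scaleR_right: "A ** (c *\<^sub>R B) = c *\<^sub>R (A ** (B :: 'a::real_algebra_1 ^ 'n ^ 'm))"
  by (simp add: vec_eq_iff matrix_matrix_mult_def scaleR_sum_right)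

lemma matrix_zero_left [simp]: "0 ** (B :: 'a::semiring_1 ^ 'n ^ 'm) = 0"
  by (simp add: vec_eq_iff matrix_matrix_mult_def)

lemma matrix_zero_right [simp]: "B ** (0 :: 'a::semiring_1 ^ 'n ^ 'm) = 0"
  by (simp add: vec_eq_iff matrix_matrix_mult_def)

lemmas mat_distribs = matrix_add_ldistrib matrix_add_rdistrib matrix_diff_ldistrib matrix_diff_rdistrib
  matrix_minus_left matrix_minus_right matrix_scaleR_left matrix_scaleR_right

lemma matrix_sum_left: "(\<Sum>i\<in>I. f i) ** B = (\<Sum>i\<in>I. f i ** (B :: 'a::comm_ring_1 ^ 'n ^ 'm))"
  by (induction I rule: infinite_finite_induct) (simp_all add: mat_distribs)

lemma matrix_sum_right: "B ** (\<Sum>i\<in>I. f i) = (\<Sum>i\<in>I. (B :: 'a::comm_ring_1 ^ 'n ^ 'm) ** f i)"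
  by (induction I rule: infinite_finite_induct) (simp_all add: mat_distribs)

lemma trace_neg: "trace (- A) = - trace (A :: 'a::comm_ring_1 ^ 'n ^ 'n)"
  by (simp add: trace_def sum_negf)

lemma trace_scaleR: "trace (c *\<^sub>R A) = c *\<^sub>R trace (A :: 'a::real_algebra_1 ^ 'n ^ 'n)"
  by (simp add: trace_def scaleR_sum_right)

lemma trace_zero [simp]: "trace 0 = 0"
  by (simp add: trace_def)

lemma trace_sum: "trace (\<Sum>i\<in>I. f i) = (\<Sum>i\<in>I. trace (f i :: 'a::comm_ring_1 ^ 'n ^ 'n))"
  by (induction I rule: infinite_finite_induct) (simp_all add: trace_add)

lemmas trace_simps = trace_add trace_sub trace_neg trace_scaleR trace_sum

lemma trace_cycle3: "trace (A ** B ** C) = trace (C ** A ** (B :: 'a::comm_semiring_1 ^ 'n ^ 'n))"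
  by (metis trace_mul_sym matrix_mul_assoc)

lemma trace_cycle4: "trace (A ** B ** C ** D) = trace (D ** A ** B ** (C :: 'a::comm_semiring_1 ^ 'n ^ 'n))"
  by (metis trace_mul_sym matrix_mul_assoc)

definition cscale :: "complex \<Rightarrow> complex ^ 'n ^ 'm \<Rightarrow> complex ^ 'n ^ 'm" where
  "cscale c A = (\<chi> i j. c * A $ i $ j)"

lemma cscale_nth [simp]: "cscale c A $ i $ j = c * A $ i $ j"
  by (simp add: cscale_def)

lemma cscale_mult_left: "cscale c A ** B = cscale c (A ** B)"
  by (simp add: vec_eq_iff matrix_matrix_mult_def sum_distrib_left mult_ac)

lemma cscale_mult_right: "A ** cscale c B = cscale c (A ** B)"
  by (simp add: vec_eq_iff matrix_matrix_mult_def sum_distrib_left mult_ac)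

lemma cscale_cscale: "cscale c (cscale d A) = cscale (c * d) A"
  by (simp add: vec_eq_iff mult_ac)

lemma cscale_of_real: "cscale (of_real c) A = c *\<^sub>R A"
  by (simp add: vec_eq_iff) (simp add: scaleR_conv_of_real)

lemma cscale_one [simp]: "cscale 1 A = A"
  by (simp add: vec_eq_iff)

lemma cscale_zero [simp]: "cscale 0 A = 0" "cscale c 0 = 0"
  by (simp_all add: vec_eq_iff)

lemma trace_cscale: "trace (cscale c A) = c * trace A"
  by (simp add: trace_def sum_distrib_left)

lemma adj_nth [simp]: "adj A $ i $ j = cnj (A $ j $ i)"
  by (simp add: adj_def)

lemma adj_adj [simp]: "adj (adj A) = A"
  by (simp add: vec_eq_iff)

lemma adj_mult: "adj (A ** B) = adj B ** adj A"
  by (simp add: vec_eq_iff matrix_matrix_mult_def mult_ac)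

lemma adj_add: "adj (A + B) = adj A + adj B" by (simp add: vec_eq_iff)
lemma adj_diff: "adj (A - B) = adj A - adj B" by (simp add: vec_eq_iff)
lemma adj_neg: "adj (- A) = - adj A" by (simp add: vec_eq_iff)
lemma adj_scaleR: "adj (c *\<^sub>R A) = c *\<^sub>R adj A" by (simp add: vec_eq_iff)
lemma adj_cscale: "adj (cscale c A) = cscale (cnj c) (adj A)" by (simp add: vec_eq_iff)
lemma adj_zero [simp]: "adj 0 = 0" by (simp add: vec_eq_iff)
lemma adj_one [simp]: "adj (mat 1) = mat 1" by (simp add: vec_eq_iff mat_def)
lemma adj_sum: "adj (\<Sum>i\<in>I. f i) = (\<Sum>i\<in>I. adj (f i))"
  by (induction I rule: infinite_finite_induct) (simp_all add: adj_add)

lemmas adj_simps = adj_mult adj_add adj_diff adj_neg adj_scaleR adj_cscale adj_sum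

lemma trace_adj: "trace (adj A) = cnj (trace A)"
  by (simp add: trace_def)

lemma adj_rank_one [simp]: "adj (rank_one w) = rank_one w"
  by (simp add: vec_eq_iff rank_one_def mult_ac)

lemma rank_one_nth [simp]: "rank_one w $ i $ j = w $ i * cnj (w $ j)"
  by (simp add: rank_one_def)

lemma hermitian_closed:
  "hermitian 0" "hermitian (mat 1)" "hermitian (rank_one w)"
  "hermitian A \<Longrightarrow> hermitian B \<Longrightarrow> hermitian (A + B)"
  "hermitian A \<Longrightarrow> hermitian B \<Longrightarrow> hermitian (A - B)"
  "hermitian A \<Longrightarrow> hermitian (- A)"
  "hermitian A \<Longrightarrow> hermitian (c *\<^sub>R A)"
  by (simp_all add: hermitian_def adj_simps)

lemma hermitian_sum: "(\<And>i. i \<in> I \<Longrightarrow> hermitian (f i)) \<Longrightarrow> hermitian (\<Sum>i\<in>I. f i)"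
  by (simp add: hermitian_def adj_simps)

lemma hermitianD: "hermitian A \<Longrightarrow> adj A = A"
  by (simp add: hermitian_def)

lemma skew_hermitianD: "skew_hermitian A \<Longrightarrow> adj A = - A"
  by (simp add: skew_hermitian_def)

lemma hermitian_commutator_skew:
  "skew_hermitian H \<Longrightarrow> hermitian A \<Longrightarrow> hermitian (commutator H A)"
  by (simp add: hermitian_def skew_hermitian_def commutator_def adj_simps mat_distribs)

lemma skew_commutator_hermitian:
  "hermitian H \<Longrightarrow> hermitian A \<Longrightarrow> skew_hermitian (commutator H A)"
  by (simp add: hermitian_def skew_hermitian_def commutator_def adj_simps mat_distribs)

text \<open>Invariance of the trace form. It moves the commutator onto the orbit variable, so that a
  bracket becomes the derivative of one function along a vector \<open>commutator Y A\<close>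
  tangent to the orbit.\<close>

lemma trace_commutator_cyclic:
  "trace (A ** commutator X Y) = trace (X ** commutator Y (A :: complex^'d^'d))"
proof -
  have "trace (A ** Y ** X) = trace (X ** A ** Y)"
    by (rule trace_cycle3)
  moreover have "trace (A ** X ** Y) = trace (X ** Y ** A)"
    by (metis trace_cycle3)
  ultimately show ?thesis
    by (simp add: commutator_def mat_distribs trace_simps matrix_mul_assoc)
qed

lemma commutator_antisym: "commutator X Y = - commutator Y X"
  by (simp add: commutator_def)

lemma commutator_add: "commutator (X + X') Y = commutator X Y + commutator X' Y"
  "commutator X (Y + Y') = commutator X Y + commutator X Y'"
  by (simp_all add: commutator_def mat_distribs)

lemma commutator_diff: "commutator (X - X') Y = commutator X Y - commutator X' Y"
  "commutator X (Y - Y') = commutator X Y - commutator X Y'"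
  by (simp_all add: commutator_def mat_distribs)

lemma commutator_neg: "commutator (- X) Y = - commutator X Y"
  "commutator X (- Y) = - commutator X Y"
  by (simp_all add: commutator_def mat_distribs)

lemma commutator_scaleR: "commutator (c *\<^sub>R X) Y = c *\<^sub>R commutator X Y"
  "commutator X (c *\<^sub>R Y) = c *\<^sub>R commutator X Y"
  by (simp_all add: commutator_def mat_distribs algebra_simps)

lemma commutator_zero [simp]: "commutator 0 X = 0" "commutator X 0 = 0"
  by (simp_all add: commutator_def)

lemma trace_commutator [simp]: "trace (commutator X (Y :: complex^'d^'d)) = 0"
  by (simp add: commutator_def trace_simps trace_mul_sym[of X Y])

subsection \<open>The Hermitian inner product\<close>

lemma hinner_cnj: "cnj (hinner v w) = hinner w v"
  by (simp add: hinner_def mult_ac)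

lemma hinner_add: "hinner (v + v') w = hinner v w + hinner v' w"
  "hinner v (w + w') = hinner v w + hinner v w'"
  by (simp_all add: hinner_def algebra_simps sum.distrib)

lemma hinner_diff: "hinner (v - v') w = hinner v w - hinner v' w"
  "hinner v (w - w') = hinner v w - hinner v w'"
  by (simp_all add: hinner_def algebra_simps sum_subtractf)

lemma hinner_scale: "hinner (c *s v) w = c * hinner v w"
  "hinner v (c *s w) = cnj c * hinner v w"
  by (simp_all add: hinner_def sum_distrib_left mult_ac)

lemma hinner_scaleR: "hinner (c *\<^sub>R v) w = of_real c * hinner v w"
  "hinner v (c *\<^sub>R w) = of_real c * hinner v w"
  by (simp_all add: hinner_def sum_distrib_left mult_ac scaleR_conv_of_real[where 'a=complex])

lemma hinner_zero [simp]: "hinner 0 w = 0" "hinner v 0 = 0"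
  by (simp_all add: hinner_def)

lemma hinner_sum: "hinner (\<Sum>i\<in>I. f i) w = (\<Sum>i\<in>I. hinner (f i) w)"
  "hinner w (\<Sum>i\<in>I. f i) = (\<Sum>i\<in>I. hinner w (f i))"
  by (induction I rule: infinite_finite_induct) (simp_all add: hinner_add)

lemmas hinner_simps = hinner_add hinner_diff hinner_scale hinner_scaleR hinner_sum

lemma Re_hinner: "Re (hinner v w) = v \<bullet> w"
  by (simp add: hinner_def inner_vec_def inner_complex_def)

lemma hinner_self: "hinner v v = of_real ((norm v)\<^sup>2)"
proof -
  have "cnj (hinner v v) = hinner v v" by (rule hinner_cnj)
  then have "Im (hinner v v) = 0" by (simp add: complex_eq_iff)
  moreover have "Re (hinner v v) = (norm v)\<^sup>2" by (simp add: Re_hinner power2_norm_eq_inner)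
  ultimately show ?thesis by (simp add: complex_eq_iff)
qed

lemma hinner_eq_0 [simp]: "hinner v v = 0 \<longleftrightarrow> v = 0"
  by (simp add: hinner_self)

lemma hinner_adj: "hinner (A *v x) y = hinner x (adj A *v y)"
proof -
  have "hinner (A *v x) y = (\<Sum>i\<in>UNIV. \<Sum>k\<in>UNIV. A $ i $ k * x $ k * cnj (y $ i))"
    by (simp add: hinner_def matrix_vector_mult_def sum_distrib_right)
  also have "\<dots> = (\<Sum>k\<in>UNIV. \<Sum>i\<in>UNIV. A $ i $ k * x $ k * cnj (y $ i))"
    by (rule sum.swap)
  also have "\<dots> = hinner x (adj A *v y)"
    by (simp add: hinner_def matrix_vector_mult_def sum_distrib_left mult_ac)
  finally show ?thesis .
qed

lemma hinner_hermitian: "hermitian A \<Longrightarrow> hinner (A *v x) y = hinner x (A *v y)"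
  by (simp add: hinner_adj hermitianD)

lemma trace_rank_one: "trace (A ** rank_one w) = hinner (A *v w) w"
  by (simp add: trace_def matrix_matrix_mult_def hinner_def matrix_vector_mult_def
      sum_distrib_left sum_distrib_right mult_ac)

lemma trace_rank_one_self: "trace (rank_one w) = of_real ((norm w)\<^sup>2)"
  using hinner_self[of w] by (simp add: trace_def hinner_def)

text \<open>Between the two outer factors only the number \<open>hinner (X *v w) w\<close> survives.
  Every later collapse of a product of eigenprojections and orbit elements goes back to this
  identity.\<close>

lemma rank_one_sandwich: "rank_one w ** X ** rank_one w = cscale (trace (X ** rank_one w)) (rank_one w)"
proof -
  have "(rank_one w ** X ** rank_one w) $ i $ j
      = cscale (trace (X ** rank_one w)) (rank_one w) $ i $ j" for i j
  proof -
    have "(rank_one w ** X ** rank_one w) $ i $ j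
        = (\<Sum>k\<in>UNIV. \<Sum>l\<in>UNIV. w $ i * cnj (w $ l) * X $ l $ k * (w $ k * cnj (w $ j)))"
      by (simp add: matrix_matrix_mult_def sum_distrib_right)
    also have "\<dots> = (\<Sum>l\<in>UNIV. \<Sum>k\<in>UNIV. w $ i * cnj (w $ l) * X $ l $ k * (w $ k * cnj (w $ j)))"
      by (rule sum.swap)
    also have "\<dots> = cscale (trace (X ** rank_one w)) (rank_one w) $ i $ j"
      by (simp add: trace_def matrix_matrix_mult_def sum_distrib_left sum_distrib_right mult_ac)
    finally show ?thesis .
  qed
  then show ?thesis
    by (simp add: vec_eq_iff)
qed

lemma matrix_rank_one: "A ** rank_one w ** adj A = rank_one (A *v w)"
  by (simp add: vec_eq_iff matrix_matrix_mult_def matrix_vector_mult_def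
      sum_distrib_left sum_distrib_right mult_ac)

lemma norm_matrix_trace: "trace (A ** adj A) = of_real ((norm A)\<^sup>2)"
proof -
  have "(norm A)\<^sup>2 = (\<Sum>i\<in>UNIV. \<Sum>j\<in>UNIV. (cmod (A $ i $ j))\<^sup>2)"
    by (simp add: power2_norm_eq_inner inner_vec_def cmod_power2[symmetric] power2_norm_eq_inner)
  then show ?thesis
    by (simp add: trace_def matrix_matrix_mult_def flip: complex_norm_square)
qed

lemma inner_hermitian: "Re (trace (A ** B)) = A \<bullet> B" if "hermitian B"
proof -
  have "cnj (B $ i $ j) = B $ j $ i" for i j
    using hermitianD[OF that] by (metis adj_nth)
  then have "trace (A ** B) = (\<Sum>i\<in>UNIV. \<Sum>j\<in>UNIV. A $ i $ j * cnj (B $ i $ j))"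
    unfolding trace_def matrix_matrix_mult_def by (simp)
  then show ?thesis
    by (simp add: inner_vec_def inner_complex_def)
qed

lemma Re_hinner_ii: "Re (hinner x (\<i> *s v)) = Im (hinner x v)"
  by (simp add: hinner_scale)

section \<open>Orthonormal frames\<close>

lemma exists_unit_orthogonal:
  fixes V :: "(complex ^ 'd) set"
  assumes "finite V" "card V < CARD('d)"
  shows "\<exists>x. norm x = 1 \<and> (\<forall>v\<in>V. hinner x v = 0)"
proof -
  \<comment> \<open>Orthogonality for \<open>hinner\<close> is real orthogonality to both
    \<open>v\<close> and \<open>\<i> *s v\<close>. The number of conditions doubles, and so does the
    dimension when it is counted over the reals.\<close>
  let ?W = "V \<union> (\<lambda>v. \<i> *s v) ` V"
  have "card ?W \<le> card V + card V"
    by (meson add_left_mono assms(1) card_Un_le card_image_le le_trans)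
  moreover have "dim (span ?W) \<le> card ?W"
    by (simp add: assms(1) dim_le_card')
  ultimately have "dim ?W < DIM(complex ^ 'd)"
    using assms(2) by simp
  then obtain x where x: "x \<noteq> 0" "\<And>y. y \<in> span ?W \<Longrightarrow> orthogonal x y"
    using orthogonal_to_subspace_exists by blast
  have "hinner x v = 0" if "v \<in> V" for v
  proof -
    have "x \<bullet> v = 0" "x \<bullet> (\<i> *s v) = 0"
      using x(2) that by (auto simp: orthogonal_def span_base)
    then show ?thesis
      by (metis Re_hinner Re_hinner_ii complex_eq_iff zero_complex.sel)
  qed
  then show ?thesis
    using x(1) by (intro exI[of _ "(1 / norm x) *\<^sub>R x"]) (simp add: hinner_scaleR)
qed

text \<open>Frames are numbered by the naturals below \<open>CARD('d)\<close> rather than by the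
  index type, so that a frame can follow the order of the eigenvalue list.\<close>

definition orthoframe :: "(nat \<Rightarrow> complex ^ 'd) \<Rightarrow> bool" where
  "orthoframe u \<longleftrightarrow> (\<forall>a<CARD('d). \<forall>b<CARD('d). hinner (u a) (u b) = (if a = b then 1 else 0))"

lemma orthoframe_hinner:
  "orthoframe u \<Longrightarrow> a < CARD('d) \<Longrightarrow> b < CARD('d) \<Longrightarrow> hinner (u a) (u b :: complex^'d) = (if a = b then 1 else 0)"
  by (simp add: orthoframe_def)

lemma orthoframe_norm: "orthoframe u \<Longrightarrow> a < CARD('d) \<Longrightarrow> norm (u a :: complex^'d) = 1"
  using orthoframe_hinner[of u a a] by (simp add: hinner_self power2_eq_1_iff flip: of_real_power)
    (smt (verit) norm_ge_zero of_real_eq_1_iff power2_eq_1_iff)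

lemma orthoframe_unitary:
  assumes "orthoframe (u :: nat \<Rightarrow> complex ^ 'd)"
  obtains U :: "complex ^ 'd ^ 'd" and \<pi> where "bij_betw \<pi> (UNIV :: 'd set) {..<CARD('d)}"
    "\<And>i j. U $ i $ j = u (\<pi> j) $ i" "unitary U"
proof -
  obtain \<pi> :: "'d \<Rightarrow> nat" where \<pi>: "bij_betw \<pi> UNIV {..<CARD('d)}"
    using ex_bij_betw_finite_nat[of "UNIV :: 'd set"] by (auto simp: atLeast0LessThan)
  then have \<pi>': "\<pi> j < CARD('d)" "\<pi> i = \<pi> j \<longleftrightarrow> i = j" for i j
    by (auto simp: bij_betw_def inj_on_def)
  define U where "U = (\<chi> i j. u (\<pi> j) $ i)"
  have "(adj U ** U) $ i $ j = mat 1 $ i $ j" for i j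
  proof -
    have "(adj U ** U) $ i $ j = hinner (u (\<pi> j)) (u (\<pi> i))"
      by (simp add: U_def matrix_matrix_mult_def hinner_def mult_ac)
    then show ?thesis
      using orthoframe_hinner[OF assms \<pi>'(1) \<pi>'(1)] \<pi>'(2) by (auto simp: mat_def)
  qed
  then have "adj U ** U = mat 1" by (simp add: vec_eq_iff)
  then have "unitary U"
    using matrix_left_right_inverse unitary_def by blast
  then show thesis
    using that[of \<pi> U] \<pi> by (simp add: U_def)
qed

lemma orthoframe_sum_rank_one:
  assumes "orthoframe (u :: nat \<Rightarrow> complex ^ 'd)"
  shows "(\<Sum>a<CARD('d). rank_one (u a)) = mat 1"
proof -
  obtain U :: "complex ^ 'd ^ 'd" and \<pi> where \<pi>: "bij_betw \<pi> (UNIV :: 'd set) {..<CARD('d)}"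
    and U: "\<And>i j. U $ i $ j = u (\<pi> j) $ i" and un: "unitary U"
    by (rule orthoframe_unitary[OF assms]) blast
  have "(U ** adj U) $ i $ j = (\<Sum>a<CARD('d). rank_one (u a)) $ i $ j" for i j
  proof -
    have "(U ** adj U) $ i $ j = (\<Sum>k\<in>UNIV. u (\<pi> k) $ i * cnj (u (\<pi> k) $ j))"
      by (simp add: matrix_matrix_mult_def U)
    also have "\<dots> = (\<Sum>a<CARD('d). u a $ i * cnj (u a $ j))"
      by (rule sum.reindex_bij_betw[OF \<pi>, where g = "\<lambda>a. u a $ i * cnj (u a $ j)"])
    finally show ?thesis by simp
  qed
  then show ?thesis
    using un by (simp add: unitary_def vec_eq_iff)
qed

lemma matrix_vector_mult_sum_l: "(\<Sum>i\<in>I. f i) *v x = (\<Sum>i\<in>I. f i *v (x :: 'a::comm_ring_1 ^ 'n))"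
  by (induction I rule: infinite_finite_induct) (simp_all add: matrix_vector_mult_add_rdistrib)

lemma matrix_vector_mult_sum_r: "A *v (\<Sum>i\<in>I. f i) = (\<Sum>i\<in>I. A *v (f i :: 'a::comm_ring_1 ^ 'n))"
  by (induction I rule: infinite_finite_induct) (simp_all add: matrix_vector_right_distrib)

lemma scaleR_matrix_vector: "(c *\<^sub>R A) *v x = c *\<^sub>R (A *v (x :: complex ^ 'n))"
  by (simp add: vec_eq_iff matrix_vector_mult_def scaleR_sum_right)

lemma matrix_vector_mult_smult: "A *v (c *s x) = c *s (A *v (x :: complex ^ 'n))"
  by (simp add: vec_eq_iff matrix_vector_mult_def sum_distrib_left mult_ac)

lemma matrix_vector_mult_scaleR_r: "A *v (c *\<^sub>R x) = c *\<^sub>R (A *v (x :: complex ^ 'n))"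
  by (simp add: vec_eq_iff matrix_vector_mult_def scaleR_sum_right)

lemma orthoframe_expand:
  assumes "orthoframe (u :: nat \<Rightarrow> complex ^ 'd)"
  shows "x = (\<Sum>a<CARD('d). hinner x (u a) *s u a)"
proof -
  have "x = mat 1 *v x" by simp
  also have "\<dots> = (\<Sum>a<CARD('d). rank_one (u a)) *v x"
    using orthoframe_sum_rank_one[OF assms] by simp
  finally show ?thesis
    by (simp add: matrix_vector_mult_sum_l rank_one_mult)
qed

lemma orthoframe_norm_expand:
  assumes "orthoframe (u :: nat \<Rightarrow> complex ^ 'd)"
  shows "(norm x)\<^sup>2 = (\<Sum>a<CARD('d). (cmod (hinner x (u a)))\<^sup>2)"
proof -
  have "of_real ((norm x)\<^sup>2) = hinner x (\<Sum>a<CARD('d). hinner x (u a) *s u a)"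
    using orthoframe_expand[OF assms, of x] by (simp add: hinner_self)
  also have "\<dots> = of_real (\<Sum>a<CARD('d). (cmod (hinner x (u a)))\<^sup>2)"
    by (simp add: hinner_simps mult.commute flip: complex_norm_square)
  finally show ?thesis
    using of_real_eq_iff by blast
qed

lemma matrix_eqI_frame:
  assumes "orthoframe (u :: nat \<Rightarrow> complex ^ 'd)" "\<And>a. a < CARD('d) \<Longrightarrow> A *v u a = B *v u a"
  shows "A = (B :: complex ^ 'd ^ 'd)"
proof -
  have "A *v x = B *v x" for x
    by (subst (1 2) orthoframe_expand[OF assms(1), of x])
      (simp add: matrix_vector_mult_sum_r matrix_vector_mult_smult assms(2))
  then show ?thesis by (simp add: matrix_eq)
qed

lemma frame_quadratic_form:
  assumes "orthoframe (u :: nat \<Rightarrow> complex ^ 'd)" "\<And>a. a < CARD('d) \<Longrightarrow> A *v u a = \<mu> a *\<^sub>R u a"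
  shows "hinner (A *v x) x = of_real (\<Sum>a<CARD('d). \<mu> a * (cmod (hinner x (u a)))\<^sup>2)"
proof -
  have "hinner (A *v x) x = hinner (A *v (\<Sum>a<CARD('d). hinner x (u a) *s u a)) x"
    using orthoframe_expand[OF assms(1), of x] by simp
  also have "\<dots> = (\<Sum>a<CARD('d). hinner x (u a) * (\<mu> a * hinner (u a) x))"
    by (simp add: matrix_vector_mult_sum_r matrix_vector_mult_smult assms(2) hinner_simps)
  also have "\<dots> = (\<Sum>a<CARD('d). \<mu> a * (hinner x (u a) * cnj (hinner x (u a))))"
    by (simp add: hinner_cnj mult_ac)
  finally show ?thesis
    by (simp flip: complex_norm_square)
qed

subsection \<open>The spectral theorem\<close>

text \<open>On the line through \<open>x\<close> in direction \<open>B *v x\<close> the form has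
  constant term 0 and linear coefficient twice the squared norm of \<open>B *v x\<close>, so
  nonnegativity there forces this norm to vanish. Asking for nonnegativity on this line only makes
  the lemma applicable to a form that is nonnegative merely on a subspace.\<close>

lemma psd_kernel:
  assumes h: "hermitian B" and x: "hinner (B *v x) x = 0"
    and y: "\<And>t::real. 0 \<le> Re (hinner (B *v (x + t *\<^sub>R (B *v x))) (x + t *\<^sub>R (B *v x)))"
  shows "B *v x = 0"
proof (rule ccontr)
  assume ne: "B *v x \<noteq> 0"
  let ?y = "B *v x"
  define c where "c = Re (hinner (B *v ?y) ?y)"
  define d where "d = (norm ?y)\<^sup>2"
  have "d > 0" using ne by (simp add: d_def)
  have *: "hinner (B *v ?y) x = of_real d"
    using h by (simp add: hinner_hermitian hinner_self d_def)
  have hyy: "hinner ?y ?y = of_real d"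
    by (simp add: hinner_self d_def)
  have "Re (hinner (B *v (x + t *\<^sub>R ?y)) (x + t *\<^sub>R ?y)) = 2 * t * d + t\<^sup>2 * c" for t
    using x * hyy by (simp add: matrix_vector_right_distrib matrix_vector_mult_scaleR_r hinner_simps c_def
        algebra_simps power2_eq_square)
  then have ge: "0 \<le> 2 * t * d + t\<^sup>2 * c" for t using y by metis
  have "c \<ge> 0 \<or> c < 0" by auto
  \<comment> \<open>The minimiser of the majorant in which \<open>c\<close> is replaced by
    \<open>\<bar>c\<bar> + 1\<close>; the added 1 keeps the denominator positive.\<close>
  define t where "t = - d / (\<bar>c\<bar> + 1)"
  have "2 * t * d + t\<^sup>2 * c \<le> 2 * t * d + t\<^sup>2 * (\<bar>c\<bar> + 1)"
    by (intro add_left_mono mult_left_mono) auto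
  also have "\<dots> = - d\<^sup>2 / (\<bar>c\<bar> + 1)"
  proof -
    have "2 * (- d / s) * d + (- d / s)\<^sup>2 * s = - d\<^sup>2 / s" if "s > 0" for s
      using that by (simp add: field_simps power2_eq_square)
    from this[of "\<bar>c\<bar> + 1"] show ?thesis by (simp add: t_def)
  qed
  also have "\<dots> < 0"
    using \<open>d > 0\<close> by (simp add: divide_neg_pos)
  finally show False using ge[of t] by linarith
qed

text \<open>The Rayleigh quotient is maximised on the unit sphere orthogonal to the eigenvectors
  found so far. With \<open>c\<close> the maximum, \<open>c *\<^sub>R mat 1 - A\<close> is
  nonnegative on that complement and its form vanishes at the maximiser, which is then an
  eigenvector by \<open>psd_kernel\<close>.\<close>

lemma spectral_step:
  fixes A :: "complex ^ 'd ^ 'd"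
  assumes h: "hermitian A" and k: "k < CARD('d)"
    and eig: "\<And>a. a < k \<Longrightarrow> A *v u a = \<mu> a *\<^sub>R u a"
  obtains v c where "norm v = 1" "\<And>a. a < k \<Longrightarrow> hinner v (u a) = 0" "A *v v = c *\<^sub>R v"
    "\<And>x. norm x = 1 \<Longrightarrow> (\<And>a. a < k \<Longrightarrow> hinner x (u a) = 0) \<Longrightarrow> Re (hinner (A *v x) x) \<le> c"
proof -
  let ?perp = "{x. \<forall>a<k. hinner x (u a) = 0}"
  let ?S = "sphere 0 1 \<inter> ?perp"
  have cont: "continuous_on X (\<lambda>x. hinner x v)" for v :: "complex ^ 'd" and X
    unfolding hinner_def by (intro continuous_intros)
  have "?perp = (\<Inter>a\<in>{..<k}. {x. hinner x (u a) = 0})" by auto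
  also have "closed \<dots>"
    by (intro closed_INT ballI closed_Collect_eq cont continuous_on_const)
  finally have "compact ?S"
    by (intro compact_Int_closed compact_sphere)
  moreover have "?S \<noteq> {}"
  proof -
    have "card (u ` {..<k}) < CARD('d)"
      using k card_image_le[of "{..<k}" u] by simp
    then show ?thesis
      using exists_unit_orthogonal[of "u ` {..<k}"] by (auto simp: lessThan_def)
  qed
  moreover have "continuous_on ?S (\<lambda>x. Re (hinner (A *v x) x))"
    unfolding hinner_def matrix_vector_mult_def by (auto intro!: continuous_intros)
  ultimately have "\<exists>v\<in>?S. \<forall>x\<in>?S. Re (hinner (A *v x) x) \<le> Re (hinner (A *v v) v)"
    by (rule continuous_attains_sup)
  then obtain v where v: "v \<in> ?S"
    and max: "\<And>x. x \<in> ?S \<Longrightarrow> Re (hinner (A *v x) x) \<le> Re (hinner (A *v v) v)"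
    by blast
  define c where "c = Re (hinner (A *v v) v)"
  define B where "B = c *\<^sub>R mat 1 - A"
  have hB: "hermitian B"
    by (simp add: B_def hermitian_closed h)
  have Bx: "B *v x = c *\<^sub>R x - A *v x" for x
    by (simp add: B_def matrix_vector_mult_diff_rdistrib scaleR_matrix_vector)
  have nv: "norm v = 1" and pv: "\<And>a. a < k \<Longrightarrow> hinner v (u a) = 0"
    using v by auto
  \<comment> \<open>\<open>B\<close> preserves the complement of the \<open>u a\<close>, so the line
    used by \<open>psd_kernel\<close> stays where the form is nonnegative.\<close>
  have pA: "hinner (B *v x) (u a) = 0" if "a < k" "hinner x (u a) = 0" for x a
    using that h by (simp add: hB hinner_hermitian) (simp add: Bx hinner_simps eig)
  have nonneg: "0 \<le> Re (hinner (B *v x) x)" if "\<And>a. a < k \<Longrightarrow> hinner x (u a) = 0" for x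
  proof (cases "x = 0")
    case False
    define y where "y = (1 / norm x) *\<^sub>R x"
    have xy: "x = norm x *\<^sub>R y" using False by (simp add: y_def)
    have "y \<in> ?S" using False that by (simp add: y_def hinner_simps)
    then have "Re (hinner (A *v y) y) \<le> c" using max by (simp add: c_def)
    moreover have "hinner y y = 1" using \<open>y \<in> ?S\<close> by (simp add: hinner_self)
    ultimately have "0 \<le> Re (hinner (B *v y) y)" by (simp add: Bx hinner_simps)
    moreover have "Re (hinner (B *v x) x) = (norm x)\<^sup>2 * Re (hinner (B *v y) y)"
      by (subst (1 2) xy) (simp add: matrix_vector_mult_scaleR_r hinner_simps power2_eq_square del: norm_eq_zero)
    ultimately show ?thesis by simp
  qed simp
  have "hinner (A *v v) v = of_real c"
  proof -
    have "cnj (hinner (A *v v) v) = hinner (A *v v) v"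
      by (simp add: hinner_cnj hinner_hermitian h)
    then show ?thesis by (simp add: c_def complex_eq_iff)
  qed
  then have "hinner (B *v v) v = 0"
    by (simp add: Bx hinner_simps hinner_self nv)
  then have "B *v v = 0"
  proof (rule psd_kernel[OF hB])
    show "0 \<le> Re (hinner (B *v (v + t *\<^sub>R (B *v v))) (v + t *\<^sub>R (B *v v)))" for t
      by (rule nonneg) (simp add: hinner_simps pA pv)
  qed
  then have "A *v v = c *\<^sub>R v" by (simp add: Bx)
  then show thesis
    using that[OF nv pv _ ] max by (auto simp: c_def)
qed

text \<open>The maximality clause is carried through the induction because it yields the ordering: a
  vector found later was already admissible in each earlier maximisation.\<close>

lemma spectral_theorem_aux:
  fixes A :: "complex ^ 'd ^ 'd"
  assumes h: "hermitian A"
  shows "k \<le> CARD('d) \<Longrightarrow> \<exists>u \<mu>. (\<forall>a<k. \<forall>b<k. hinner (u a) (u b) = (if a = b then 1 else 0)) \<and>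
     (\<forall>a<k. A *v u a = \<mu> a *\<^sub>R u a) \<and> (\<forall>a<k. \<forall>b\<le>a. \<mu> a \<le> \<mu> b) \<and>
     (\<forall>a<k. \<forall>x. norm x = 1 \<longrightarrow> (\<forall>b<a. hinner x (u b) = 0) \<longrightarrow> Re (hinner (A *v x) x) \<le> \<mu> a)"
proof (induction k)
  case (Suc k)
  obtain u :: "nat \<Rightarrow> complex ^ 'd" and \<mu> where H:
     "(\<forall>a<k. \<forall>b<k. hinner (u a) (u b) = (if a = b then 1 else 0)) \<and>
     (\<forall>a<k. A *v u a = \<mu> a *\<^sub>R u a) \<and> (\<forall>a<k. \<forall>b\<le>a. \<mu> a \<le> \<mu> b) \<and>
     (\<forall>a<k. \<forall>x. norm x = 1 \<longrightarrow> (\<forall>b<a. hinner x (u b) = 0) \<longrightarrow> Re (hinner (A *v x) x) \<le> \<mu> a)"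
    using Suc.IH[OF Suc_leD[OF Suc.prems]] by blast
  then have u: "\<And>a b. a < k \<Longrightarrow> b < k \<Longrightarrow> hinner (u a) (u b) = (if a = b then 1 else 0)"
     "\<And>a. a < k \<Longrightarrow> A *v u a = \<mu> a *\<^sub>R u a" "\<And>a b. a < k \<Longrightarrow> b \<le> a \<Longrightarrow> \<mu> a \<le> \<mu> b"
     "\<And>a x. a < k \<Longrightarrow> norm x = 1 \<Longrightarrow> (\<And>b. b < a \<Longrightarrow> hinner x (u b) = 0) \<Longrightarrow> Re (hinner (A *v x) x) \<le> \<mu> a"
    by blast+
  obtain v c where v: "norm v = 1" "\<And>a. a < k \<Longrightarrow> hinner v (u a) = 0" "A *v v = c *\<^sub>R v"
    "\<And>x. norm x = 1 \<Longrightarrow> (\<And>a. a < k \<Longrightarrow> hinner x (u a) = 0) \<Longrightarrow> Re (hinner (A *v x) x) \<le> c"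
    by (rule spectral_step[OF h Suc_le_lessD[OF Suc.prems] u(2)]) blast+
  have v': "hinner (u a) v = 0" if "a < k" for a
    using v(2)[OF that] by (metis hinner_cnj complex_cnj_zero)
  have vv: "hinner v v = 1" using v(1) by (simp add: hinner_self)
  have c: "c \<le> \<mu> a" if "a < k" for a
  proof -
    have "Re (hinner (A *v v) v) \<le> \<mu> a" using that v(1,2) by (intro u(4)) auto
    then show ?thesis by (simp add: v(3) hinner_simps vv)
  qed
  show ?case
    by (rule exI[of _ "u(k := v)"], rule exI[of _ "\<mu>(k := c)"])
      (use u v v' vv c in \<open>auto simp: less_Suc_eq\<close>)
qed simp

lemma spectral_theorem_sorted:
  fixes A :: "complex ^ 'd ^ 'd"
  assumes h: "hermitian A"
  obtains u \<mu> where "orthoframe u" "\<And>a. a < CARD('d) \<Longrightarrow> A *v u a = \<mu> a *\<^sub>R u a"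
    "\<And>a b. a < CARD('d) \<Longrightarrow> b \<le> a \<Longrightarrow> \<mu> a \<le> \<mu> b"
  using spectral_theorem_aux[OF h order_refl] unfolding orthoframe_def by blast

text \<open>\<open>eigvals\<close> is a definite description, so two facts are combined: a
  diagonalising unitary splits the characteristic polynomial into linear factors, and a product of
  monic linear factors determines the multiset of its roots, hence the decreasing list.\<close>

lemma eigvals_eqI:
  fixes A :: "complex ^ 'd ^ 'd"
  assumes u: "orthoframe u" and eig: "\<And>a. a < CARD('d) \<Longrightarrow> A *v u a = \<mu> a *\<^sub>R u a"
    and anti: "\<And>a b. a < CARD('d) \<Longrightarrow> b \<le> a \<Longrightarrow> \<mu> a \<le> \<mu> b"
  shows "eigvals A = map \<mu> [0..<CARD('d)]"
proof -
  define lin where "lin x = [:- complex_of_real x, 1:]" for x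
  obtain U :: "complex ^ 'd ^ 'd" and \<pi> where \<pi>: "bij_betw \<pi> (UNIV :: 'd set) {..<CARD('d)}"
    and U: "\<And>i j. U $ i $ j = u (\<pi> j) $ i" and un: "unitary U"
    by (rule orthoframe_unitary[OF u]) blast
  have \<pi>': "\<pi> j < CARD('d)" for j using \<pi> by (auto simp: bij_betw_def)
  define D :: "complex ^ 'd ^ 'd" where "D = (\<chi> i j. if i = j then of_real (\<mu> (\<pi> i)) else 0)"
  \<comment> \<open>Embeds complex matrices as constant polynomial matrices. The embedding is
    multiplicative, so the diagonalisation can be carried out inside the determinant.\<close>
  define C :: "complex ^ 'd ^ 'd \<Rightarrow> complex poly ^ 'd ^ 'd" where "C M = (\<chi> i j. [:M $ i $ j:])" for M
  have Cm: "C (M ** M') = C M ** C M'" for M M'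
    by (simp add: C_def vec_eq_iff matrix_matrix_mult_def sum_to_poly mult_ac)
  have C1: "C (mat 1) = mat 1"
    by (simp add: C_def vec_eq_iff mat_def one_pCons)
  have "(A ** U) $ i $ j = (U ** D) $ i $ j" for i j
  proof -
    have "(A ** U) $ i $ j = (A *v u (\<pi> j)) $ i"
      by (simp add: matrix_matrix_mult_def matrix_vector_mult_def U)
    also have "\<dots> = of_real (\<mu> (\<pi> j)) * U $ i $ j"
      using eig[OF \<pi>'] by (simp add: U) (simp add: scaleR_conv_of_real)
    also have "\<dots> = (U ** D) $ i $ j"
      by (simp add: matrix_matrix_mult_def D_def if_distrib[of "\<lambda>x. _ * x"] cong: if_cong)
    finally show ?thesis .
  qed
  then have "A ** U = U ** D" by (simp add: vec_eq_iff)
  then have AU: "A = U ** D ** adj U"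
    using un by (metis matrix_mul_assoc matrix_mul_rid unitary_def)
  define X :: "complex poly ^ 'd ^ 'd" where "X = mat [:0, 1:]"
  have Xc: "M ** X = X ** M" for M
    by (simp add: X_def vec_eq_iff matrix_matrix_mult_def mat_def if_distrib if_distribR cong: if_cong)
  have UU: "C U ** C (adj U) = mat 1"
    using un by (simp add: unitary_def C1 flip: Cm)
  have "X - C A = C U ** (X - C D) ** C (adj U)"
  proof -
    have "C U ** X ** C (adj U) = X"
      by (metis Xc UU matrix_mul_assoc matrix_mul_rid)
    then show ?thesis by (simp add: AU Cm matrix_diff_ldistrib matrix_diff_rdistrib)
  qed
  then have "charpoly A = det (C U) * det (X - C D) * det (C (adj U))"
    by (simp add: charpoly_def X_def C_def det_mul)
  also have "\<dots> = det (C U ** C (adj U)) * det (X - C D)"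
    by (simp add: det_mul mult_ac)
  also have "\<dots> = det (X - C D)" by (simp add: UU)
  also have "\<dots> = (\<Prod>i\<in>UNIV. (X - C D) $ i $ i)"
    by (rule det_diagonal) (simp add: X_def C_def D_def mat_def)
  also have "\<dots> = (\<Prod>i\<in>UNIV. lin (\<mu> (\<pi> i)))"
    by (simp add: X_def C_def D_def mat_def lin_def)
  also have "\<dots> = (\<Prod>a<CARD('d). lin (\<mu> a))"
    by (rule prod.reindex_bij_betw[OF \<pi>])
  also have "\<dots> = prod_list (map lin (map \<mu> [0..<CARD('d)]))"
    by (simp add: prod.distinct_set_conv_list[symmetric] comp_def atLeast0LessThan)
  finally have cp: "charpoly A = prod_list (map lin (map \<mu> [0..<CARD('d)]))" .
  have uniq: "xs = ys" if "sorted (rev xs)" "sorted (rev ys)" "prod_list (map lin xs) = prod_list (map lin ys)" for xs ys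
  proof -
    have lin: "lin x \<noteq> 0" "proots (lin x) = {#of_real x#}" for x
      by (simp_all add: lin_def)
    have nz: "prod_list (map lin zs) \<noteq> 0" for zs
      by (induction zs) (simp_all add: lin)
    have pr: "proots (prod_list (map lin zs)) = image_mset of_real (mset zs)" for zs
      by (induction zs) (simp_all add: lin proots_mult nz)
    have "mset xs = mset ys"
      using that(3) pr[of xs] pr[of ys] injD[OF multiset.inj_map[OF inj_of_real]] by metis
    then have "rev xs = rev ys"
      using that(1,2) by (metis mset_rev properties_for_sort)
    then show ?thesis by simp
  qed
  have s: "sorted (rev (map \<mu> [0..<CARD('d)]))"
    by (auto simp: sorted_rev_nth_mono sorted_rev_iff_nth_mono intro!: anti)
  show ?thesis
    unfolding eigvals_def
    by (rule the_equality) (use s cp uniq in \<open>auto simp: lin_def[abs_def]\<close>)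
qed

lemma spectral_theorem:
  fixes A :: "complex ^ 'd ^ 'd"
  assumes h: "hermitian A"
  obtains u where "orthoframe u" "\<And>a. a < CARD('d) \<Longrightarrow> A *v u a = eigvals A ! a *\<^sub>R u a"
proof -
  obtain u \<mu> where u: "orthoframe u" "\<And>a. a < CARD('d) \<Longrightarrow> A *v u a = \<mu> a *\<^sub>R u a"
    "\<And>a b. a < CARD('d) \<Longrightarrow> b \<le> a \<Longrightarrow> \<mu> a \<le> \<mu> b"
    by (rule spectral_theorem_sorted[OF h]) blast
  then show thesis
    using that[of u] eigvals_eqI[OF u] by simp
qed

lemma eigvals_antimono:
  fixes A :: "complex ^ 'd ^ 'd"
  assumes h: "hermitian A" and "a \<le> b" "b < CARD('d)"
  shows "eigvals A ! b \<le> eigvals A ! a"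
proof -
  obtain u \<mu> where u: "orthoframe u" "\<And>a. a < CARD('d) \<Longrightarrow> A *v u a = \<mu> a *\<^sub>R u a"
    "\<And>a b. a < CARD('d) \<Longrightarrow> b \<le> a \<Longrightarrow> \<mu> a \<le> \<mu> b"
    by (rule spectral_theorem_sorted[OF h]) blast
  then show ?thesis
    using eigvals_eqI[OF u] assms by simp
qed

text \<open>Courant-Fischer by counting dimensions. The eigenvectors of \<open>A\<close> after
  position \<open>j\<close> and those of \<open>B\<close> before it are together fewer than the
  dimension, so some unit vector is orthogonal to all of them. There the form of \<open>A\<close> is
  at least its eigenvalue at \<open>j\<close>, and the form of \<open>B\<close> at most its
  own.\<close>

lemma eigvals_compare:
  fixes A B :: "complex ^ 'd ^ 'd"
  assumes hA: "hermitian A" and hB: "hermitian B" and j: "j < CARD('d)"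
    and le: "\<And>x. norm x = 1 \<Longrightarrow> Re (hinner (A *v x) x) \<le> Re (hinner (B *v x) x) + c"
  shows "eigvals A ! j \<le> eigvals B ! j + c"
proof -
  let ?N = "CARD('d)"
  obtain u where u: "orthoframe u" "\<And>a. a < ?N \<Longrightarrow> A *v u a = eigvals A ! a *\<^sub>R u a"
    by (rule spectral_theorem[OF hA]) blast
  obtain v where v: "orthoframe v" "\<And>a. a < ?N \<Longrightarrow> B *v v a = eigvals B ! a *\<^sub>R v a"
    by (rule spectral_theorem[OF hB]) blast
  let ?V = "u ` {j<..<?N} \<union> v ` {..<j}"
  have "card ?V \<le> card (u ` {j<..<?N}) + card (v ` {..<j})" by (rule card_Un_le)
  also have "\<dots> \<le> (?N - Suc j) + j"
    by (intro add_mono) (metis card_image_le finite_greaterThanLessThan card_greaterThanLessThan,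
        metis card_image_le finite_lessThan card_lessThan)
  also have "\<dots> < ?N" using j by simp
  finally obtain x where x: "norm x = 1" "\<forall>v\<in>?V. hinner x v = 0"
    using exists_unit_orthogonal[of ?V] by auto
  have "eigvals A ! j = (\<Sum>a<?N. eigvals A ! j * (cmod (hinner x (u a)))\<^sup>2)"
    using orthoframe_norm_expand[OF u(1), of x] x(1) by (simp flip: sum_distrib_left)
  also have "\<dots> \<le> (\<Sum>a<?N. eigvals A ! a * (cmod (hinner x (u a)))\<^sup>2)"
  proof (rule sum_mono)
    fix a assume "a \<in> {..<?N}"
    show "eigvals A ! j * (cmod (hinner x (u a)))\<^sup>2 \<le> eigvals A ! a * (cmod (hinner x (u a)))\<^sup>2"
    proof (cases "a \<le> j")
      case True
      then show ?thesis using eigvals_antimono[OF hA True j] by (simp add: mult_right_mono)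
    next
      case False
      then have "hinner x (u a) = 0" using x(2) \<open>a \<in> _\<close> by auto
      then show ?thesis by simp
    qed
  qed
  also have "\<dots> = Re (hinner (A *v x) x)"
    by (simp add: frame_quadratic_form[OF u])
  also have "\<dots> \<le> Re (hinner (B *v x) x) + c" by (rule le[OF x(1)])
  also have "Re (hinner (B *v x) x) = (\<Sum>a<?N. eigvals B ! a * (cmod (hinner x (v a)))\<^sup>2)"
    by (simp add: frame_quadratic_form[OF v])
  also have "\<dots> \<le> (\<Sum>a<?N. eigvals B ! j * (cmod (hinner x (v a)))\<^sup>2)"
  proof (rule sum_mono)
    fix a assume a: "a \<in> {..<?N}"
    show "eigvals B ! a * (cmod (hinner x (v a)))\<^sup>2 \<le> eigvals B ! j * (cmod (hinner x (v a)))\<^sup>2"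
    proof (cases "j \<le> a")
      case True
      then show ?thesis using eigvals_antimono[OF hB True] a by (simp add: mult_right_mono)
    next
      case False
      then have "hinner x (v a) = 0" using x(2) by auto
      then show ?thesis by simp
    qed
  qed
  also have "\<dots> = eigvals B ! j"
    using orthoframe_norm_expand[OF v(1), of x] x(1) by (simp flip: sum_distrib_left)
  finally show ?thesis by simp
qed

lemma norm_rank_one: "norm (rank_one w) = 1" if "norm w = 1"
proof -
  have "of_real ((norm (rank_one w))\<^sup>2) = trace (rank_one w ** rank_one w)"
    using norm_matrix_trace[of "rank_one w"] by simp
  also have "\<dots> = hinner (rank_one w *v w) w" by (rule trace_rank_one)
  also have "\<dots> = of_real 1" by (simp add: rank_one_mult hinner_simps hinner_self that)
  finally have "(norm (rank_one w))\<^sup>2 = 1" using of_real_eq_iff by blast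
  then show ?thesis by (simp add: power2_eq_1_iff) (smt (verit) norm_ge_zero)
qed

lemma Re_hinner_le_norm: "\<bar>Re (hinner (A *v x) x)\<bar> \<le> norm (A :: complex^'d^'d)" if "norm x = 1"
proof -
  have "trace (A ** rank_one x) = hinner (A *v x) x" by (rule trace_rank_one)
  then have "\<bar>Re (hinner (A *v x) x)\<bar> = \<bar>A \<bullet> rank_one x\<bar>"
    using inner_hermitian[of "rank_one x" A] by (simp add: hermitian_closed)
  also have "\<dots> \<le> norm A * norm (rank_one x)" by (rule Cauchy_Schwarz_ineq2)
  also have "norm (rank_one x) = 1" by (rule norm_rank_one[OF that])
  finally show ?thesis by simp
qed

text \<open>Weyl's inequality, with the Hilbert-Schmidt norm in place of the operator norm;
  continuity of the eigenvalues asks for no more.\<close>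

lemma eigvals_weyl:
  fixes A B :: "complex ^ 'd ^ 'd"
  assumes hA: "hermitian A" and hB: "hermitian B" and j: "j < CARD('d)"
  shows "\<bar>eigvals A ! j - eigvals B ! j\<bar> \<le> norm (A - B)"
proof -
  have "\<bar>Re (hinner (A *v x) x) - Re (hinner (B *v x) x)\<bar> \<le> norm (A - B)" if "norm x = 1" for x
    using Re_hinner_le_norm[OF that, of "A - B"] by (simp add: matrix_vector_mult_diff_rdistrib hinner_simps)
  then have "Re (hinner (A *v x) x) \<le> Re (hinner (B *v x) x) + norm (A - B)"
    "Re (hinner (B *v x) x) \<le> Re (hinner (A *v x) x) + norm (A - B)" if "norm x = 1" for x
    using that by (smt (verit))+
  then have "eigvals A ! j \<le> eigvals B ! j + norm (A - B)"
    "eigvals B ! j \<le> eigvals A ! j + norm (A - B)"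
    by (auto intro: eigvals_compare[OF hA hB j] eigvals_compare[OF hB hA j])
  then show ?thesis by linarith
qed

lemma eigvals_conj:
  fixes A :: "complex ^ 'd ^ 'd"
  assumes h: "hermitian A" and U: "unitary U"
  shows "eigvals (U ** A ** adj U) = eigvals A"
proof -
  obtain u \<mu> where u: "orthoframe u" "\<And>a. a < CARD('d) \<Longrightarrow> A *v u a = \<mu> a *\<^sub>R u a"
    "\<And>a b. a < CARD('d) \<Longrightarrow> b \<le> a \<Longrightarrow> \<mu> a \<le> \<mu> b"
    by (rule spectral_theorem_sorted[OF h]) blast
  have UU: "adj U ** U = mat 1" using U by (simp add: unitary_def)
  have "orthoframe (\<lambda>a. U *v u a)"
    using u(1) UU by (simp add: orthoframe_def hinner_adj matrix_vector_mul_assoc)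
  moreover have "U ** A ** adj U *v (U *v u a) = \<mu> a *\<^sub>R (U *v u a)" if "a < CARD('d)" for a
  proof -
    have "U ** A ** adj U *v (U *v u a) = U *v (A *v ((adj U ** U) *v u a))"
      by (simp add: matrix_vector_mul_assoc matrix_mul_assoc)
    then show ?thesis
      by (simp add: UU u(2)[OF that] matrix_vector_mult_scaleR_r)
  qed
  ultimately have "eigvals (U ** A ** adj U) = map \<mu> [0..<CARD('d)]"
    using u(3) by (intro eigvals_eqI) auto
  then show ?thesis using eigvals_eqI[OF u] by simp
qed

section \<open>Limits of matrix operations\<close>

lemma bounded_bilinear_matrix_mult:
  "bounded_bilinear ((**) :: complex^'d^'d \<Rightarrow> complex^'d^'d \<Rightarrow> complex^'d^'d)"
  by (subst bilinear_conv_bounded_bilinear[symmetric])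
    (auto simp: bilinear_def mat_distribs intro!: linearI)

lemma bounded_linear_trace: "bounded_linear (trace :: complex^'d^'d \<Rightarrow> complex)"
  by (subst linear_conv_bounded_linear[symmetric]) (auto simp: trace_simps intro!: linearI)

lemma bounded_linear_adj: "bounded_linear (adj :: complex^'d^'d \<Rightarrow> complex^'d^'d)"
  by (subst linear_conv_bounded_linear[symmetric]) (auto simp: adj_simps intro!: linearI)

lemmas tendsto_matrix_mult = bounded_bilinear.tendsto[OF bounded_bilinear_matrix_mult]
lemmas tendsto_trace = bounded_linear.tendsto[OF bounded_linear_trace]
lemmas tendsto_adj = bounded_linear.tendsto[OF bounded_linear_adj]

lemma cscale_diff_left: "cscale (a - b) M = cscale a M - cscale b M"
  by (simp add: vec_eq_iff algebra_simps)

lemma cscale_scaleR: "cscale (c *\<^sub>R z) M = c *\<^sub>R cscale z M"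
  by (simp add: vec_eq_iff)

lemma tendsto_cscale: "(f \<longlongrightarrow> c) F \<Longrightarrow> (g \<longlongrightarrow> M) F \<Longrightarrow> ((\<lambda>x. cscale (f x) (g x)) \<longlongrightarrow> cscale c (M :: complex^'d^'d)) F"
  unfolding cscale_def by (intro tendsto_vec_lambda tendsto_intros)

subsection \<open>Spectral projections of simple eigenvalues\<close>

definition simple_eig :: "nat \<Rightarrow> complex ^ 'd ^ 'd \<Rightarrow> bool" where
  "simple_eig j A \<longleftrightarrow> hermitian A \<and> j < CARD('d) \<and>
     (\<forall>a<CARD('d). a \<noteq> j \<longrightarrow> eigvals A ! a \<noteq> eigvals A ! j)"

text \<open>The phase is an arbitrary choice. Only the projection built from the vector is
  canonical, and only at a simple eigenvalue.\<close>

definition eigvec :: "nat \<Rightarrow> complex ^ 'd ^ 'd \<Rightarrow> complex ^ 'd" where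
  "eigvec j A = (SOME u. norm u = 1 \<and> A *v u = eigvals A ! j *\<^sub>R u)"

definition eigproj :: "nat \<Rightarrow> complex ^ 'd ^ 'd \<Rightarrow> complex ^ 'd ^ 'd" where
  "eigproj j A = rank_one (eigvec j A)"

text \<open>The reduced resolvent of perturbation theory: at a simple eigenvalue it inverts the
  eigenvalue minus \<open>A\<close> on the complement of the eigenline and vanishes on the
  eigenline. \<open>red_resolvent_eqI\<close> shows that the choice is then unique.\<close>

definition red_resolvent :: "nat \<Rightarrow> complex ^ 'd ^ 'd \<Rightarrow> complex ^ 'd ^ 'd" where
  "red_resolvent j A = (SOME S. adj S = S \<and> S ** eigproj j A = 0 \<and>
     S ** (eigvals A ! j *\<^sub>R mat 1 - A) = mat 1 - eigproj j A)"

lemma eigvec: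
  fixes A :: "complex ^ 'd ^ 'd"
  assumes "hermitian A" "j < CARD('d)"
  shows "norm (eigvec j A) = 1" "A *v eigvec j A = eigvals A ! j *\<^sub>R eigvec j A"
proof -
  obtain u where u: "orthoframe u" "\<And>a. a < CARD('d) \<Longrightarrow> A *v u a = eigvals A ! a *\<^sub>R u a"
    by (rule spectral_theorem[OF assms(1)]) blast
  then have "norm (u j) = 1 \<and> A *v u j = eigvals A ! j *\<^sub>R u j"
    using assms(2) orthoframe_norm by blast
  then have "norm (eigvec j A) = 1 \<and> A *v eigvec j A = eigvals A ! j *\<^sub>R eigvec j A"
    unfolding eigvec_def by (rule someI)
  then show "norm (eigvec j A) = 1" "A *v eigvec j A = eigvals A ! j *\<^sub>R eigvec j A"
    by auto
qed

lemma eigproj_basic: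
  fixes A :: "complex ^ 'd ^ 'd"
  assumes "hermitian A" "j < CARD('d)"
  shows "adj (eigproj j A) = eigproj j A" "eigproj j A ** eigproj j A = eigproj j A"
    "trace (eigproj j A) = 1" "norm (eigproj j A) = 1"
    "eigproj j A ** X ** eigproj j A = cscale (trace (X ** eigproj j A)) (eigproj j A)"
    "A ** eigproj j A = eigvals A ! j *\<^sub>R eigproj j A"
    "eigproj j A ** A = eigvals A ! j *\<^sub>R eigproj j A"
proof -
  note e = eigvec[OF assms]
  show a: "adj (eigproj j A) = eigproj j A" by (simp add: eigproj_def)
  show t: "trace (eigproj j A) = 1" by (simp add: eigproj_def trace_rank_one_self e)
  show "norm (eigproj j A) = 1" by (simp add: eigproj_def norm_rank_one e)
  show s: "eigproj j A ** X ** eigproj j A = cscale (trace (X ** eigproj j A)) (eigproj j A)" for X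
    by (simp add: eigproj_def rank_one_sandwich)
  show "eigproj j A ** eigproj j A = eigproj j A"
    using s[of "mat 1"] by (simp add: t)
  show b: "A ** eigproj j A = eigvals A ! j *\<^sub>R eigproj j A"
  proof -
    have "(A ** eigproj j A) *v x = (eigvals A ! j *\<^sub>R eigproj j A) *v x" for x
      by (simp add: eigproj_def rank_one_mult matrix_vector_mult_smult e scaleR_matrix_vector
          flip: matrix_vector_mul_assoc) (simp add: vec_eq_iff)
    then show ?thesis by (simp add: matrix_eq)
  qed
  have "adj (A ** eigproj j A) = adj (eigvals A ! j *\<^sub>R eigproj j A)" by (simp add: b)
  then show "eigproj j A ** A = eigvals A ! j *\<^sub>R eigproj j A"
    using assms(1) by (simp add: adj_simps a hermitianD)
qed

text \<open>In an eigenframe, simplicity removes every coefficient except the one at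
  \<open>j\<close>. Both \<open>v\<close> and the chosen \<open>eigvec j A\<close> are then
  multiples of the same frame vector, and the phase cancels.\<close>

lemma simple_eigenvector_unique:
  fixes A :: "complex ^ 'd ^ 'd"
  assumes s: "simple_eig j A" and v: "A *v v = eigvals A ! j *\<^sub>R v"
  shows "eigproj j A *v v = v"
proof -
  have h: "hermitian A" and j: "j < CARD('d)" using s by (auto simp: simple_eig_def)
  obtain w where w: "orthoframe w" "\<And>a. a < CARD('d) \<Longrightarrow> A *v w a = eigvals A ! a *\<^sub>R w a"
    by (rule spectral_theorem[OF h]) blast
  have key: "x = hinner x (w j) *s w j" if "A *v x = eigvals A ! j *\<^sub>R x" for x
  proof -
    have "hinner x (w a) = 0" if a: "a < CARD('d)" "a \<noteq> j" for a
    proof -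
      have "hinner (A *v x) (w a) = hinner x (A *v w a)"
        by (rule hinner_hermitian[OF h])
      then have "of_real (eigvals A ! j) * hinner x (w a) = of_real (eigvals A ! a) * hinner x (w a)"
        using \<open>A *v x = _\<close> w(2)[OF a(1)] by (simp add: hinner_simps)
      then show ?thesis
        using s a by (auto simp: simple_eig_def)
    qed
    then have "(\<Sum>a<CARD('d). hinner x (w a) *s w a) = (\<Sum>a<CARD('d). if a = j then hinner x (w j) *s w j else 0)"
      by (intro sum.cong) auto
    then show ?thesis
      using orthoframe_expand[OF w(1), of x] j by simp
  qed
  define u where "u = eigvec j A"
  have nu: "norm u = 1" and eu: "A *v u = eigvals A ! j *\<^sub>R u"
    using eigvec[OF h j] by (auto simp: u_def)
  have ku: "u = hinner u (w j) *s w j" by (rule key[OF eu])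
  have kv: "v = hinner v (w j) *s w j" by (rule key[OF v])
  have wj: "hinner (w j) (w j) = 1" using orthoframe_hinner[OF w(1) j j] by simp
  have c1: "hinner u (w j) * cnj (hinner u (w j)) = 1"
  proof -
    have "hinner u u = 1" using nu by (simp add: hinner_self)
    then show ?thesis using ku wj by (metis hinner_scale(1) hinner_scale(2) mult.right_neutral)
  qed
  have "eigproj j A *v v = hinner v u *s u"
    by (simp add: eigproj_def u_def rank_one_mult)
  also have "hinner v u = hinner (hinner v (w j) *s w j) (hinner u (w j) *s w j)"
    using ku kv by metis
  also have "\<dots> = hinner v (w j) * cnj (hinner u (w j))"
    by (simp add: hinner_simps wj)
  also have "\<dots> *s u = (hinner v (w j) * cnj (hinner u (w j))) *s (hinner u (w j) *s w j)"
    using ku by metis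
  also have "\<dots> = (hinner v (w j) * (hinner u (w j) * cnj (hinner u (w j)))) *s w j"
    by (simp add: vector_smult_assoc mult_ac)
  also have "\<dots> = v" using kv by (simp add: c1)
  finally show ?thesis .
qed

lemma simple_eigenmatrix_unique:
  fixes A :: "complex ^ 'd ^ 'd"
  assumes s: "simple_eig j A" and X: "A ** X = eigvals A ! j *\<^sub>R X"
  shows "eigproj j A ** X = X"
proof -
  have "(eigproj j A ** X) *v v = X *v v" for v
  proof -
    have "A *v (X *v v) = eigvals A ! j *\<^sub>R (X *v v)"
      by (simp add: matrix_vector_mul_assoc X scaleR_matrix_vector)
    then show ?thesis
      using simple_eigenvector_unique[OF s] by (simp flip: matrix_vector_mul_assoc)
  qed
  then show ?thesis by (simp add: matrix_eq)
qed

text \<open>A description of the projection without vectors. Unitary conjugation and complex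
  conjugation in an eigenbasis respect these equations, and this is how the projection is
  transported along them.\<close>

lemma eigproj_unique:
  fixes A :: "complex ^ 'd ^ 'd"
  assumes s: "simple_eig j A" and X: "A ** X = eigvals A ! j *\<^sub>R X" and a: "adj X = X" and t: "trace X = 1"
  shows "X = eigproj j A"
proof -
  let ?P = "eigproj j A"
  have h: "hermitian A" and j: "j < CARD('d)" using s by (auto simp: simple_eig_def)
  note P = eigproj_basic[OF h j]
  have PX: "?P ** X = X" by (rule simple_eigenmatrix_unique[OF s X])
  then have "adj (?P ** X) = adj X" by simp
  then have "X ** ?P = X" by (simp add: adj_simps a P)
  then have "X = cscale (trace (X ** ?P)) ?P"
    using P(5)[of X] PX by simp
  then show ?thesis by (simp add: \<open>X ** ?P = X\<close> t)
qed

lemma eigproj_eq_rank_one: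
  fixes A :: "complex ^ 'd ^ 'd"
  assumes s: "simple_eig j A" and v: "A *v v = eigvals A ! j *\<^sub>R v" "norm v = 1"
  shows "rank_one v = eigproj j A"
proof (rule eigproj_unique[OF s])
  show "trace (rank_one v) = 1" by (simp add: trace_rank_one_self v)
  have "(A ** rank_one v) *v x = (eigvals A ! j *\<^sub>R rank_one v) *v x" for x
    by (simp add: rank_one_mult matrix_vector_mult_smult v scaleR_matrix_vector
          flip: matrix_vector_mul_assoc) (simp add: vec_eq_iff)
  then show "A ** rank_one v = eigvals A ! j *\<^sub>R rank_one v" by (simp add: matrix_eq)
qed simp

text \<open>Built in an eigenframe from the inverse gaps. The norm bound is recorded because the
  reduced resolvents of nearby matrices must be known to be bounded before they can be shown to
  converge.\<close>

lemma red_resolvent_exists: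
  fixes A :: "complex ^ 'd ^ 'd"
  assumes s: "simple_eig j A" and g: "g > 0" "\<And>a. a < CARD('d) \<Longrightarrow> a \<noteq> j \<Longrightarrow> g \<le> \<bar>eigvals A ! j - eigvals A ! a\<bar>"
  shows "\<exists>S. adj S = S \<and> S ** eigproj j A = 0 \<and>
     S ** (eigvals A ! j *\<^sub>R mat 1 - A) = mat 1 - eigproj j A \<and> norm S \<le> CARD('d) / g"
proof -
  let ?N = "CARD('d)" and ?l = "eigvals A ! j"
  have h: "hermitian A" and j: "j < CARD('d)" using s by (auto simp: simple_eig_def)
  obtain w where w: "orthoframe w" "\<And>a. a < ?N \<Longrightarrow> A *v w a = eigvals A ! a *\<^sub>R w a"
    by (rule spectral_theorem[OF h]) blast
  define c where "c a = (if a = j then 0 else 1 / (?l - eigvals A ! a))" for a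
  define S where "S = (\<Sum>a<?N. c a *\<^sub>R rank_one (w a))"
  have P: "eigproj j A = rank_one (w j)"
    using eigproj_eq_rank_one[OF s w(2)[OF j]] orthoframe_norm[OF w(1) j] by simp
  have Sw: "S *v w b = c b *\<^sub>R w b" if "b < ?N" for b
  proof -
    have "S *v w b = (\<Sum>a<?N. if a = b then c b *\<^sub>R w b else 0)"
      unfolding S_def matrix_vector_mult_sum_l
      by (intro sum.cong refl)
        (use orthoframe_hinner[OF w(1) that] in \<open>auto simp: scaleR_matrix_vector rank_one_mult\<close>)
    then show ?thesis using that by simp
  qed
  have Pw: "eigproj j A *v w b = (if b = j then w b else 0)" if "b < ?N" for b
    using orthoframe_hinner[OF w(1) that j] by (simp add: P rank_one_mult)
  have a: "adj S = S" by (simp add: S_def adj_simps)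
  moreover have "S ** eigproj j A = 0"
    by (rule matrix_eqI_frame[OF w(1)])
      (auto simp: Pw Sw c_def simp flip: matrix_vector_mul_assoc)
  moreover have "S ** (?l *\<^sub>R mat 1 - A) = mat 1 - eigproj j A"
  proof (rule matrix_eqI_frame[OF w(1)])
    fix b assume b: "b < ?N"
    have "(S ** (?l *\<^sub>R mat 1 - A)) *v w b = S *v ((?l - eigvals A ! b) *\<^sub>R w b)"
      by (simp add: matrix_vector_mult_diff_rdistrib scaleR_matrix_vector w(2)[OF b] scaleR_diff_left
          flip: matrix_vector_mul_assoc)
    also have "\<dots> = ((?l - eigvals A ! b) * c b) *\<^sub>R w b"
      by (simp add: matrix_vector_mult_scaleR_r Sw[OF b])
    also have "\<dots> = (if b = j then 0 else w b)"
      using s b by (auto simp: c_def simple_eig_def)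
    finally show "(S ** (?l *\<^sub>R mat 1 - A)) *v w b = (mat 1 - eigproj j A) *v w b"
      by (simp add: matrix_vector_mult_diff_rdistrib Pw[OF b])
  qed
  moreover have "norm S \<le> (\<Sum>a<?N. 1 / g)"
    unfolding S_def
  proof (rule sum_norm_le)
    fix a assume a: "a \<in> {..<?N}"
    have "\<bar>c a\<bar> \<le> 1 / g"
    proof (cases "a = j")
      case False
      then have "g \<le> \<bar>?l - eigvals A ! a\<bar>" using g(2) a by simp
      then have "1 / \<bar>?l - eigvals A ! a\<bar> \<le> 1 / g" using g(1) by (intro frac_le) auto
      then show ?thesis using False by (simp add: c_def)
    qed (use g in \<open>simp add: c_def\<close>)
    then show "norm (c a *\<^sub>R rank_one (w a)) \<le> 1 / g"
      using a by (simp add: norm_rank_one orthoframe_norm[OF w(1)])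
  qed
  ultimately show ?thesis by auto
qed

lemma simple_eig_gap:
  fixes A :: "complex ^ 'd ^ 'd"
  assumes s: "simple_eig j A"
  obtains g where "g > 0" "\<And>a. a < CARD('d) \<Longrightarrow> a \<noteq> j \<Longrightarrow> g \<le> \<bar>eigvals A ! j - eigvals A ! a\<bar>"
proof -
  let ?I = "(\<lambda>a. \<bar>eigvals A ! j - eigvals A ! a\<bar>) ` ({..<CARD('d)} - {j})"
  \<comment> \<open>Inserting 1 keeps the minimum defined in dimension one, where there is no other
    eigenvalue.\<close>
  have "Min (insert 1 ?I) > 0"
    using s by (subst Min_gr_iff) (auto simp: simple_eig_def)
  moreover have "Min (insert 1 ?I) \<le> \<bar>eigvals A ! j - eigvals A ! a\<bar>" if "a < CARD('d)" "a \<noteq> j" for a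
    by (rule Min_le) (use that in auto)
  ultimately show thesis using that by blast
qed

lemma red_resolvent_unique:
  fixes A :: "complex ^ 'd ^ 'd"
  assumes "adj S = S" "S ** (l *\<^sub>R mat 1 - A) = mat 1 - P"
    and "S' ** P = 0" "S' ** (l *\<^sub>R mat 1 - A) = mat 1 - P" and "P ** S = 0" "adj A = A" "adj P = P"
  shows "S' = S"
proof -
  have "(l *\<^sub>R mat 1 - A) ** S = adj (S ** (l *\<^sub>R mat 1 - A))"
    using assms(1,6) by (simp add: adj_simps)
  also have "\<dots> = mat 1 - P" using assms(2,7) by (simp add: adj_simps)
  finally have "(l *\<^sub>R mat 1 - A) ** S = mat 1 - P" .
  then have "S' ** (mat 1 - P) = (mat 1 - P) ** S"
    using assms(4) by (metis matrix_mul_assoc)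
  then show ?thesis using assms by (simp add: mat_distribs)
qed

lemma red_resolvent:
  fixes A :: "complex ^ 'd ^ 'd"
  assumes s: "simple_eig j A"
  shows "adj (red_resolvent j A) = red_resolvent j A" "red_resolvent j A ** eigproj j A = 0"
    "eigproj j A ** red_resolvent j A = 0"
    "red_resolvent j A ** (eigvals A ! j *\<^sub>R mat 1 - A) = mat 1 - eigproj j A"
    "(eigvals A ! j *\<^sub>R mat 1 - A) ** red_resolvent j A = mat 1 - eigproj j A"
proof -
  have h: "hermitian A" and j: "j < CARD('d)" using s by (auto simp: simple_eig_def)
  let ?S = "red_resolvent j A"
  obtain g where g: "g > 0" "\<And>a. a < CARD('d) \<Longrightarrow> a \<noteq> j \<Longrightarrow> g \<le> \<bar>eigvals A ! j - eigvals A ! a\<bar>"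
    using simple_eig_gap[OF s] by blast
  have "\<exists>S. adj S = S \<and> S ** eigproj j A = 0 \<and> S ** (eigvals A ! j *\<^sub>R mat 1 - A) = mat 1 - eigproj j A"
    using red_resolvent_exists[OF s g] by blast
  then have S: "adj ?S = ?S \<and> ?S ** eigproj j A = 0 \<and> ?S ** (eigvals A ! j *\<^sub>R mat 1 - A) = mat 1 - eigproj j A"
    unfolding red_resolvent_def by (rule someI_ex)
  then show "adj ?S = ?S" "?S ** eigproj j A = 0" "?S ** (eigvals A ! j *\<^sub>R mat 1 - A) = mat 1 - eigproj j A"
    by auto
  note P = eigproj_basic[OF h j]
  have "eigproj j A ** ?S = adj (?S ** eigproj j A)"
    by (simp add: adj_mult conjunct1[OF S] P(1))
  then show "eigproj j A ** ?S = 0" using S by simp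
  have "(eigvals A ! j *\<^sub>R mat 1 - A) ** ?S = adj (?S ** (eigvals A ! j *\<^sub>R mat 1 - A))"
    using conjunct1[OF S] h by (simp add: adj_simps hermitianD)
  also have "\<dots> = adj (mat 1 - eigproj j A)" using S by simp
  finally show "(eigvals A ! j *\<^sub>R mat 1 - A) ** ?S = mat 1 - eigproj j A"
    using P(1) by (simp add: adj_simps)
qed

lemma red_resolvent_eqI:
  fixes A :: "complex ^ 'd ^ 'd"
  assumes s: "simple_eig j A" and S: "S ** eigproj j A = 0"
    "S ** (eigvals A ! j *\<^sub>R mat 1 - A) = mat 1 - eigproj j A"
  shows "S = red_resolvent j A"
proof (rule red_resolvent_unique[OF red_resolvent(1,4)[OF s] S red_resolvent(3)[OF s]])
  show "adj A = A" "adj (eigproj j A) = eigproj j A"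
    using s eigproj_basic(1)[of A j] by (auto simp: simple_eig_def hermitianD)
qed

lemma red_resolvent_norm:
  fixes A :: "complex ^ 'd ^ 'd"
  assumes s: "simple_eig j A" and g: "g > 0" "\<And>a. a < CARD('d) \<Longrightarrow> a \<noteq> j \<Longrightarrow> g \<le> \<bar>eigvals A ! j - eigvals A ! a\<bar>"
  shows "norm (red_resolvent j A) \<le> CARD('d) / g"
  using red_resolvent_exists[OF s g] red_resolvent_eqI[OF s] by blast

subsection \<open>Perturbation theory\<close>

lemma eigvals_tendsto:
  fixes A :: "complex ^ 'd ^ 'd"
  assumes h: "hermitian A" and h': "\<forall>\<^sub>F x in F. hermitian (A' x)" and lim: "(A' \<longlongrightarrow> A) F"
    and a: "a < CARD('d)"
  shows "((\<lambda>x. eigvals (A' x) ! a) \<longlongrightarrow> eigvals A ! a) F"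
proof -
  have "\<forall>\<^sub>F x in F. norm (eigvals (A' x) ! a - eigvals A ! a) \<le> norm (A' x - A)"
    using h' by eventually_elim (unfold real_norm_def, rule eigvals_weyl[OF _ h a])
  moreover have "((\<lambda>x. norm (A' x - A)) \<longlongrightarrow> 0) F"
    using lim by (simp add: Lim_null[of A'] tendsto_norm_zero)
  ultimately have "((\<lambda>x. eigvals (A' x) ! a - eigvals A ! a) \<longlongrightarrow> 0) F"
    by (rule Lim_null_comparison)
  then show ?thesis by (rule Lim_null[THEN iffD2])
qed

context
  fixes A :: "complex ^ 'd ^ 'd" and A' :: "'x \<Rightarrow> complex ^ 'd ^ 'd" and F :: "'x filter" and j :: nat
  assumes s: "simple_eig j A" and s': "\<forall>\<^sub>F x in F. simple_eig j (A' x)" and lim: "(A' \<longlongrightarrow> A) F"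
begin

private abbreviation "P \<equiv> eigproj j A"
private abbreviation "P' x \<equiv> eigproj j (A' x)"
private abbreviation "S \<equiv> red_resolvent j A"
private abbreviation "S' x \<equiv> red_resolvent j (A' x)"
private abbreviation "l \<equiv> eigvals A ! j"
private abbreviation "l' x \<equiv> eigvals (A' x) ! j"

private lemma h: "hermitian A" and j: "j < CARD('d)"
  using s by (auto simp: simple_eig_def)

private lemma h': "\<forall>\<^sub>F x in F. hermitian (A' x)"
  using s' by eventually_elim (simp add: simple_eig_def)

lemma eigvals_tendsto_simple:
  assumes a: "a < CARD('d)"
  shows "((\<lambda>x. eigvals (A' x) ! a) \<longlongrightarrow> eigvals A ! a) F"
  by (rule eigvals_tendsto[OF h h' lim a])

text \<open>Apply \<open>S ** (l *\<^sub>R mat 1 - A) = mat 1 - P\<close> to \<open>P' x\<close>, an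
  eigenmatrix of \<open>A' x\<close>. The part of \<open>P' x\<close> outside the range of
  \<open>P\<close> is thus expressed exactly through the changes of eigenvalue and matrix, with no
  remainder term.\<close>

lemma eigproj_defect:
  "\<forall>\<^sub>F x in F. P' x - P ** P' x = (l - l' x) *\<^sub>R (S ** P' x) + S ** (A' x - A) ** P' x"
  using h'
proof eventually_elim
  case (elim x)
  note P' = eigproj_basic[OF elim j]
  have "P' x - P ** P' x = (mat 1 - P) ** P' x" by (simp add: mat_distribs)
  also have "\<dots> = S ** ((l *\<^sub>R mat 1 - A) ** P' x)"
    by (simp add: red_resolvent(4)[OF s] matrix_mul_assoc)
  also have "(l *\<^sub>R mat 1 - A) ** P' x = (l - l' x) *\<^sub>R P' x + (A' x - A) ** P' x"
    by (simp add: mat_distribs P'(6) scaleR_diff_left)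
  finally show ?case by (simp add: mat_distribs matrix_mul_assoc)
qed

private lemma P'_bdd: "\<forall>\<^sub>F x in F. norm (P' x) \<le> 1"
  using h' by eventually_elim (simp add: eigproj_basic[OF _ j])

text \<open>The defect alone determines \<open>P' x - P\<close>. Adding \<open>P\<close> times its
  adjoint gives \<open>P' x - P ** P' x ** P\<close>, which is \<open>P' x\<close> minus a multiple
  of \<open>P\<close>, and its trace tells how far that multiple is from 1. Limits and derivatives
  of the projection thereby reduce to those of the defect.\<close>

lemma eigproj_decomp:
  "\<forall>\<^sub>F x in F. P' x - P = (P' x - P ** P' x) + P ** adj (P' x - P ** P' x)
      - cscale (trace ((P' x - P ** P' x) + P ** adj (P' x - P ** P' x))) P"
  using h'
proof eventually_elim
  case (elim x)
  note P' = eigproj_basic[OF elim j] and P = eigproj_basic[OF h j]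
  let ?D = "(P' x - P ** P' x) + P ** adj (P' x - P ** P' x)"
  have D: "?D = P' x - cscale (trace (P' x ** P)) P"
    using P(5)[of "P' x"] by (simp add: mat_distribs adj_simps P P' matrix_mul_assoc)
  have "trace ?D = trace (P' x - cscale (trace (P' x ** P)) P)"
    by (simp only: D)
  then have "trace ?D = 1 - trace (P' x ** P)"
    by (simp only: trace_simps trace_cscale P P' mult_1_right)
  then show ?case
    unfolding D by (simp add: cscale_diff_left)
qed

lemma eigproj_tendsto: "(P' \<longlongrightarrow> P) F"
proof -
  have "((\<lambda>x. (l - l' x) *\<^sub>R S + S ** (A' x - A)) \<longlongrightarrow> (l - l) *\<^sub>R S + S ** (A - A)) F"
    by (intro tendsto_intros tendsto_matrix_mult lim eigvals_tendsto_simple j)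
  then have z: "((\<lambda>x. (l - l' x) *\<^sub>R S + S ** (A' x - A)) \<longlongrightarrow> 0) F" by simp
  \<comment> \<open>At this point \<open>P'\<close> is only known to be bounded, hence the product
    of a vanishing and a bounded factor.\<close>
  have "((\<lambda>x. ((l - l' x) *\<^sub>R S + S ** (A' x - A)) ** P' x) \<longlongrightarrow> 0) F"
  proof (rule bounded_bilinear.Zfun_prod_Bfun[OF bounded_bilinear_matrix_mult, folded tendsto_Zfun_iff[of _ 0, simplified]])
    show "((\<lambda>x. (l - l' x) *\<^sub>R S + S ** (A' x - A)) \<longlongrightarrow> 0) F" by (rule z)
    show "Bfun P' F" using P'_bdd by (rule BfunI)
  qed
  then have d: "((\<lambda>x. P' x - P ** P' x) \<longlongrightarrow> 0) F"
    by (rule Lim_transform_eventually)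
      (use eigproj_defect in eventually_elim, simp add: mat_distribs)
  have "((\<lambda>x. (P' x - P ** P' x) + P ** adj (P' x - P ** P' x)
      - cscale (trace ((P' x - P ** P' x) + P ** adj (P' x - P ** P' x))) P) \<longlongrightarrow>
      0 + P ** adj 0 - cscale (trace (0 + P ** adj 0)) P) F"
    by (intro tendsto_intros tendsto_matrix_mult tendsto_cscale tendsto_trace tendsto_adj d)
  then have "((\<lambda>x. (P' x - P ** P' x) + P ** adj (P' x - P ** P' x)
      - cscale (trace ((P' x - P ** P' x) + P ** adj (P' x - P ** P' x))) P) \<longlongrightarrow> 0) F"
    by simp
  then have "((\<lambda>x. P' x - P) \<longlongrightarrow> 0) F"
    by (rule Lim_transform_eventually) (use eigproj_decomp in eventually_elim, auto)
  then show ?thesis by (simp add: Lim_null[of P'])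
qed

private lemma resolvent_sum:
  "simple_eig j (B :: complex^'d^'d) \<Longrightarrow> (red_resolvent j B + eigproj j B) ** (eigvals B ! j *\<^sub>R mat 1 - B + eigproj j B) = mat 1"
  "simple_eig j (B :: complex^'d^'d) \<Longrightarrow> (eigvals B ! j *\<^sub>R mat 1 - B + eigproj j B) ** (red_resolvent j B + eigproj j B) = mat 1"
proof -
  assume sB: "simple_eig j B"
  then have hB: "hermitian B" by (simp add: simple_eig_def)
  note P = eigproj_basic[OF hB j] and S = red_resolvent[OF sB]
  show "(red_resolvent j B + eigproj j B) ** (eigvals B ! j *\<^sub>R mat 1 - B + eigproj j B) = mat 1"
    using S(4) by (simp add: matrix_add_ldistrib matrix_add_rdistrib S P) (simp add: mat_distribs P)
  show "(eigvals B ! j *\<^sub>R mat 1 - B + eigproj j B) ** (red_resolvent j B + eigproj j B) = mat 1"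
    using S(5) by (simp add: matrix_add_ldistrib matrix_add_rdistrib S P) (simp add: mat_distribs P)
qed

text \<open>The reduced resolvent is singular, but \<open>S + P\<close> is the inverse of
  \<open>l *\<^sub>R mat 1 - A + P\<close>. This is the second resolvent identity for two such
  inverses.\<close>

lemma red_resolvent_defect:
  "\<forall>\<^sub>F x in F. (S' x + P' x) - (S + P)
     = (S' x + P' x) ** ((l - l' x) *\<^sub>R mat 1 + (A' x - A) - (P' x - P)) ** (S + P)"
  using s'
proof eventually_elim
  case (elim x)
  let ?R' = "S' x + P' x" and ?B' = "l' x *\<^sub>R mat 1 - A' x + P' x" and ?R = "S + P" and ?B = "l *\<^sub>R mat 1 - A + P"
  have "?R' ** (?B - ?B') ** ?R = ?R' ** (?B ** ?R) - (?R' ** ?B') ** ?R"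
    by (simp add: matrix_diff_ldistrib matrix_diff_rdistrib matrix_mul_assoc)
  also have "\<dots> = ?R' - ?R"
    by (simp only: resolvent_sum[OF s] resolvent_sum[OF elim] matrix_mul_lid matrix_mul_rid)
  finally have "?R' - ?R = ?R' ** (?B - ?B') ** ?R" by simp
  also have "?B - ?B' = (l - l' x) *\<^sub>R mat 1 + (A' x - A) - (P' x - P)"
    by (simp add: scaleR_diff_left)
  finally show ?case .
qed

lemma red_resolvent_tendsto: "(S' \<longlongrightarrow> S) F"
proof -
  obtain g where g: "g > 0" "\<And>a. a < CARD('d) \<Longrightarrow> a \<noteq> j \<Longrightarrow> g \<le> \<bar>l - eigvals A ! a\<bar>"
    using simple_eig_gap[OF s] by blast
  \<comment> \<open>Half of the gap persists nearby, which bounds \<open>S'\<close> uniformly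
    through \<open>red_resolvent_norm\<close>.\<close>
  have "\<forall>\<^sub>F x in F. \<forall>a\<in>{..<CARD('d)}. a \<noteq> j \<longrightarrow> g / 2 < \<bar>l' x - eigvals (A' x) ! a\<bar>"
  proof (intro eventually_ball_finite ballI)
    fix a assume a: "a \<in> {..<CARD('d)}"
    show "\<forall>\<^sub>F x in F. a \<noteq> j \<longrightarrow> g / 2 < \<bar>l' x - eigvals (A' x) ! a\<bar>"
    proof (cases "a = j")
      case False
      have "((\<lambda>x. \<bar>l' x - eigvals (A' x) ! a\<bar>) \<longlongrightarrow> \<bar>l - eigvals A ! a\<bar>) F"
        using a j by (intro tendsto_intros eigvals_tendsto_simple) auto
      moreover have "g / 2 < \<bar>l - eigvals A ! a\<bar>" using g(1) g(2)[of a] a False by auto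
      ultimately have "\<forall>\<^sub>F x in F. g / 2 < \<bar>l' x - eigvals (A' x) ! a\<bar>" by (rule order_tendstoD(1))
      then show ?thesis by eventually_elim simp
    qed simp
  qed simp
  then have bS: "\<forall>\<^sub>F x in F. norm (S' x + P' x) \<le> CARD('d) / (g / 2) + 1"
    using s' P'_bdd
  proof eventually_elim
    case (elim x)
    have "norm (S' x) \<le> CARD('d) / (g / 2)"
      using elim g(1) by (intro red_resolvent_norm) (auto simp: less_imp_le)
    then show ?case using elim(3) norm_triangle_ineq[of "S' x" "P' x"] by linarith
  qed
  have "((\<lambda>x. ((l - l' x) *\<^sub>R mat 1 + (A' x - A) - (P' x - P)) ** (S + P)) \<longlongrightarrow>
      ((l - l) *\<^sub>R mat 1 + (A - A) - (P - P)) ** (S + P)) F"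
    by (intro tendsto_intros tendsto_matrix_mult lim eigvals_tendsto_simple j eigproj_tendsto)
  then have z: "((\<lambda>x. ((l - l' x) *\<^sub>R mat 1 + (A' x - A) - (P' x - P)) ** (S + P)) \<longlongrightarrow> 0) F" by simp
  have "((\<lambda>x. (S' x + P' x) ** (((l - l' x) *\<^sub>R mat 1 + (A' x - A) - (P' x - P)) ** (S + P))) \<longlongrightarrow> 0) F"
  proof (rule bounded_bilinear.Bfun_prod_Zfun[OF bounded_bilinear_matrix_mult, folded tendsto_Zfun_iff[of _ 0, simplified]])
    show "Bfun (\<lambda>x. S' x + P' x) F" using bS by (rule BfunI)
  qed (rule z)
  then have "((\<lambda>x. (S' x + P' x) - (S + P)) \<longlongrightarrow> 0) F"
    by (rule Lim_transform_eventually)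
      (use red_resolvent_defect in eventually_elim, simp add: matrix_mul_assoc)
  then have "((\<lambda>x. S' x + P' x) \<longlongrightarrow> S + P) F" by (simp add: Lim_null[of "\<lambda>x. S' x + P' x"])
  then have "((\<lambda>x. (S' x + P' x) - P' x) \<longlongrightarrow> (S + P) - P) F"
    by (intro tendsto_diff eigproj_tendsto)
  then show ?thesis by simp
qed

end

lemma has_vector_derivative_quotient:
  fixes f :: "real \<Rightarrow> 'a::real_normed_vector"
  shows "(f has_vector_derivative d) (at 0) \<longleftrightarrow> ((\<lambda>t. (f t - f 0) /\<^sub>R t) \<longlongrightarrow> d) (at 0)"
proof -
  have "(f has_vector_derivative d) (at 0) \<longleftrightarrow>
      ((\<lambda>t. norm (f t - f 0 - t *\<^sub>R d) / norm t) \<longlongrightarrow> 0) (at 0)"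
    by (simp add: has_vector_derivative_def has_derivative_at bounded_linear_scaleR_left)
  also have "\<dots> \<longleftrightarrow> ((\<lambda>t. norm ((f t - f 0) /\<^sub>R t - d)) \<longlongrightarrow> 0) (at 0)"
  proof (rule filterlim_cong[OF refl refl])
    have "\<forall>\<^sub>F t::real in at 0. t \<noteq> 0" by (auto simp: eventually_at_filter)
    then show "\<forall>\<^sub>F t in at 0. norm (f t - f 0 - t *\<^sub>R d) / norm t = norm ((f t - f 0) /\<^sub>R t - d)"
    proof eventually_elim
      case (elim t)
      have "(f t - f 0) /\<^sub>R t - d = (f t - f 0 - t *\<^sub>R d) /\<^sub>R t"
        using elim by (simp add: scaleR_diff_right)
      then show ?case by (simp add: divide_inverse mult.commute)
    qed
  qed
  also have "\<dots> \<longleftrightarrow> ((\<lambda>t. (f t - f 0) /\<^sub>R t) \<longlongrightarrow> d) (at 0)"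
    by (metis (no_types) Lim_null tendsto_norm_zero_iff)
  finally show ?thesis .
qed

lemma simple_eig_eventually:
  fixes A :: "complex ^ 'd ^ 'd"
  assumes s: "simple_eig j A" and hA': "\<forall>\<^sub>F x in F. hermitian (A' x)" and lim: "(A' \<longlongrightarrow> A) F"
  shows "\<forall>\<^sub>F x in F. simple_eig j (A' x)"
proof -
  have h: "hermitian A" and j: "j < CARD('d)" using s by (auto simp: simple_eig_def)
  have "\<forall>\<^sub>F x in F. \<forall>a\<in>{..<CARD('d)}. a \<noteq> j \<longrightarrow> eigvals (A' x) ! a \<noteq> eigvals (A' x) ! j"
  proof (intro eventually_ball_finite ballI)
    fix a assume a: "a \<in> {..<CARD('d)}"
    show "\<forall>\<^sub>F x in F. a \<noteq> j \<longrightarrow> eigvals (A' x) ! a \<noteq> eigvals (A' x) ! j"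
    proof (cases "a = j")
      case False
      have "((\<lambda>x. eigvals (A' x) ! a - eigvals (A' x) ! j) \<longlongrightarrow> eigvals A ! a - eigvals A ! j) F"
        using a j by (intro tendsto_diff eigvals_tendsto[OF h hA' lim]) auto
      moreover have "eigvals A ! a - eigvals A ! j \<noteq> 0" using s a False by (auto simp: simple_eig_def)
      ultimately have "\<forall>\<^sub>F x in F. eigvals (A' x) ! a - eigvals (A' x) ! j \<noteq> 0"
        by (rule tendsto_imp_eventually_ne)
      then show ?thesis by eventually_elim simp
    qed simp
  qed simp
  with hA' show ?thesis
    by eventually_elim (use j in \<open>auto simp: simple_eig_def\<close>)
qed

lemma simple_eig_line:
  fixes A :: "complex ^ 'd ^ 'd"
  assumes s: "simple_eig j A" and Y: "hermitian Y"
  shows "\<forall>\<^sub>F t in at (0::real). simple_eig j (A + t *\<^sub>R Y)"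
proof (rule simple_eig_eventually[OF s])
  have "hermitian A" using s by (simp add: simple_eig_def)
  then show "\<forall>\<^sub>F t in at (0::real). hermitian (A + t *\<^sub>R Y)"
    by (intro always_eventually allI hermitian_closed Y)
  show "((\<lambda>t. A + t *\<^sub>R Y) \<longlongrightarrow> A) (at (0::real))"
    by (rule tendsto_eq_intros refl | simp)+
qed

text \<open>First-order perturbation theory. The exact identities for the projection and the
  resolvent are divided by \<open>t\<close>, so each derivative is a limit of products of quantities
  already known to converge. All three derivatives are again polynomial in \<open>P\<close>,
  \<open>S\<close>, \<open>Y\<close> and real parts of traces of such products, which later closes a
  class of functions under differentiation.\<close>

lemma simple_eig_derivatives:
  fixes A :: "complex ^ 'd ^ 'd"
  assumes s: "simple_eig j A" and Y: "hermitian Y"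
  defines "P \<equiv> eigproj j A" and "S \<equiv> red_resolvent j A"
  defines "lY \<equiv> Re (trace (P ** Y))" and "PY \<equiv> S ** Y ** P + P ** Y ** S"
  shows "((\<lambda>t. eigvals (A + t *\<^sub>R Y) ! j) has_vector_derivative lY) (at 0)"
    and "((\<lambda>t. eigproj j (A + t *\<^sub>R Y)) has_vector_derivative PY) (at 0)"
    and "((\<lambda>t. red_resolvent j (A + t *\<^sub>R Y)) has_vector_derivative
      (S + P) ** (Y - lY *\<^sub>R mat 1 - PY) ** (S + P) - PY) (at 0)"
proof -
  have h: "hermitian A" and j: "j < CARD('d)" using s by (auto simp: simple_eig_def)
  have hh: "hermitian (A + t *\<^sub>R Y)" for t by (intro hermitian_closed h Y)
  define l where "l = eigvals A ! j"
  define l' where "l' t = eigvals (A + t *\<^sub>R Y) ! j" for t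
  define P' where "P' t = eigproj j (A + t *\<^sub>R Y)" for t
  define S' where "S' t = red_resolvent j (A + t *\<^sub>R Y)" for t
  have lim: "((\<lambda>t. A + t *\<^sub>R Y) \<longlongrightarrow> A) (at (0::real))"
    by (rule tendsto_eq_intros refl | simp)+
  note ev = simple_eig_line[OF s Y]
  note P = eigproj_basic[OF h j, folded P_def]
  note S = red_resolvent[OF s, folded P_def S_def]
  have nz: "\<forall>\<^sub>F t::real in at 0. t \<noteq> 0" by (auto simp: eventually_at_filter)
  have limP: "(P' \<longlongrightarrow> P) (at 0)"
    using eigproj_tendsto[OF s ev lim] by (simp add: P'_def[abs_def] P_def)
  have limS: "(S' \<longlongrightarrow> S) (at 0)"
    using red_resolvent_tendsto[OF s ev lim] by (simp add: S'_def[abs_def] S_def)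
  have trPP: "((\<lambda>t. trace (P' t ** P)) \<longlongrightarrow> 1) (at 0)"
    using tendsto_trace[OF tendsto_matrix_mult[OF limP tendsto_const[of P]]] by (simp add: P)
  have lq: "((\<lambda>t. (l' t - l) /\<^sub>R t) \<longlongrightarrow> lY) (at 0)"
  proof -
    \<comment> \<open>Evaluating \<open>P' t ** (A + t *\<^sub>R Y) ** P\<close> from both sides
      shows that this ratio is exactly the difference quotient of the eigenvalue once the
      denominator is nonzero. Only continuity of the projection enters.\<close>
    have "((\<lambda>t. Re (trace (P' t ** Y ** P) / trace (P' t ** P))) \<longlongrightarrow> Re (trace (P ** Y ** P) / 1)) (at 0)"
      by (intro tendsto_intros tendsto_trace tendsto_matrix_mult limP trPP) simp
    moreover have "trace (P ** Y ** P) = trace (P ** Y)"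
      by (metis P(2) matrix_mul_assoc trace_mul_sym)
    ultimately have "((\<lambda>t. Re (trace (P' t ** Y ** P) / trace (P' t ** P))) \<longlongrightarrow> lY) (at 0)"
      by (simp add: lY_def)
    then show ?thesis
    proof (rule Lim_transform_eventually)
      have "\<forall>\<^sub>F t in at 0. trace (P' t ** P) \<noteq> 0"
        using tendsto_imp_eventually_ne[OF trPP] by simp
      then show "\<forall>\<^sub>F t in at 0. Re (trace (P' t ** Y ** P) / trace (P' t ** P)) = (l' t - l) /\<^sub>R t"
        using nz
      proof eventually_elim
        case (elim t)
        have "P' t ** (A + t *\<^sub>R Y) ** P = l' t *\<^sub>R (P' t ** P)"
          using eigproj_basic(7)[OF hh j] by (simp add: P'_def l'_def mat_distribs)
        then have "P' t ** A ** P + t *\<^sub>R (P' t ** Y ** P) = l' t *\<^sub>R (P' t ** P)"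
          by (simp add: mat_distribs)
        moreover have "P' t ** A ** P = l *\<^sub>R (P' t ** P)"
          using P(6) by (simp add: l_def mat_distribs flip: matrix_mul_assoc)
        ultimately have "t *\<^sub>R (P' t ** Y ** P) = (l' t - l) *\<^sub>R (P' t ** P)"
          by (simp add: algebra_simps)
        then have "trace (t *\<^sub>R (P' t ** Y ** P)) = trace ((l' t - l) *\<^sub>R (P' t ** P))" by simp
        then have "of_real t * trace (P' t ** Y ** P) = of_real (l' t - l) * trace (P' t ** P)"
          by (simp only: trace_simps scaleR_conv_of_real[where 'a=complex])
        then have "trace (P' t ** Y ** P) / trace (P' t ** P) = of_real ((l' t - l) / t)"
          using elim by (simp add: field_simps)
        then have "Re (trace (P' t ** Y ** P) / trace (P' t ** P)) = (l' t - l) / t"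
          by (simp only: Re_complex_of_real)
        then show ?case by (simp add: divide_inverse mult.commute)
      qed
    qed
  qed
  then show "((\<lambda>t. eigvals (A + t *\<^sub>R Y) ! j) has_vector_derivative lY) (at 0)"
    by (simp add: has_vector_derivative_quotient l'_def l_def)
  have dq: "((\<lambda>t. (P' t - P ** P' t) /\<^sub>R t) \<longlongrightarrow> S ** Y ** P) (at 0)"
  proof -
    have "((\<lambda>t. - ((l' t - l) /\<^sub>R t) *\<^sub>R (S ** P' t) + S ** Y ** P' t) \<longlongrightarrow> - lY *\<^sub>R (S ** P) + S ** Y ** P) (at 0)"
      by (intro tendsto_intros tendsto_matrix_mult limP lq)
    then have "((\<lambda>t. - ((l' t - l) /\<^sub>R t) *\<^sub>R (S ** P' t) + S ** Y ** P' t) \<longlongrightarrow> S ** Y ** P) (at 0)"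
      by (simp add: S)
    then show ?thesis
    proof (rule Lim_transform_eventually)
      show "\<forall>\<^sub>F t in at 0. - ((l' t - l) /\<^sub>R t) *\<^sub>R (S ** P' t) + S ** Y ** P' t = (P' t - P ** P' t) /\<^sub>R t"
        using eigproj_defect[OF s ev lim, folded P_def S_def l_def l'_def P'_def] nz
      proof eventually_elim
        case (elim t)
        have "- ((l' t - l) /\<^sub>R t) = (l - l' t) /\<^sub>R t" by (simp add: algebra_simps)
        moreover have "(P' t - P ** P' t) = (l - l' t) *\<^sub>R (S ** P' t) + t *\<^sub>R (S ** Y ** P' t)"
          unfolding elim(1) by (simp add: mat_distribs)
        ultimately show ?case
          using elim(2) by (simp add: scaleR_add_right mult.commute)
      qed
    qed
  qed
  let ?E = "\<lambda>t. (P' t - P ** P' t) /\<^sub>R t"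
  have Pq: "((\<lambda>t. (P' t - P) /\<^sub>R t) \<longlongrightarrow> PY) (at 0)"
  proof -
    have "((\<lambda>t. ?E t + P ** adj (?E t) - cscale (trace (?E t + P ** adj (?E t))) P) \<longlongrightarrow>
        S ** Y ** P + P ** adj (S ** Y ** P) - cscale (trace (S ** Y ** P + P ** adj (S ** Y ** P))) P) (at 0)"
      by (intro tendsto_intros tendsto_matrix_mult tendsto_cscale tendsto_trace tendsto_adj dq)
    moreover have "P ** adj (S ** Y ** P) = P ** Y ** S"
      by (simp add: adj_simps P S hermitianD[OF Y] matrix_mul_assoc)
    \<comment> \<open>\<open>S\<close> and \<open>P\<close> annihilate each other, so the trace
      correction of \<open>eigproj_decomp\<close> disappears in the limit.\<close>
    moreover have "trace (S ** Y ** P) = 0" "trace (P ** Y ** S) = 0"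
      using trace_cycle3[of S Y P] trace_cycle3[of P Y S] by (simp_all add: S)
    ultimately have "((\<lambda>t. ?E t + P ** adj (?E t) - cscale (trace (?E t + P ** adj (?E t))) P) \<longlongrightarrow> PY) (at 0)"
      by (simp add: PY_def trace_simps)
    then show ?thesis
    proof (rule Lim_transform_eventually)
      show "\<forall>\<^sub>F t in at 0. ?E t + P ** adj (?E t) - cscale (trace (?E t + P ** adj (?E t))) P = (P' t - P) /\<^sub>R t"
        using eigproj_decomp[OF s ev lim, folded P_def S_def l_def l'_def P'_def] nz
      proof eventually_elim
        case (elim t)
        let ?X = "P' t - P ** P' t"
        have "?E t + P ** adj (?E t) = (?X + P ** adj ?X) /\<^sub>R t"
          by (simp only: adj_scaleR matrix_scaleR_right scaleR_add_right)
        then have "?E t + P ** adj (?E t) - cscale (trace (?E t + P ** adj (?E t))) P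
          = ((?X + P ** adj ?X) - cscale (trace (?X + P ** adj ?X)) P) /\<^sub>R t"
          by (simp only: trace_scaleR cscale_scaleR scaleR_diff_right)
        then show ?case by (simp only: flip: elim(1))
      qed
    qed
  qed
  then show "((\<lambda>t. eigproj j (A + t *\<^sub>R Y)) has_vector_derivative PY) (at 0)"
    by (simp add: has_vector_derivative_quotient P'_def P_def)
  have "((\<lambda>t. (S' t + P' t) ** (- ((l' t - l) /\<^sub>R t) *\<^sub>R mat 1 + Y - (P' t - P) /\<^sub>R t) ** (S + P) - (P' t - P) /\<^sub>R t)
     \<longlongrightarrow> (S + P) ** (- lY *\<^sub>R mat 1 + Y - PY) ** (S + P) - PY) (at 0)"
    by (intro tendsto_intros tendsto_matrix_mult limP limS lq Pq)
  moreover have "- lY *\<^sub>R mat 1 + Y - PY = Y - lY *\<^sub>R mat 1 - PY" by simp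
  ultimately have "((\<lambda>t. (S' t + P' t) ** (- ((l' t - l) /\<^sub>R t) *\<^sub>R mat 1 + Y - (P' t - P) /\<^sub>R t) ** (S + P) - (P' t - P) /\<^sub>R t)
     \<longlongrightarrow> (S + P) ** (Y - lY *\<^sub>R mat 1 - PY) ** (S + P) - PY) (at 0)" by simp
  then have "((\<lambda>t. (S' t - S) /\<^sub>R t) \<longlongrightarrow> (S + P) ** (Y - lY *\<^sub>R mat 1 - PY) ** (S + P) - PY) (at 0)"
  proof (rule Lim_transform_eventually)
    show "\<forall>\<^sub>F t in at 0. (S' t + P' t) ** (- ((l' t - l) /\<^sub>R t) *\<^sub>R mat 1 + Y - (P' t - P) /\<^sub>R t) ** (S + P) - (P' t - P) /\<^sub>R t
        = (S' t - S) /\<^sub>R t"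
      using red_resolvent_defect[OF s ev lim, folded P_def S_def l_def l'_def P'_def S'_def] nz
    proof eventually_elim
      case (elim t)
      have "(l - l' t) *\<^sub>R mat 1 + (A + t *\<^sub>R Y - A) - (P' t - P) = t *\<^sub>R (- ((l' t - l) /\<^sub>R t) *\<^sub>R mat 1 + Y - (P' t - P) /\<^sub>R t)"
        using elim(2) by (simp add: scaleR_add_right scaleR_diff_right) (simp add: algebra_simps)
      then have "(S' t + P' t) - (S + P) = t *\<^sub>R ((S' t + P' t) ** (- ((l' t - l) /\<^sub>R t) *\<^sub>R mat 1 + Y - (P' t - P) /\<^sub>R t) ** (S + P))"
        using elim(1) by (simp only: matrix_scaleR_left matrix_scaleR_right)
      then have "((S' t + P' t) - (S + P)) /\<^sub>R t = (S' t + P' t) ** (- ((l' t - l) /\<^sub>R t) *\<^sub>R mat 1 + Y - (P' t - P) /\<^sub>R t) ** (S + P)"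
        using elim(2) by simp
      moreover have "((S' t + P' t) - (S + P)) /\<^sub>R t - (P' t - P) /\<^sub>R t = (S' t - S) /\<^sub>R t"
        by (simp flip: scaleR_diff_right)
      ultimately show ?case by simp
    qed
  qed
  then show "((\<lambda>t. red_resolvent j (A + t *\<^sub>R Y)) has_vector_derivative
      (S + P) ** (Y - lY *\<^sub>R mat 1 - PY) ** (S + P) - PY) (at 0)"
    by (simp add: has_vector_derivative_quotient S'_def S_def)
qed

section \<open>From smooth partial derivatives to Frechet derivatives and gradients\<close>

lemma tendsto_fun_coordinatewise:
  fixes f :: "'x \<Rightarrow> 'i \<Rightarrow> 'b::topological_space"
  assumes "\<And>i. ((\<lambda>x. f x i) \<longlongrightarrow> l i) F"
  shows "(f \<longlongrightarrow> l) F"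
proof (rule topological_tendstoI)
  fix T assume "open T" "l \<in> T"
  then have "openin (product_topology (\<lambda>i. euclidean) UNIV) T"
    by (simp add: open_fun_def)
  from product_topology_open_contains_basis[OF this \<open>l \<in> T\<close>]
  have "\<exists>X. l \<in> (\<Pi>\<^sub>E i\<in>UNIV. X i) \<and> (\<forall>i. open (X i)) \<and> finite {i. X i \<noteq> UNIV} \<and> (\<Pi>\<^sub>E i\<in>UNIV. X i) \<subseteq> T"
    by simp
  then obtain X where X: "l \<in> (\<Pi>\<^sub>E i\<in>UNIV. X i)" "\<And>i. open (X i)" "finite {i. X i \<noteq> UNIV}" "(\<Pi>\<^sub>E i\<in>UNIV. X i) \<subseteq> T"
    by blast
  have "\<forall>\<^sub>F x in F. \<forall>i\<in>{i. X i \<noteq> UNIV}. f x i \<in> X i"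
    by (intro eventually_ball_finite X(3) ballI topological_tendstoD[OF assms X(2)])
      (use X(1) in auto)
  then show "\<forall>\<^sub>F x in F. f x \<in> T"
  proof eventually_elim
    case (elim x)
    then have "f x i \<in> X i" for i by (cases "X i = UNIV") auto
    then show ?case using X(4) by auto
  qed
qed

lemma smooth_on_continuous: "smooth_on n W F \<Longrightarrow> continuous_on W F"
  by (erule smooth_on.cases) auto

lemma smooth_on_partial:
  assumes "smooth_on n W F" "s \<in> {1..n}" "hermitian Y"
  obtains D where "\<And>e. e \<in> W \<Longrightarrow> ((\<lambda>t. F (e(s := e s + t *\<^sub>R Y))) has_real_derivative D e) (at 0)"
    "smooth_on n W D"
proof -
  have "\<exists>D. (\<forall>e\<in>W. ((\<lambda>t. F (e(s := e s + t *\<^sub>R Y))) has_real_derivative D e) (at 0)) \<and> smooth_on n W D"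
    using assms(1) by (rule smooth_on.cases) (use assms(2,3) in blast)
  then show thesis using that by blast
qed

text \<open>A product rule at a zero of \<open>a\<close>, where the other factor needs only a limit.
  It is applied with \<eta> a difference quotient, which converges but need not be
  differentiable.\<close>

lemma has_derivative_mult_vanishing:
  fixes a \<eta> :: "'a::real_normed_vector \<Rightarrow> real"
  assumes a0: "a y0 = 0" and a: "(a has_derivative a') (at y0)" and \<eta>: "(\<eta> \<longlongrightarrow> c) (at y0)"
  shows "((\<lambda>y. a y * \<eta> y) has_derivative (\<lambda>v. a' v * c)) (at y0)"
proof -
  interpret a': bounded_linear a' using a by (rule has_derivative_bounded_linear)
  obtain K where K: "\<And>x. norm (a' x) \<le> norm x * K" using a'.bounded by blast
  let ?q = "\<lambda>y. \<bar>a y - a' (y - y0)\<bar> / norm (y - y0)"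
  have q: "(?q \<longlongrightarrow> 0) (at y0)"
    using a by (simp add: has_derivative_iff_norm a0)
  have "((\<lambda>y. ?q y * \<bar>\<eta> y\<bar> + \<bar>K\<bar> * \<bar>\<eta> y - c\<bar>) \<longlongrightarrow> 0 * \<bar>c\<bar> + \<bar>K\<bar> * \<bar>c - c\<bar>) (at y0)"
    by (intro tendsto_intros q \<eta>)
  then have lim: "((\<lambda>y. ?q y * \<bar>\<eta> y\<bar> + \<bar>K\<bar> * \<bar>\<eta> y - c\<bar>) \<longlongrightarrow> 0) (at y0)" by simp
  show ?thesis
    unfolding has_derivative_iff_norm
  proof
    show "bounded_linear (\<lambda>v. a' v * c)"
      by (rule bounded_linear_mult_left[THEN bounded_linear_compose, OF a'.bounded_linear_axioms])
    show "((\<lambda>y. norm (a y * \<eta> y - a y0 * \<eta> y0 - a' (y - y0) * c) / norm (y - y0)) \<longlongrightarrow> 0) (at y0)"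
    proof (rule Lim_null_comparison[OF _ lim])
      have "\<forall>\<^sub>F y in at y0. y \<noteq> y0" by (simp add: eventually_at_filter)
      then show "\<forall>\<^sub>F y in at y0. norm (norm (a y * \<eta> y - a y0 * \<eta> y0 - a' (y - y0) * c) / norm (y - y0))
          \<le> ?q y * \<bar>\<eta> y\<bar> + \<bar>K\<bar> * \<bar>\<eta> y - c\<bar>"
      proof eventually_elim
        case (elim y)
        have "a y * \<eta> y - a' (y - y0) * c = (a y - a' (y - y0)) * \<eta> y + a' (y - y0) * (\<eta> y - c)"
          by (simp add: algebra_simps)
        then have "\<bar>a y * \<eta> y - a' (y - y0) * c\<bar> \<le> \<bar>a y - a' (y - y0)\<bar> * \<bar>\<eta> y\<bar> + \<bar>a' (y - y0)\<bar> * \<bar>\<eta> y - c\<bar>"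
          by (metis abs_mult abs_triangle_ineq)
        also have "\<bar>a' (y - y0)\<bar> \<le> norm (y - y0) * \<bar>K\<bar>"
          using K[of "y - y0"] by (smt (verit, best) mult_left_mono norm_ge_zero real_norm_def)
        finally have "\<bar>a y * \<eta> y - a' (y - y0) * c\<bar> \<le> \<bar>a y - a' (y - y0)\<bar> * \<bar>\<eta> y\<bar> + norm (y - y0) * \<bar>K\<bar> * \<bar>\<eta> y - c\<bar>"
          by (simp add: mult_right_mono)
        then have "\<bar>a y * \<eta> y - a' (y - y0) * c\<bar> / norm (y - y0)
            \<le> (\<bar>a y - a' (y - y0)\<bar> * \<bar>\<eta> y\<bar> + norm (y - y0) * \<bar>K\<bar> * \<bar>\<eta> y - c\<bar>) / norm (y - y0)"
          by (rule divide_right_mono) simp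
        also have "\<dots> = ?q y * \<bar>\<eta> y\<bar> + \<bar>K\<bar> * \<bar>\<eta> y - c\<bar>"
          using elim by (simp add: add_divide_distrib)
        finally show ?case by (simp add: a0)
      qed
    qed
  qed
qed

lemma Herm_n_fun_upd: "x \<in> Herm_n n \<Longrightarrow> s \<in> {1..n} \<Longrightarrow> hermitian Y \<Longrightarrow> x(s := Y) \<in> Herm_n n"
  by (auto simp: Herm_n_def PiE_iff extensional_def)

text \<open>Increments along finitely many coordinate directions are added one at a time, each controlled
  by the mean value theorem.\<close>

lemma smooth_on_telescope:
  fixes F :: "('d::finite) config \<Rightarrow> real" and a :: "nat \<times> (complex ^ 'd ^ 'd) \<Rightarrow> 'a::real_normed_vector \<Rightarrow> real"
  assumes W: "openin (top_of_set (Herm_n n)) W" and e: "e \<in> W"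
    and K: "finite K" "K \<subseteq> {1..n} \<times> {Y. hermitian Y}"
    and a: "\<And>k. k \<in> K \<Longrightarrow> a k y0 = 0" "\<And>k. k \<in> K \<Longrightarrow> (a k has_derivative a' k) (at y0)"
    and D: "\<And>k x. k \<in> K \<Longrightarrow> x \<in> W \<Longrightarrow>
        ((\<lambda>t. F (x(fst k := x (fst k) + t *\<^sub>R snd k))) has_real_derivative D k x) (at 0)"
      "\<And>k. k \<in> K \<Longrightarrow> continuous_on W (D k)"
  shows "((\<lambda>y. F (\<lambda>s. e s + (\<Sum>k\<in>{k\<in>K. fst k = s}. a k y *\<^sub>R snd k))) has_derivative
     (\<lambda>v. \<Sum>k\<in>K. a' k v * D k e)) (at y0)"
  using K a D
proof (induction K rule: finite_induct)
  case empty
  show ?case by simp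
next
  case (insert k K)
  define X where "X K y = (\<lambda>s. e s + (\<Sum>k\<in>{k\<in>K. fst k = s}. a k y *\<^sub>R snd k))" for K y
  obtain s b where k: "k = (s, b)" by force
  have s: "s \<in> {1..n}" and b: "hermitian b" using insert.prems(1) k by auto
  define Z where "Z y \<tau> = (X K y)(s := X K y s + \<tau> *\<^sub>R b)" for y \<tau>
  have Xk: "X (insert k K) y = Z y (a k y)" for y
  proof
    fix s'
    have "{k'\<in>insert k K. fst k' = s'} = (if s' = s then insert k {k'\<in>K. fst k' = s'} else {k'\<in>K. fst k' = s'})"
      by (auto simp: k)
    then show "X (insert k K) y s' = Z y (a k y) s'"
      using insert.hyps by (simp add: X_def Z_def k add_ac)
  qed
  have eH: "e \<in> Herm_n n" using e W openin_imp_subset by blast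
  have XH: "X K y \<in> Herm_n n" for y
  proof -
    have "X K y s' = undefined" if "s' \<notin> {1..n}" for s'
    proof -
      have "{k \<in> K. fst k = s'} = {}" using insert.prems(1) that by auto
      then have "X K y s' = e s'" by (simp only: X_def sum.empty add_0_right)
      then show ?thesis using eH that by (auto simp: Herm_n_def PiE_iff extensional_def)
    qed
    moreover have "hermitian (X K y s')" if "s' \<in> {1..n}" for s'
      unfolding X_def using eH that insert.prems(1)
      by (intro hermitian_closed hermitian_sum) (auto simp: Herm_n_def PiE_iff)
    ultimately show ?thesis by (auto simp: Herm_n_def PiE_iff extensional_def)
  qed
  have ZH: "Z y \<tau> \<in> Herm_n n" for y \<tau>
    unfolding Z_def by (intro Herm_n_fun_upd XH s hermitian_closed b)
      (use XH s in \<open>auto simp: Herm_n_def PiE_iff\<close>)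
  have a0: "a k' y0 = 0" if "k' \<in> insert k K" for k' using insert.prems(2) that by blast
  have alim: "(a k' \<longlongrightarrow> 0) (nhds y0)" if "k' \<in> insert k K" for k'
  proof -
    have "(a k' \<longlongrightarrow> a k' y0) (nhds y0)"
      using has_derivative_continuous[OF insert.prems(3)[OF that]]
      by (simp add: continuous_at flip: tendsto_at_iff_tendsto_nhds)
    then show ?thesis by (simp add: a0[OF that])
  qed
  have Zlim: "((\<lambda>p. Z (fst p) (snd p)) \<longlongrightarrow> e) (nhds y0 \<times>\<^sub>F nhds 0)"
  proof (rule tendsto_fun_coordinatewise)
    fix s'
    have "((\<lambda>p. X K (fst p) s') \<longlongrightarrow> e s' + (\<Sum>k\<in>{k\<in>K. fst k = s'}. 0 *\<^sub>R snd k)) (nhds y0 \<times>\<^sub>F nhds 0)" for s'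
      unfolding X_def
      by (intro tendsto_intros filterlim_compose[OF alim filterlim_fst]) auto
    then have Xl: "((\<lambda>p. X K (fst p) s') \<longlongrightarrow> e s') (nhds y0 \<times>\<^sub>F nhds 0)" for s' by simp
    have "((\<lambda>p. X K (fst p) s + snd p *\<^sub>R b) \<longlongrightarrow> e s + 0 *\<^sub>R b) (nhds y0 \<times>\<^sub>F nhds 0)"
      by (intro tendsto_intros Xl filterlim_snd)
    then show "((\<lambda>p. Z (fst p) (snd p) s') \<longlongrightarrow> e s') (nhds y0 \<times>\<^sub>F nhds 0)"
      using Xl[of s'] by (cases "s' = s") (simp_all add: Z_def)
  qed
  \<comment> \<open>The mean value theorem is applied on a whole segment of increments, so all of it
    has to lie in the given neighbourhood.\<close>
  have near: "\<forall>\<^sub>F y in nhds y0. \<forall>\<tau>. \<bar>\<tau>\<bar> \<le> \<bar>a k y\<bar> \<longrightarrow> Z y \<tau> \<in> T" if T: "open T" "e \<in> T" for T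
  proof -
    have "\<forall>\<^sub>F p in nhds y0 \<times>\<^sub>F nhds 0. Z (fst p) (snd p) \<in> T"
      by (rule topological_tendstoD[OF Zlim T])
    then obtain Pf Pg where P: "eventually Pf (nhds y0)" "eventually Pg (nhds (0::real))"
      "\<And>y \<tau>. Pf y \<Longrightarrow> Pg \<tau> \<Longrightarrow> Z y \<tau> \<in> T"
      unfolding eventually_prod_filter by auto
    obtain d where d: "d > 0" "\<And>\<tau>. \<bar>\<tau>\<bar> < d \<Longrightarrow> Pg \<tau>"
      using P(2) unfolding eventually_nhds_metric by (auto simp: dist_real_def)
    have "\<forall>\<^sub>F y in nhds y0. \<bar>a k y\<bar> < d"
      using order_tendstoD(2)[OF tendsto_rabs[OF alim[of k]], of d] d by simp
    with P(1) show ?thesis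
      by eventually_elim (use P(3) d in force)
  qed
  obtain T where T: "open T" "W = Herm_n n \<inter> T"
    using W by (auto simp: openin_open)
  \<comment> \<open>The increment in direction \<open>k\<close> divided by \<open>a k y\<close>.
    Where \<open>a k y\<close> vanishes the product with \<eta> is zero anyway, and the value
    \<open>D k e\<close> is chosen to keep the limit.\<close>
  define \<eta> where "\<eta> y = (if a k y = 0 then D k e else (F (X (insert k K) y) - F (X K y)) / a k y)" for y
  have mvt: "\<exists>\<theta>. \<bar>\<theta>\<bar> \<le> \<bar>a k y\<bar> \<and> \<eta> y = D k (Z y \<theta>)"
    if y: "\<forall>\<tau>. \<bar>\<tau>\<bar> \<le> \<bar>a k y\<bar> \<longrightarrow> Z y \<tau> \<in> T" and nz: "a k y \<noteq> 0" for y
  proof -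
    \<comment> \<open>The segment is rescaled to the unit interval, so the sign of
      \<open>a k y\<close> plays no part.\<close>
    have "\<exists>z::real>0. z < 1 \<and> F (Z y (1 * a k y)) - F (Z y (0 * a k y)) = (1 - 0) * (a k y * D k (Z y (z * a k y)))"
    proof (rule MVT2)
      fix x :: real assume x: "0 \<le> x" "x \<le> 1"
      have "\<bar>x * a k y\<bar> \<le> \<bar>a k y\<bar>" using x by (simp add: abs_mult mult_left_le_one_le)
      then have "Z y (x * a k y) \<in> W" using y ZH T(2) by auto
      then have d: "((\<lambda>t. F ((Z y (x * a k y))(s := Z y (x * a k y) s + t *\<^sub>R b))) has_real_derivative D k (Z y (x * a k y))) (at ((x - x) * a k y))"
        using insert.prems(4)[of k "Z y (x * a k y)"] by (simp add: k fun_upd_def)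
      have "((\<lambda>x'. F ((Z y (x * a k y))(s := Z y (x * a k y) s + ((x' - x) * a k y) *\<^sub>R b))) has_real_derivative D k (Z y (x * a k y)) * a k y) (at x)"
        by (rule DERIV_chain2[where g = "\<lambda>x'. (x' - x) * a k y", OF d]) (auto intro!: derivative_eq_intros)
      moreover have "(Z y (x * a k y))(s := Z y (x * a k y) s + ((x' - x) * a k y) *\<^sub>R b) = Z y (x' * a k y)" for x'
        by (simp add: Z_def algebra_simps)
      ultimately show "((\<lambda>x'. F (Z y (x' * a k y))) has_real_derivative a k y * D k (Z y (x * a k y))) (at x)"
        by (simp add: mult.commute)
    qed simp
    then obtain z where z: "0 < z" "z < 1" "F (Z y (a k y)) - F (Z y 0) = a k y * D k (Z y (z * a k y))"
      by auto
    have "Z y 0 = X K y" by (simp add: Z_def)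
    then have "\<eta> y = D k (Z y (z * a k y))" using z(3) nz by (simp add: \<eta>_def Xk)
    moreover have "\<bar>z * a k y\<bar> \<le> \<bar>a k y\<bar>" using z by (simp add: abs_mult mult_left_le_one_le)
    ultimately show ?thesis by blast
  qed
  have "(\<eta> \<longlongrightarrow> D k e) (at y0)"
  proof (rule tendstoI)
    fix \<epsilon> :: real assume "\<epsilon> > 0"
    have "open (ball (D k e) \<epsilon>)" by simp
    moreover have "continuous_on W (D k)" using insert.prems(5) by simp
    ultimately obtain T' where T': "open T'" "D k -` ball (D k e) \<epsilon> \<inter> W = T' \<inter> W"
      unfolding continuous_on_open_invariant by (metis inf_commute)
    have "e \<in> T'" using T' e \<open>\<epsilon> > 0\<close> by auto
    then have "\<forall>\<^sub>F y in nhds y0. \<forall>\<tau>. \<bar>\<tau>\<bar> \<le> \<bar>a k y\<bar> \<longrightarrow> Z y \<tau> \<in> T \<inter> T'"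
      using T T'(1) e by (intro near) auto
    then have "\<forall>\<^sub>F y in nhds y0. dist (\<eta> y) (D k e) < \<epsilon>"
    proof eventually_elim
      case (elim y)
      show ?case
      proof (cases "a k y = 0")
        case False
        then obtain \<theta> where "\<bar>\<theta>\<bar> \<le> \<bar>a k y\<bar>" "\<eta> y = D k (Z y \<theta>)"
          using mvt elim by blast
        moreover from this(1) have "Z y \<theta> \<in> T' \<inter> W" using elim T ZH by auto
        ultimately show ?thesis using T'(2) by (auto simp: dist_commute)
      qed (simp add: \<eta>_def \<open>\<epsilon> > 0\<close>)
    qed
    then show "\<forall>\<^sub>F y in at y0. dist (\<eta> y) (D k e) < \<epsilon>"
      by (simp add: eventually_at_filter eventually_mono)
  qed
  then have "((\<lambda>y. a k y * \<eta> y) has_derivative (\<lambda>v. a' k v * D k e)) (at y0)"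
    by (intro has_derivative_mult_vanishing a0 insert.prems(3)) auto
  moreover have "((\<lambda>y. F (X K y)) has_derivative (\<lambda>v. \<Sum>k\<in>K. a' k v * D k e)) (at y0)"
    unfolding X_def by (rule insert.IH) (use insert.prems in auto)
  ultimately have "((\<lambda>y. a k y * \<eta> y + F (X K y)) has_derivative (\<lambda>v. a' k v * D k e + (\<Sum>k\<in>K. a' k v * D k e))) (at y0)"
    by (rule has_derivative_add)
  moreover have "a k y * \<eta> y + F (X K y) = F (X (insert k K) y)" for y
    by (simp add: \<eta>_def Xk Z_def)
  ultimately show ?case
    using insert.hyps by (simp add: X_def)
qed

lemma hermitian_basis_exists:
  "\<exists>B :: (complex ^ 'd ^ 'd) set. finite B \<and> (\<forall>b\<in>B. hermitian b) \<and> (\<forall>Y. hermitian Y \<longrightarrow> (\<Sum>b\<in>B. (Y \<bullet> b) *\<^sub>R b) = Y)"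
proof -
  have "subspace {Y :: complex ^ 'd ^ 'd. hermitian Y}"
    by (simp add: subspace_def hermitian_closed)
  then obtain B where B: "B \<subseteq> {Y :: complex ^ 'd ^ 'd. hermitian Y}" "pairwise orthogonal B"
    "\<And>x. x \<in> B \<Longrightarrow> norm x = 1" "independent B" "span B = {Y. hermitian Y}"
    by (rule orthonormal_basis_subspace) blast
  have "finite B" using B(4) by (rule independent_imp_finite)
  moreover have "(\<Sum>b\<in>B. (Y \<bullet> b) *\<^sub>R b) = Y" if "hermitian Y" for Y
    using B that by (intro orthonormal_basis_expand \<open>finite B\<close>) auto
  ultimately show ?thesis using B(1) by blast
qed

text \<open>Tested against the Hermitian matrix \<open>cscale \<i> X\<close>, the pairing is minus
  the squared norm of \<open>X\<close>. This is what makes gradients unique.\<close>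

lemma skew_pairing_eq_0:
  assumes "skew_hermitian X" "\<And>Y. hermitian Y \<Longrightarrow> Im (trace (X ** Y)) = 0"
  shows "X = 0"
proof -
  have a: "adj X = - X" using assms(1) by (rule skew_hermitianD)
  have "hermitian (cscale \<i> X)"
    by (simp add: hermitian_def adj_simps a vec_eq_iff)
  then have "Im (trace (X ** cscale \<i> X)) = 0" by (rule assms(2))
  then have "Re (trace (X ** X)) = 0" by (simp add: cscale_mult_right trace_cscale)
  moreover have "trace (X ** adj X) = - trace (X ** X)"
    by (simp add: a matrix_minus_right trace_neg)
  ultimately have "Re (trace (X ** adj X)) = 0" by simp
  then show "X = 0" by (simp add: norm_matrix_trace)
qed

lemma gradient_eqI:
  assumes X: "skew_hermitian X" "\<And>Y. hermitian Y \<Longrightarrow>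
      ((\<lambda>t. F (e(s := e s + t *\<^sub>R Y))) has_real_derivative Im (trace (X ** Y))) (at 0)"
  shows "gradient F e s = X"
  unfolding gradient_def
proof (rule the_equality)
  fix X' assume X': "skew_hermitian X' \<and> (\<forall>Y. hermitian Y \<longrightarrow>
      ((\<lambda>t. F (e(s := e s + t *\<^sub>R Y))) has_real_derivative Im (trace (X' ** Y))) (at 0))"
  have "X' - X = 0"
  proof (rule skew_pairing_eq_0)
    show "skew_hermitian (X' - X)"
      using X(1) X' by (simp add: skew_hermitian_def adj_simps)
    show "Im (trace ((X' - X) ** Y)) = 0" if "hermitian Y" for Y
      using DERIV_unique[OF X(2)[OF that], of "Im (trace (X' ** Y))"] X' that by (simp add: mat_distribs trace_simps)
  qed
  then show "X' = X" by simp
qed (use X in blast)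

text \<open>A curve is written in coordinates for an orthonormal basis of the Hermitian matrices in
  each slot, and \<open>smooth_on_telescope\<close> applies to these coordinates. The parameter
  space is kept general because both curves in one real parameter and families parametrised by
  matrices occur later.\<close>

lemma smooth_on_frechet:
  fixes F :: "('d::finite) config \<Rightarrow> real"
  assumes W: "openin (top_of_set (Herm_n n)) W" and F: "smooth_on n W F" and e: "e \<in> W"
  obtains G where "\<And>s. skew_hermitian (G s)"
    "\<And>(\<gamma> :: 'a::real_normed_vector \<Rightarrow> 'd config) \<gamma>' y0. \<gamma> y0 = e \<Longrightarrow> (\<forall>\<^sub>F y in nhds y0. \<gamma> y \<in> Herm_n n) \<Longrightarrow>
      (\<And>s. s \<in> {1..n} \<Longrightarrow> ((\<lambda>y. \<gamma> y s) has_derivative \<gamma>' s) (at y0)) \<Longrightarrow>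
      (\<And>s v. s \<in> {1..n} \<Longrightarrow> hermitian (\<gamma>' s v)) \<Longrightarrow>
      ((\<lambda>y. F (\<gamma> y)) has_derivative (\<lambda>v. \<Sum>s=1..n. Im (trace (G s ** \<gamma>' s v)))) (at y0)"
    "\<And>s Y. s \<in> {1..n} \<Longrightarrow> hermitian Y \<Longrightarrow>
      ((\<lambda>t. F (e(s := e s + t *\<^sub>R Y))) has_real_derivative Im (trace (G s ** Y))) (at 0)"
proof -
  obtain B :: "(complex ^ 'd ^ 'd) set" where B: "finite B" "\<And>b. b \<in> B \<Longrightarrow> hermitian b"
    "\<And>Y. hermitian Y \<Longrightarrow> (\<Sum>b\<in>B. (Y \<bullet> b) *\<^sub>R b) = Y"
    using hermitian_basis_exists by blast
  define K where "K = {1..n} \<times> B"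
  have K: "finite K" "K \<subseteq> {1..n} \<times> {Y. hermitian Y}" using B by (auto simp: K_def)
  have "\<forall>k\<in>K. \<exists>D. (\<forall>x\<in>W. ((\<lambda>t. F (x(fst k := x (fst k) + t *\<^sub>R snd k))) has_real_derivative D x) (at 0)) \<and> continuous_on W D"
  proof
    fix k assume "k \<in> K"
    then have "fst k \<in> {1..n}" "hermitian (snd k)" using B by (auto simp: K_def)
    then obtain D where "\<And>x. x \<in> W \<Longrightarrow> ((\<lambda>t. F (x(fst k := x (fst k) + t *\<^sub>R snd k))) has_real_derivative D x) (at 0)"
      "smooth_on n W D" by (rule smooth_on_partial[OF F]) blast
    then show "\<exists>D. (\<forall>x\<in>W. ((\<lambda>t. F (x(fst k := x (fst k) + t *\<^sub>R snd k))) has_real_derivative D x) (at 0)) \<and> continuous_on W D"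
      using smooth_on_continuous by blast
  qed
  then obtain D where D: "\<And>k x. k \<in> K \<Longrightarrow> x \<in> W \<Longrightarrow> ((\<lambda>t. F (x(fst k := x (fst k) + t *\<^sub>R snd k))) has_real_derivative D k x) (at 0)"
    "\<And>k. k \<in> K \<Longrightarrow> continuous_on W (D k)" by metis
  \<comment> \<open>The factor \<open>\<i>\<close> turns the Hermitian vector of partial derivatives
    into a skew-Hermitian matrix and the real inner product into the imaginary part of the
    trace.\<close>
  define G where "G s = cscale \<i> (\<Sum>b\<in>B. D (s, b) e *\<^sub>R b)" for s
  have G: "skew_hermitian (G s)" for s
  proof -
    have "adj (\<Sum>b\<in>B. D (s, b) e *\<^sub>R b) = (\<Sum>b\<in>B. D (s, b) e *\<^sub>R b)"
      unfolding adj_sum by (intro sum.cong refl) (simp add: adj_simps hermitianD B)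
    then show ?thesis by (simp add: skew_hermitian_def G_def adj_cscale) (simp add: vec_eq_iff)
  qed
  have pair: "Im (trace (G s ** Y)) = (\<Sum>b\<in>B. (Y \<bullet> b) * D (s, b) e)" if "hermitian Y" for s Y
  proof -
    have "Im (trace (G s ** Y)) = Re (trace ((\<Sum>b\<in>B. D (s, b) e *\<^sub>R b) ** Y))"
      by (simp add: G_def cscale_mult_left trace_cscale)
    also have "\<dots> = (\<Sum>b\<in>B. D (s, b) e *\<^sub>R b) \<bullet> Y" by (rule inner_hermitian[OF that])
    also have "\<dots> = (\<Sum>b\<in>B. (Y \<bullet> b) * D (s, b) e)"
      by (simp add: inner_commute[of _ Y] inner_sum_right mult.commute)
    finally show ?thesis .
  qed
  have eH: "e \<in> Herm_n n" using e W openin_imp_subset by blast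
  have chain: "((\<lambda>y. F (\<gamma> y)) has_derivative (\<lambda>v. \<Sum>s=1..n. Im (trace (G s ** \<gamma>' s v)))) (at y0)"
    if g0: "\<gamma> y0 = e" and gH: "\<forall>\<^sub>F y in nhds y0. \<gamma> y \<in> Herm_n n"
      and g: "\<And>s. s \<in> {1..n} \<Longrightarrow> ((\<lambda>y. \<gamma> y s) has_derivative \<gamma>' s) (at y0)"
      and h: "\<And>s v. s \<in> {1..n} \<Longrightarrow> hermitian (\<gamma>' s v)"
    for \<gamma> :: "'z::real_normed_vector \<Rightarrow> 'd config" and \<gamma>' y0
  proof -
    define a where "a k y = (\<gamma> y (fst k) - e (fst k)) \<bullet> snd k" for k y
    have "((\<lambda>y. F (\<lambda>s. e s + (\<Sum>k\<in>{k\<in>K. fst k = s}. a k y *\<^sub>R snd k))) has_derivative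
       (\<lambda>v. \<Sum>k\<in>K. (\<gamma>' (fst k) v \<bullet> snd k) * D k e)) (at y0)"
    proof (rule smooth_on_telescope[OF W e K _ _ D])
      show "a k y0 = 0" for k by (simp add: a_def g0)
      show "(a k has_derivative (\<lambda>v. \<gamma>' (fst k) v \<bullet> snd k)) (at y0)" if "k \<in> K" for k
      proof -
        have "((\<lambda>y. \<gamma> y (fst k)) has_derivative \<gamma>' (fst k)) (at y0)" using that by (intro g) (auto simp: K_def)
        then have "((\<lambda>y. (\<gamma> y (fst k) - e (fst k)) \<bullet> snd k) has_derivative (\<lambda>v. (\<gamma>' (fst k) v - 0) \<bullet> snd k)) (at y0)"
          by (intro has_derivative_inner_left has_derivative_diff has_derivative_const)
        then show ?thesis by (simp add: a_def[abs_def])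
      qed
    qed
    moreover have "(\<Sum>k\<in>K. (\<gamma>' (fst k) v \<bullet> snd k) * D k e) = (\<Sum>s=1..n. Im (trace (G s ** \<gamma>' s v)))" for v
      by (simp add: K_def sum.cartesian_product' pair h)
    ultimately have d: "((\<lambda>y. F (\<lambda>s. e s + (\<Sum>k\<in>{k\<in>K. fst k = s}. a k y *\<^sub>R snd k))) has_derivative
       (\<lambda>v. \<Sum>s=1..n. Im (trace (G s ** \<gamma>' s v)))) (at y0)" by simp
    have eq: "(\<lambda>s. e s + (\<Sum>k\<in>{k\<in>K. fst k = s}. a k y *\<^sub>R snd k)) = \<gamma> y" if y: "\<gamma> y \<in> Herm_n n" for y
    proof
      fix s
      show "e s + (\<Sum>k\<in>{k\<in>K. fst k = s}. a k y *\<^sub>R snd k) = \<gamma> y s"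
      proof (cases "s \<in> {1..n}")
        case True
        have "{k\<in>K. fst k = s} = Pair s ` B" using True by (auto simp: K_def)
        then have "(\<Sum>k\<in>{k\<in>K. fst k = s}. a k y *\<^sub>R snd k) = (\<Sum>b\<in>B. ((\<gamma> y s - e s) \<bullet> b) *\<^sub>R b)"
          by (simp add: sum.reindex inj_on_def a_def)
        also have "\<dots> = \<gamma> y s - e s"
          using y eH True by (intro B(3) hermitian_closed) (auto simp: Herm_n_def PiE_iff)
        finally show ?thesis by simp
      next
        case False
        then have "{k\<in>K. fst k = s} = {}" by (auto simp: K_def)
        then have "e s + (\<Sum>k\<in>{k\<in>K. fst k = s}. a k y *\<^sub>R snd k) = e s" by (simp only: sum.empty add_0_right)
        then show ?thesis using False y eH by (simp add: Herm_n_def PiE_iff extensional_def)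
      qed
    qed
    show ?thesis
    proof (rule has_derivative_transform_eventually[OF d])
      have "\<forall>\<^sub>F y in nhds y0. F (\<lambda>s. e s + (\<Sum>k\<in>{k\<in>K. fst k = s}. a k y *\<^sub>R snd k)) = F (\<gamma> y)"
        using gH by eventually_elim (simp add: eq)
      then show "\<forall>\<^sub>F y in at y0. F (\<lambda>s. e s + (\<Sum>k\<in>{k\<in>K. fst k = s}. a k y *\<^sub>R snd k)) = F (\<gamma> y)"
        by (simp add: eventually_at_filter eventually_mono)
      show "F (\<lambda>s. e s + (\<Sum>k\<in>{k\<in>K. fst k = s}. a k y0 *\<^sub>R snd k)) = F (\<gamma> y0)"
        using eventually_nhds_x_imp_x[OF gH] by (simp add: eq)
    qed simp
  qed
  have "((\<lambda>t. F (e(s := e s + t *\<^sub>R Y))) has_real_derivative Im (trace (G s ** Y))) (at 0)"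
    if s: "s \<in> {1..n}" and Y: "hermitian Y" for s Y
  proof -
    define \<gamma> where "\<gamma> t = e(s := e s + t *\<^sub>R Y)" for t :: real
    have "((\<lambda>t. F (\<gamma> t)) has_derivative (\<lambda>v. \<Sum>s'=1..n. Im (trace (G s' ** (if s' = s then v *\<^sub>R Y else 0))))) (at 0)"
    proof (rule chain)
      show "\<gamma> 0 = e" by (simp add: \<gamma>_def)
      have "hermitian (e s)" using eH s by (auto simp: Herm_n_def PiE_iff)
      then show "\<forall>\<^sub>F t in nhds 0. \<gamma> t \<in> Herm_n n"
        unfolding \<gamma>_def by (intro always_eventually allI Herm_n_fun_upd eH s hermitian_closed Y)
      show "((\<lambda>t. \<gamma> t s') has_derivative (\<lambda>v. if s' = s then v *\<^sub>R Y else 0)) (at 0)" for s'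
        by (cases "s' = s") (auto simp: \<gamma>_def intro!: derivative_eq_intros)
      show "hermitian (if s' = s then v *\<^sub>R Y else 0)" for s' v
        using Y by (simp add: hermitian_closed)
    qed
    moreover have "(\<Sum>s'=1..n. Im (trace (G s' ** (if s' = s then v *\<^sub>R Y else 0)))) = Im (trace (G s ** Y)) * v" for v
    proof -
      have "(\<Sum>s'=1..n. Im (trace (G s' ** (if s' = s then v *\<^sub>R Y else 0)))) = (\<Sum>s'=1..n. if s' = s then Im (trace (G s ** Y)) * v else 0)"
        by (intro sum.cong refl) (simp add: mat_distribs trace_simps)
      then show ?thesis using s by simp
    qed
    ultimately show ?thesis
      by (simp add: has_field_derivative_def \<gamma>_def)
  qed
  then show thesis using that[of G] G chain by blast
qed

lemma smooth_on_gradient: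
  fixes F :: "('d::finite) config \<Rightarrow> real"
  assumes W: "openin (top_of_set (Herm_n n)) W" and F: "smooth_on n W F" and e: "e \<in> W" and s: "s \<in> {1..n}"
  shows "skew_hermitian (gradient F e s)"
    and "hermitian Y \<Longrightarrow> ((\<lambda>t. F (e(s := e s + t *\<^sub>R Y))) has_real_derivative Im (trace (gradient F e s ** Y))) (at 0)"
proof -
  obtain G where G: "\<And>s. skew_hermitian (G s)" "\<And>s Y. s \<in> {1..n} \<Longrightarrow> hermitian Y \<Longrightarrow>
      ((\<lambda>t. F (e(s := e s + t *\<^sub>R Y))) has_real_derivative Im (trace (G s ** Y))) (at 0)"
    by (rule smooth_on_frechet[OF W F e, where 'a = real]) blast
  have "gradient F e s = G s" by (rule gradient_eqI) (use G s in auto)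
  then show "skew_hermitian (gradient F e s)"
    "hermitian Y \<Longrightarrow> ((\<lambda>t. F (e(s := e s + t *\<^sub>R Y))) has_real_derivative Im (trace (gradient F e s ** Y))) (at 0)"
    using G s by auto
qed

lemma smooth_on_chain_rule:
  fixes F :: "('d::finite) config \<Rightarrow> real" and \<gamma> :: "'a::real_normed_vector \<Rightarrow> 'd config"
  assumes W: "openin (top_of_set (Herm_n n)) W" and F: "smooth_on n W F" and e: "\<gamma> y0 \<in> W"
    and \<gamma>H: "\<forall>\<^sub>F y in nhds y0. \<gamma> y \<in> Herm_n n"
    and \<gamma>: "\<And>s. s \<in> {1..n} \<Longrightarrow> ((\<lambda>y. \<gamma> y s) has_derivative \<gamma>' s) (at y0)"
    and h: "\<And>s v. s \<in> {1..n} \<Longrightarrow> hermitian (\<gamma>' s v)"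
  shows "((\<lambda>y. F (\<gamma> y)) has_derivative (\<lambda>v. \<Sum>s=1..n. Im (trace (gradient F (\<gamma> y0) s ** \<gamma>' s v)))) (at y0)"
proof -
  obtain G where G: "\<And>s. skew_hermitian (G s)" "\<And>(\<gamma>'' :: 'a \<Rightarrow> 'd config) \<gamma>' y1. \<gamma>'' y1 = \<gamma> y0 \<Longrightarrow> (\<forall>\<^sub>F y in nhds y1. \<gamma>'' y \<in> Herm_n n) \<Longrightarrow>
      (\<And>s. s \<in> {1..n} \<Longrightarrow> ((\<lambda>y. \<gamma>'' y s) has_derivative \<gamma>' s) (at y1)) \<Longrightarrow>
      (\<And>s v. s \<in> {1..n} \<Longrightarrow> hermitian (\<gamma>' s v)) \<Longrightarrow>
      ((\<lambda>y. F (\<gamma>'' y)) has_derivative (\<lambda>v. \<Sum>s=1..n. Im (trace (G s ** \<gamma>' s v)))) (at y1)"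
    "\<And>s Y. s \<in> {1..n} \<Longrightarrow> hermitian Y \<Longrightarrow>
      ((\<lambda>t. F ((\<gamma> y0)(s := \<gamma> y0 s + t *\<^sub>R Y))) has_real_derivative Im (trace (G s ** Y))) (at 0)"
    by (rule smooth_on_frechet[OF W F e, where 'a = 'a]) blast
  have "gradient F (\<gamma> y0) s = G s" if "s \<in> {1..n}" for s by (rule gradient_eqI) (use G that in auto)
  then show ?thesis
    using G(2)[OF refl \<gamma>H \<gamma> h] by simp
qed

section \<open>Skew-Hermitian parts and matrices of rank at most one\<close>

definition skew_part :: "complex ^ 'd ^ 'd \<Rightarrow> complex ^ 'd ^ 'd" where
  "skew_part Z = (1 / 2) *\<^sub>R (Z - adj Z)"

lemma skew_part_skew: "skew_hermitian (skew_part Z)"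
  by (simp add: skew_part_def skew_hermitian_def adj_simps flip: scaleR_minus_right)

lemma Im_trace_adj: "hermitian Y \<Longrightarrow> Im (trace (adj Z ** Y)) = - Im (trace (Z ** Y))"
proof -
  assume "hermitian Y"
  then have "adj (Y ** Z) = adj Z ** Y" by (simp add: adj_mult hermitianD)
  then have "trace (adj Z ** Y) = cnj (trace (Y ** Z))" by (metis trace_adj)
  then show ?thesis by (simp add: trace_mul_sym[of Y Z])
qed

text \<open>Consequently, if \<open>Z\<close> represents a derivative in the form
  \<open>Im (trace (Z ** Y))\<close>, the gradient is \<open>skew_part Z\<close>, whether or not
  \<open>Z\<close> itself is skew-Hermitian.\<close>

lemma skew_part_pairing: "hermitian Y \<Longrightarrow> Im (trace (skew_part Z ** Y)) = Im (trace (Z ** Y))"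
  by (simp add: skew_part_def mat_distribs trace_simps Im_trace_adj)

text \<open>The sandwich identity itself is taken as the definition. It covers scaled orbit elements
  and eigenprojections alike, without mention of vectors or phases.\<close>

definition rank_le_one :: "complex ^ 'd ^ 'd \<Rightarrow> bool" where
  "rank_le_one e \<longleftrightarrow> hermitian e \<and> (\<forall>X. e ** X ** e = cscale (trace (X ** e)) e)"

lemma rank_le_one_scaled: "rank_le_one (\<rho> *\<^sub>R rank_one w)"
  unfolding rank_le_one_def
  by (simp add: hermitian_closed mat_distribs rank_one_sandwich trace_simps cscale_scaleR)
    (simp add: vec_eq_iff)

lemma rank_le_one_sandwich: "rank_le_one e \<Longrightarrow> e ** X ** e = cscale (trace (X ** e)) e"
  by (simp add: rank_le_one_def)

lemma rank_le_one_hermitian: "rank_le_one e \<Longrightarrow> hermitian e"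
  by (simp add: rank_le_one_def)

lemma rank_le_one_eigproj: "hermitian A \<Longrightarrow> j < CARD('d) \<Longrightarrow> rank_le_one (eigproj j (A :: complex^'d^'d))"
  by (simp add: rank_le_one_def eigproj_basic hermitian_def)

text \<open>The product \<open>a ** b ** a ** X ** b\<close> is evaluated once by the sandwich
  identity at \<open>a\<close> and once at \<open>b\<close>. It cancels common factors in quotients
  of traces.\<close>

lemma rank_le_one_exchange:
  assumes "rank_le_one a" "rank_le_one b"
  shows "cscale (trace (b ** a)) (a ** X ** b) = cscale (trace (b ** a ** X)) (a ** b)"
proof -
  have "(a ** b ** a) ** X ** b = a ** (b ** (a ** X) ** b)"
    by (simp add: matrix_mul_assoc)
  then have "cscale (trace (b ** a)) (a ** X ** b) = cscale (trace (a ** X ** b)) (a ** b)"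
    by (simp only: rank_le_one_sandwich[OF assms(1)] rank_le_one_sandwich[OF assms(2)] cscale_mult_left cscale_mult_right)
  then show ?thesis by (simp only: trace_cycle3[of a X b])
qed

text \<open>For the projection onto a unit vector u and e equal to \<rho> times the projection onto
  w, this is \<rho> |(w, u)|^2. Its nonvanishing is what allows arguments to be taken.\<close>

definition overlap :: "complex ^ 'd ^ 'd \<Rightarrow> complex ^ 'd ^ 'd \<Rightarrow> real" where
  "overlap P e = Re (trace (P ** e))"

lemma trace_overlap: "hermitian P \<Longrightarrow> hermitian e \<Longrightarrow> trace (P ** e) = of_real (overlap P e)"
proof -
  assume h: "hermitian P" "hermitian e"
  have "cnj (trace (P ** e)) = trace (adj (P ** e))" by (rule trace_adj[symmetric])
  also have "\<dots> = trace (e ** P)" using h by (simp add: adj_mult hermitianD)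
  also have "\<dots> = trace (P ** e)" by (rule trace_mul_sym)
  finally have "cnj (trace (P ** e)) = trace (P ** e)" .
  then show ?thesis by (simp add: overlap_def complex_eq_iff)
qed

lemma trace_overlap': "hermitian P \<Longrightarrow> hermitian e \<Longrightarrow> trace (e ** P) = of_real (overlap P e)"
  by (simp add: trace_overlap trace_mul_sym[of e P])

subsection \<open>The gradient of an angle variable\<close>

text \<open>The angle variable is a difference of two functions of the same shape, one for each of the two
  orbit variables. \<open>frame_grad\<close> and \<open>orbit_grad\<close> are the gradients of one of them in the direction of
  the partial sum and of the orbit variable \<open>e\<close>.\<close>

definition frame_grad :: "nat \<Rightarrow> nat \<Rightarrow> complex ^ 'd ^ 'd \<Rightarrow> complex ^ 'd ^ 'd \<Rightarrow> complex ^ 'd ^ 'd" where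
  "frame_grad j j' A e = skew_part
    ((1 / overlap (eigproj j A) e) *\<^sub>R (red_resolvent j A ** e ** eigproj j A)
     - (1 / overlap (eigproj j' A) e) *\<^sub>R (red_resolvent j' A ** e ** eigproj j' A))"

definition orbit_grad :: "nat \<Rightarrow> nat \<Rightarrow> complex ^ 'd ^ 'd \<Rightarrow> complex ^ 'd ^ 'd \<Rightarrow> complex ^ 'd ^ 'd" where
  "orbit_grad j j' A e = skew_part
    ((1 / (overlap (eigproj j A) e * overlap (eigproj j' A) e)) *\<^sub>R (eigproj j' A ** e ** eigproj j A))"

abbreviation lie_pairing :: "complex ^ 'd ^ 'd \<Rightarrow> complex ^ 'd ^ 'd \<Rightarrow> complex ^ 'd ^ 'd \<Rightarrow> real" where
  "lie_pairing e X Y \<equiv> Im (trace (e ** commutator X Y))"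

lemma lie_pairing_antisym: "lie_pairing e X Y = - lie_pairing e Y X"
  by (simp only: commutator_antisym[of X Y] matrix_minus_right trace_neg uminus_complex.sel)

lemma lie_pairing_cyclic: "lie_pairing e X Y = Im (trace (X ** commutator Y e))"
  by (simp only: trace_commutator_cyclic[of e X Y])

lemma lie_pairing_linear:
  "lie_pairing e (X + X') Y = lie_pairing e X Y + lie_pairing e X' Y"
  "lie_pairing e (X - X') Y = lie_pairing e X Y - lie_pairing e X' Y"
  "lie_pairing e (- X) Y = - lie_pairing e X Y"
  "lie_pairing e X (Y + Y') = lie_pairing e X Y + lie_pairing e X Y'"
  "lie_pairing e X (Y - Y') = lie_pairing e X Y - lie_pairing e X Y'"
  "lie_pairing e X (- Y) = - lie_pairing e X Y"
  "lie_pairing e 0 Y = 0" "lie_pairing e X 0 = 0"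
  by (simp_all only: commutator_add commutator_diff commutator_neg commutator_zero mat_distribs trace_simps
      matrix_zero_right trace_zero plus_complex.sel minus_complex.sel uminus_complex.sel zero_complex.sel)

lemma lie_pairing_sum_l: "lie_pairing (\<Sum>s\<in>I. f s) X Y = (\<Sum>s\<in>I. lie_pairing (f s) X Y)"
  by (simp add: matrix_sum_left trace_sum)

text \<open>The defining equation gives \<open>A ** S\<close> as the eigenvalue times
  \<open>S\<close>, minus the identity, plus the projection. The terms still containing the
  resolvent then cancel, leaving only the projection.\<close>

lemma trace_resolvent_commutator:
  fixes A :: "complex ^ 'd ^ 'd"
  assumes s: "simple_eig j A" and e: "hermitian e"
  shows "trace (red_resolvent j A ** e ** eigproj j A ** commutator H A)
    = of_real (overlap (eigproj j A) e) * trace (eigproj j A ** H) - trace (e ** eigproj j A ** H)"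
proof -
  have h: "hermitian A" and j: "j < CARD('d)" using s by (auto simp: simple_eig_def)
  let ?P = "eigproj j A" and ?S = "red_resolvent j A" and ?l = "eigvals A ! j"
  note P = eigproj_basic[OF h j]
  have AS: "A ** ?S = ?l *\<^sub>R ?S - mat 1 + ?P"
    using red_resolvent(5)[OF s] by (simp add: mat_distribs algebra_simps)
  have "trace (?S ** e ** ?P ** commutator H A)
      = trace (?S ** e ** ?P ** H ** A) - trace (?S ** e ** (?P ** A) ** H)"
    by (simp add: commutator_def mat_distribs trace_simps matrix_mul_assoc)
  also have "trace (?S ** e ** ?P ** H ** A) = trace ((A ** ?S) ** (e ** ?P ** H))"
    by (subst trace_mul_sym) (simp add: matrix_mul_assoc)
  also have "\<dots> = ?l *\<^sub>R trace (?S ** e ** ?P ** H) - trace (e ** ?P ** H) + trace (?P ** e ** ?P ** H)"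
    by (simp add: AS mat_distribs trace_simps matrix_mul_assoc)
  also have "?P ** e ** ?P ** H = cscale (of_real (overlap ?P e)) (?P ** H)"
    using P(5)[of e] trace_overlap'[of ?P e] P(1) e by (simp add: cscale_mult_left hermitian_def)
  also have "trace (?S ** e ** (?P ** A) ** H) = ?l *\<^sub>R trace (?S ** e ** ?P ** H)"
    by (simp add: P mat_distribs trace_simps)
  finally show ?thesis by (simp add: trace_cscale)
qed

lemma trace_orbit_commutator:
  assumes "rank_le_one e" "hermitian P" "hermitian P'"
  shows "trace (P' ** e ** P ** commutator H e)
    = of_real (overlap P' e) * trace (e ** P ** H) - of_real (overlap P e) * trace (P' ** e ** H)"
proof -
  note sand = rank_le_one_sandwich[OF assms(1)]
  have e: "hermitian e" using assms(1) by (rule rank_le_one_hermitian)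
  have "trace (P' ** e ** P ** commutator H e)
      = trace (e ** P' ** e ** P ** H) - trace (P' ** (e ** P ** e) ** H)"
    using trace_mul_sym[of "P' ** e ** P ** H" e]
    by (simp add: commutator_def mat_distribs trace_simps matrix_mul_assoc)
  then show ?thesis
    by (simp add: sand cscale_mult_left cscale_mult_right trace_cscale trace_overlap assms e)
qed

text \<open>Conjugating \<open>A\<close> and \<open>e\<close> together changes arg (e u', u) only
  through the phases of u and u', because eigenvectors transported without a component along
  themselves differ from conjugated ones by phases. The right-hand side is this phase defect; it
  does not involve \<open>e\<close>.\<close>

lemma frame_orbit_invariance:
  fixes A :: "complex ^ 'd ^ 'd"
  assumes s: "simple_eig j A" "simple_eig j' A" and e: "rank_le_one e" and H: "skew_hermitian H"
    and nz: "overlap (eigproj j A) e \<noteq> 0" "overlap (eigproj j' A) e \<noteq> 0"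
  shows "lie_pairing A (frame_grad j j' A e) H + lie_pairing e (orbit_grad j j' A e) H
    = Im (trace (eigproj j A ** H)) - Im (trace (eigproj j' A ** H))"
proof -
  have h: "hermitian A" and j: "j < CARD('d)" "j' < CARD('d)" using s by (auto simp: simple_eig_def)
  let ?P = "eigproj j A" and ?P' = "eigproj j' A"
  let ?p = "overlap ?P e" and ?p' = "overlap ?P' e"
  have hP: "hermitian ?P" "hermitian ?P'" using eigproj_basic[OF h] j by (auto simp: hermitian_def)
  have he: "hermitian e" using e by (rule rank_le_one_hermitian)
  have "lie_pairing A (frame_grad j j' A e) H = (1 / ?p) * Im (of_real ?p * trace (?P ** H) - trace (e ** ?P ** H))
      - (1 / ?p') * Im (of_real ?p' * trace (?P' ** H) - trace (e ** ?P' ** H))"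
    by (subst lie_pairing_cyclic)
      (simp add: frame_grad_def skew_part_pairing hermitian_commutator_skew H h mat_distribs trace_simps
        trace_resolvent_commutator[OF s(1) he] trace_resolvent_commutator[OF s(2) he])
  also have "\<dots> = Im (trace (?P ** H)) - Im (trace (?P' ** H)) - Im (trace (e ** ?P ** H)) / ?p + Im (trace (e ** ?P' ** H)) / ?p'"
    using nz by (simp add: field_simps)
  finally have 1: "lie_pairing A (frame_grad j j' A e) H = Im (trace (?P ** H)) - Im (trace (?P' ** H)) - Im (trace (e ** ?P ** H)) / ?p + Im (trace (e ** ?P' ** H)) / ?p'" .
  have "lie_pairing e (orbit_grad j j' A e) H = (1 / (?p * ?p')) * Im (of_real ?p' * trace (e ** ?P ** H) - of_real ?p * trace (?P' ** e ** H))"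
    by (subst lie_pairing_cyclic)
      (simp add: orbit_grad_def skew_part_pairing hermitian_commutator_skew H he mat_distribs trace_simps
        trace_orbit_commutator[OF e hP])
  also have "\<dots> = Im (trace (e ** ?P ** H)) / ?p - Im (trace (?P' ** e ** H)) / ?p'"
    using nz by (simp add: field_simps)
  \<comment> \<open>Brings both formulas to the same order of factors. The adjoint contributes a
    conjugation and the sign of the skew-Hermitian \<open>H\<close>, and together these leave the
    imaginary part unchanged.\<close>
  also have "trace (?P' ** e ** H) = - cnj (trace (e ** ?P' ** H))"
  proof -
    have "adj (e ** ?P' ** H) = - (H ** ?P' ** e)"
      using H he hP by (simp add: adj_mult hermitianD skew_hermitianD matrix_minus_left matrix_mul_assoc)
    then have "cnj (trace (e ** ?P' ** H)) = - trace (H ** ?P' ** e)"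
      by (metis trace_adj trace_neg)
    then show ?thesis by (metis minus_minus trace_cycle3)
  qed
  finally show ?thesis using 1 by simp
qed

lemma eigproj_orthogonal:
  fixes A :: "complex ^ 'd ^ 'd"
  assumes s: "simple_eig j A" and k: "k < CARD('d)" "k \<noteq> j"
  shows "eigproj j A ** eigproj k A = 0" "eigproj k A ** eigproj j A = 0"
proof -
  have h: "hermitian A" and j: "j < CARD('d)" using s by (auto simp: simple_eig_def)
  note Pj = eigproj_basic[OF h j] and Pk = eigproj_basic[OF h k(1)]
  have "eigvals A ! j *\<^sub>R (eigproj j A ** eigproj k A) = eigproj j A ** A ** eigproj k A"
    by (simp add: Pj mat_distribs)
  also have "\<dots> = eigvals A ! k *\<^sub>R (eigproj j A ** eigproj k A)"
    by (simp add: Pk mat_distribs flip: matrix_mul_assoc)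
  finally have "(eigvals A ! j - eigvals A ! k) *\<^sub>R (eigproj j A ** eigproj k A) = 0"
    by (simp add: scaleR_diff_left)
  then show 0: "eigproj j A ** eigproj k A = 0"
    using s k by (auto simp: simple_eig_def)
  have "eigproj k A ** eigproj j A = adj (eigproj j A ** eigproj k A)" by (simp add: adj_mult Pj Pk)
  then show "eigproj k A ** eigproj j A = 0" by (simp add: 0)
qed

text \<open>A frame gradient is off-diagonal in the eigenbasis, hence rotates no phase. When it
  serves as \<open>H\<close> in \<open>frame_orbit_invariance\<close>, the defect vanishes.\<close>

lemma frame_grad_diagonal:
  fixes A :: "complex ^ 'd ^ 'd"
  assumes s: "simple_eig j A" "simple_eig j' A" and k: "k < CARD('d)"
  shows "Im (trace (eigproj k A ** frame_grad j j' A e)) = 0"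
proof -
  have h: "hermitian A" using s by (simp add: simple_eig_def)
  have hP: "hermitian (eigproj k A)" using eigproj_basic[OF h k] by (simp add: hermitian_def)
  have z: "trace (red_resolvent j A ** e ** eigproj j A ** eigproj k A) = 0" if "simple_eig j A" for j
  proof (cases "k = j")
    case True
    have "trace (red_resolvent j A ** e ** eigproj j A ** eigproj k A) = trace (eigproj k A ** red_resolvent j A ** e ** eigproj j A)"
      by (rule trace_cycle4)
    then show ?thesis using red_resolvent(3)[OF that] by (simp add: True)
  next
    case False
    then show ?thesis
      using eigproj_orthogonal(1)[OF that k] by (simp flip: matrix_mul_assoc)
  qed
  have "trace (eigproj k A ** frame_grad j j' A e) = trace (frame_grad j j' A e ** eigproj k A)"
    by (rule trace_mul_sym)
  then show ?thesis
    by (simp add: frame_grad_def skew_part_pairing hP mat_distribs trace_simps z s)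
qed

subsection \<open>Real structures\<close>

text \<open>Complex conjugation of matrix entries in an orthonormal basis, reduced to the algebraic
  rules that it obeys. The basis itself is not mentioned, so that all reality arguments become
  rewriting.\<close>

definition real_structure :: "(complex ^ 'd ^ 'd \<Rightarrow> complex ^ 'd ^ 'd) \<Rightarrow> bool" where
  "real_structure K \<longleftrightarrow> (\<forall>X Y. K (X + Y) = K X + K Y) \<and> (\<forall>X Y. K (X - Y) = K X - K Y) \<and>
     (\<forall>c X. K (c *\<^sub>R X) = c *\<^sub>R K X) \<and> (\<forall>X Y. K (X ** Y) = K X ** K Y) \<and>
     (\<forall>X. K (adj X) = adj (K X)) \<and> K (mat 1) = mat 1 \<and> (\<forall>X. trace (K X) = cnj (trace X))"

lemma real_structureD:
  assumes "real_structure K"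
  shows "K (X + Y) = K X + K Y" "K (X - Y) = K X - K Y" "K (c *\<^sub>R X) = c *\<^sub>R K X" "K (X ** Y) = K X ** K Y"
    "K (adj X) = adj (K X)" "K (mat 1) = mat 1" "trace (K X) = cnj (trace X)"
  using assms by (auto simp: real_structure_def)

lemma real_structure_Im_trace: "real_structure K \<Longrightarrow> K X = X \<Longrightarrow> Im (trace X) = 0"
  by (metis real_structureD(7) complex_cnj_cancel_iff cnj.simps(2) neg_equal_zero)

lemma real_structure_skew_part: "real_structure K \<Longrightarrow> K X = X \<Longrightarrow> K (skew_part X) = skew_part X"
  by (simp add: skew_part_def real_structureD)

text \<open>The eigenvalue is real, so the map preserves the equations that characterise the
  projection and the reduced resolvent; uniqueness does the rest.\<close>

lemma real_structure_eigproj: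
  fixes A :: "complex ^ 'd ^ 'd"
  assumes K: "real_structure K" "K A = A" and s: "simple_eig j A"
  shows "K (eigproj j A) = eigproj j A" "K (red_resolvent j A) = red_resolvent j A"
proof -
  have h: "hermitian A" and j: "j < CARD('d)" using s by (auto simp: simple_eig_def)
  note P = eigproj_basic[OF h j] and S = red_resolvent[OF s] and KD = real_structureD[OF K(1)]
  show KP: "K (eigproj j A) = eigproj j A"
  proof (rule eigproj_unique[OF s])
    have "A ** K (eigproj j A) = K (A ** eigproj j A)" by (simp add: KD K(2))
    then show "A ** K (eigproj j A) = eigvals A ! j *\<^sub>R K (eigproj j A)" by (simp add: P KD)
    have "adj (K (eigproj j A)) = K (adj (eigproj j A))" by (simp add: KD)
    then show "adj (K (eigproj j A)) = K (eigproj j A)" by (simp add: P)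
    show "trace (K (eigproj j A)) = 1" by (simp add: KD P)
  qed
  show "K (red_resolvent j A) = red_resolvent j A"
  proof (rule red_resolvent_eqI[OF s])
    have "K 0 = 0" using KD(3)[of 0 0] by simp
    then show "K (red_resolvent j A) ** eigproj j A = 0"
      using KD(4)[of "red_resolvent j A" "eigproj j A"] by (simp add: KP S)
    have "K (red_resolvent j A ** (eigvals A ! j *\<^sub>R mat 1 - A)) = K (mat 1 - eigproj j A)" by (simp add: S)
    then show "K (red_resolvent j A) ** (eigvals A ! j *\<^sub>R mat 1 - A) = mat 1 - eigproj j A"
      by (simp add: KD K(2) KP)
  qed
qed

lemma real_structure_frame_grad:
  assumes K: "real_structure K" "K A = A" "K e = e" and s: "simple_eig j A" "simple_eig j' A"
  shows "K (frame_grad j j' A e) = frame_grad j j' A e" "K (orbit_grad j j' A e) = orbit_grad j j' A e"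
  unfolding frame_grad_def orbit_grad_def
  by (intro real_structure_skew_part[OF K(1)];
      simp add: real_structureD[OF K(1)] K real_structure_eigproj[OF K(1,2) s(1)] real_structure_eigproj[OF K(1,2) s(2)])+

lemma real_structure_lie_pairing:
  assumes "real_structure K" "K e = e" "K X = X" "K Y = Y"
  shows "lie_pairing e X Y = 0"
  by (rule real_structure_Im_trace[OF assms(1)])
    (simp add: commutator_def real_structureD[OF assms(1)] assms)

text \<open>In an eigenbasis of \<open>A\<close> whose phases make the coordinates of \<open>w\<close> real, both \<open>A\<close> and
  \<open>rank_one w\<close> have real entries.\<close>

lemma real_structure_exists:
  fixes A :: "complex ^ 'd ^ 'd"
  assumes h: "hermitian A"
  obtains K where "real_structure K" "K A = A" "K (rank_one w) = rank_one w"
proof -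
  obtain u where u: "orthoframe u" "\<And>a. a < CARD('d) \<Longrightarrow> A *v u a = eigvals A ! a *\<^sub>R u a"
    by (rule spectral_theorem[OF h]) blast
  \<comment> \<open>The phase of the coordinate of \<open>w\<close>, with 1 as default at a
    vanishing coordinate, where \<open>sgn\<close> would not give a unit.\<close>
  define c where "c a = (if hinner w (u a) = 0 then 1 else sgn (hinner w (u a)))" for a
  define v where "v a = c a *s u a" for a
  have cc: "cmod (c a) = 1" for a by (simp add: c_def norm_sgn)
  have cc': "c a * cnj (c a) = 1" for a using cc[of a] by (simp add: complex_norm_square[symmetric])
  have ov: "orthoframe v"
    using u(1) cc' cc'[unfolded mult.commute[of "c _"]] by (auto simp: orthoframe_def v_def hinner_simps)
  have ev: "A *v v a = eigvals A ! a *\<^sub>R v a" if "a < CARD('d)" for a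
    using u(2)[OF that] by (simp add: v_def matrix_vector_mult_smult) (simp add: vec_eq_iff)
  have rw: "hinner w (v a) \<in> \<real>" for a
  proof (cases "hinner w (u a) = 0")
    case False
    have "cnj (sgn z) * z = of_real (cmod z)" if "z \<noteq> 0" for z
    proof -
      have "cnj (sgn z) * z = z * cnj z / of_real (cmod z)" by (simp add: sgn_eq)
      also have "\<dots> = of_real (cmod z)" using that by (simp add: power2_eq_square flip: complex_norm_square)
      finally show ?thesis .
    qed
    then show ?thesis using False by (simp add: v_def c_def hinner_simps)
  qed (simp add: v_def hinner_simps)
  obtain U :: "complex ^ 'd ^ 'd" and \<pi> where \<pi>: "bij_betw \<pi> (UNIV :: 'd set) {..<CARD('d)}"
    and U: "\<And>i j. U $ i $ j = v (\<pi> j) $ i" and un: "unitary U"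
    by (rule orthoframe_unitary[OF ov]) blast
  have \<pi>': "\<pi> j < CARD('d)" for j using \<pi> by (auto simp: bij_betw_def)
  have UU: "adj U ** U = mat 1" "U ** adj U = mat 1" using un by (auto simp: unitary_def)
  define C :: "complex ^ 'd ^ 'd \<Rightarrow> complex ^ 'd ^ 'd" where "C M = (\<chi> i j. cnj (M $ i $ j))" for M
  have C: "C (X + Y) = C X + C Y" "C (X - Y) = C X - C Y" "C (r *\<^sub>R X) = r *\<^sub>R C X" "C (X ** Y) = C X ** C Y"
    "C (adj X) = adj (C X)" "C (mat 1) = mat 1" "trace (C X) = cnj (trace X)" for X Y r
    by (simp_all add: C_def vec_eq_iff matrix_matrix_mult_def mat_def trace_def)
  define K where "K X = U ** C (adj U ** X ** U) ** adj U" for X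
  have "K (X ** Y) = K X ** K Y" for X Y
  proof -
    have "adj U ** (X ** Y) ** U = (adj U ** X ** U) ** (adj U ** Y ** U)"
      by (metis UU(2) matrix_mul_assoc matrix_mul_rid)
    then have "C (adj U ** (X ** Y) ** U) = C (adj U ** X ** U) ** (adj U ** U) ** C (adj U ** Y ** U)"
      by (simp only: C UU matrix_mul_rid)
    then show ?thesis by (simp add: K_def matrix_mul_assoc)
  qed
  moreover have "trace (K X) = cnj (trace X)" for X
  proof -
    have "trace (K X) = trace (adj U ** U ** C (adj U ** X ** U))"
      unfolding K_def by (rule trace_cycle3)
    also have "\<dots> = cnj (trace (adj U ** X ** U))" by (simp only: UU C(7) matrix_mul_lid)
    also have "trace (adj U ** X ** U) = trace (U ** adj U ** X)" by (rule trace_cycle3)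
    finally show ?thesis by (simp add: UU)
  qed
  moreover have "K (adj X) = adj (K X)" for X
  proof -
    have "adj U ** adj X ** U = adj (adj U ** X ** U)" by (simp add: adj_mult matrix_mul_assoc)
    then have "C (adj U ** adj X ** U) = adj (C (adj U ** X ** U))" by (simp only: C)
    then show ?thesis by (simp add: K_def adj_mult matrix_mul_assoc)
  qed
  moreover have "K (mat 1) = mat 1" by (simp add: K_def UU C)
  ultimately have K: "real_structure K"
    unfolding real_structure_def by (simp add: K_def mat_distribs C)
  have fixK: "K X = X" if "\<And>i j. (adj U ** X ** U) $ i $ j \<in> \<real>" for X
  proof -
    have "C (adj U ** X ** U) = adj U ** X ** U"
      using that by (simp add: C_def vec_eq_iff Reals_cnj_iff)
    then have "K X = (U ** adj U) ** X ** (U ** adj U)" by (simp add: K_def matrix_mul_assoc)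
    then show ?thesis by (simp add: UU)
  qed
  have ent: "(adj U ** X ** U) $ i $ j = hinner (X *v v (\<pi> j)) (v (\<pi> i))" for X i j
  proof -
    have "(adj U ** X ** U) $ i $ j = (adj U ** (X ** U)) $ i $ j" by (simp add: matrix_mul_assoc)
    also have "\<dots> = (\<Sum>k\<in>UNIV. cnj (v (\<pi> i) $ k) * (X *v v (\<pi> j)) $ k)"
      by (simp add: matrix_matrix_mult_def matrix_vector_mult_def U)
    finally show ?thesis by (simp add: hinner_def mult.commute)
  qed
  have "K A = A"
    by (rule fixK) (simp add: ent ev[OF \<pi>'] hinner_simps orthoframe_hinner[OF ov \<pi>' \<pi>'])
  moreover have "K (rank_one w) = rank_one w"
  proof (rule fixK)
    fix i j
    have "hinner (v (\<pi> j)) w \<in> \<real>" using rw[of "\<pi> j"] by (metis hinner_cnj Reals_cnj_iff)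
    then show "(adj U ** rank_one w ** U) $ i $ j \<in> \<real>"
      using rw by (simp add: ent rank_one_mult hinner_simps)
  qed
  ultimately show thesis using that K by blast
qed

subsection \<open>Commutation of the angle variables on the big space\<close>

context
  fixes A :: "complex ^ 'd ^ 'd" and w w' :: "complex ^ 'd" and \<rho> \<rho>' :: real and e e' :: "complex ^ 'd ^ 'd"
    and j j' :: nat
  assumes s: "simple_eig j A" "simple_eig j' A"
    and e: "e = \<rho> *\<^sub>R rank_one w" and e': "e' = \<rho>' *\<^sub>R rank_one w'"
    and nz: "overlap (eigproj j A) e \<noteq> 0" "overlap (eigproj j' A) e \<noteq> 0"
      "overlap (eigproj j A) e' \<noteq> 0" "overlap (eigproj j' A) e' \<noteq> 0"
begin

text \<open>The phase defect is the same for \<open>e\<close> and for \<open>e'\<close>, so it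
  cancels in the difference. This settles the pairing with any gradient that is constant on all
  slots involved.\<close>

lemma angle_gradient_invariant:
  assumes H: "skew_hermitian H"
  shows "lie_pairing A (frame_grad j j' A e - frame_grad j j' A e') H
    + lie_pairing e (orbit_grad j j' A e) H + lie_pairing e' (- orbit_grad j j' A e') H = 0"
  using frame_orbit_invariance[OF s _ H nz(1,2)] frame_orbit_invariance[OF s _ H nz(3,4)]
  by (simp add: e e' rank_le_one_scaled lie_pairing_linear)

text \<open>For neighbouring levels one extra term survives, carried by the shared orbit variable
  \<open>e'\<close>. A real structure that fixes \<open>A\<close> and \<open>e'\<close> also fixes
  \<open>A + e'\<close>, so it serves both levels.\<close>

lemma angle_gradients_consecutive:
  assumes k: "simple_eig k (A + e')" "simple_eig k' (A + e')"
  shows "lie_pairing e' (- orbit_grad j j' A e') (orbit_grad k k' (A + e') e') = 0"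
proof -
  have h: "hermitian A" using s by (simp add: simple_eig_def)
  obtain K where K: "real_structure K" "K A = A" "K (rank_one w') = rank_one w'"
    using real_structure_exists[OF h] by blast
  have Ke: "K e' = e'" by (simp add: e' real_structureD[OF K(1)] K)
  then have KA: "K (A + e') = A + e'" by (simp add: real_structureD[OF K(1)] K)
  have "lie_pairing e' (orbit_grad j j' A e') (orbit_grad k k' (A + e') e') = 0"
    by (rule real_structure_lie_pairing[OF K(1) Ke real_structure_frame_grad(2)[OF K(1,2) Ke s]
          real_structure_frame_grad(2)[OF K(1) KA Ke k]])
  then show ?thesis by (simp add: lie_pairing_linear)
qed

text \<open>No single eigenbasis need make both \<open>e\<close> and \<open>e'\<close> real.
  Equivariance, with the frame gradients themselves as generators, first cancels every term that
  mixes \<open>e\<close> and \<open>e'\<close>. Each remaining term involves one of them only and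
  vanishes by reality.\<close>

lemma angle_gradients_same_level:
  assumes k: "simple_eig k A" "simple_eig k' A"
    and nzk: "overlap (eigproj k A) e \<noteq> 0" "overlap (eigproj k' A) e \<noteq> 0"
      "overlap (eigproj k A) e' \<noteq> 0" "overlap (eigproj k' A) e' \<noteq> 0"
  defines "G \<equiv> frame_grad j j' A e - frame_grad j j' A e'" and "H \<equiv> frame_grad k k' A e - frame_grad k k' A e'"
  shows "lie_pairing A G H + lie_pairing e (orbit_grad j j' A e) H + lie_pairing e G (orbit_grad k k' A e)
    + lie_pairing e (orbit_grad j j' A e) (orbit_grad k k' A e)
    + lie_pairing e' (- orbit_grad j j' A e') (- orbit_grad k k' A e') = 0"
proof -
  have h: "hermitian A" and jj: "j < CARD('d)" "j' < CARD('d)" "k < CARD('d)" "k' < CARD('d)"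
    using s k by (auto simp: simple_eig_def)
  have r: "rank_le_one e" "rank_le_one e'" by (simp_all add: e e' rank_le_one_scaled)
  have sk: "skew_hermitian (frame_grad i i' A x)" for i i' x by (simp add: frame_grad_def skew_part_skew)
  let ?F = "frame_grad j j' A" and ?D = "orbit_grad j j' A" and ?F' = "frame_grad k k' A" and ?D' = "orbit_grad k k' A"
  have 1: "lie_pairing A (?F e) (?F' x) + lie_pairing e (?D e) (?F' x) = 0" for x
    using frame_orbit_invariance[OF s r(1) sk nz(1,2)] frame_grad_diagonal[OF k jj(1)] frame_grad_diagonal[OF k jj(2)] by simp
  have 2: "lie_pairing A (?F' e) (?F x) + lie_pairing e (?D' e) (?F x) = 0" for x
    using frame_orbit_invariance[OF k r(1) sk nzk(1,2)] frame_grad_diagonal[OF s jj(3)] frame_grad_diagonal[OF s jj(4)] by simp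
  \<comment> \<open>Stated for an arbitrary \<open>x\<close>, since it is used once with
    \<open>e\<close> and once with \<open>e'\<close>, each time with its own real structure.\<close>
  have real: "lie_pairing x (?F x) (?D' x) = 0" "lie_pairing x (?D x) (?D' x) = 0" "lie_pairing A (?F x) (?F' x) = 0"
    if x: "x = r *\<^sub>R rank_one v" for x r v
  proof -
    obtain K where K: "real_structure K" "K A = A" "K (rank_one v) = rank_one v"
      using real_structure_exists[OF h] by blast
    have Kx: "K x = x" by (simp add: x real_structureD[OF K(1)] K)
    note F = real_structure_frame_grad[OF K(1,2) Kx s] real_structure_frame_grad[OF K(1,2) Kx k]
    show "lie_pairing x (?F x) (?D' x) = 0" "lie_pairing x (?D x) (?D' x) = 0" "lie_pairing A (?F x) (?F' x) = 0"
      by (rule real_structure_lie_pairing[OF K(1)]; simp add: F Kx K)+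
  qed
  show ?thesis
    unfolding G_def H_def lie_pairing_linear
    using 1[of e] 1[of e'] 2[of e'] real[OF e] real[OF e']
      lie_pairing_antisym[of A "?F' e" "?F e'"] lie_pairing_antisym[of e "?D' e" "?F e'"]
    by linarith
qed

end

section \<open>Calculus along coordinate lines and continuity of partial sums\<close>

lemmas matrix_mult_has_vector_derivative = bounded_bilinear.has_vector_derivative[OF bounded_bilinear_matrix_mult]
lemmas bounded_linear_vector_derivative = bounded_linear.has_vector_derivative

lemma complex_inverse_has_vector_derivative:
  fixes f :: "real \<Rightarrow> complex"
  assumes "(f has_vector_derivative f') (at x)" "f x \<noteq> 0"
  shows "((\<lambda>x. inverse (f x)) has_vector_derivative - (f' * (inverse (f x) * inverse (f x)))) (at x)"
proof -
  have "(inverse has_field_derivative - (inverse (f x) ^ Suc (Suc 0))) (at (f x))"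
    by (rule DERIV_inverse[OF assms(2)])
  then have "((inverse \<circ> f) has_vector_derivative (f' * - (inverse (f x) ^ Suc (Suc 0)))) (at x)"
    by (rule field_vector_diff_chain_at[OF assms(1)])
  then show ?thesis by (simp add: comp_def)
qed

lemma partial_sum_upd:
  "s \<in> {1..n} \<Longrightarrow> partial_sum (x(s := x s + Y)) i = partial_sum x i + (if s \<le> i + 1 then Y else 0)"
proof -
  assume s: "s \<in> {1..n}"
  have "partial_sum (x(s := x s + Y)) i = (\<Sum>k=1..i+1. x k + (if k = s then Y else 0))"
    unfolding partial_sum_def by (intro sum.cong) auto
  also have "\<dots> = partial_sum x i + (if s \<le> i + 1 then Y else 0)"
    using s by (auto simp: partial_sum_def sum.distrib)
  finally show ?thesis .
qed

lemma partial_sum_hermitian: "x \<in> Herm_n n \<Longrightarrow> i + 1 \<le> n \<Longrightarrow> hermitian (partial_sum x i)"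
  unfolding partial_sum_def by (intro hermitian_sum) (auto simp: Herm_n_def PiE_iff)

lemma tendsto_coordinate: "((\<lambda>x :: 'a \<Rightarrow> 'b::topological_space. x k) \<longlongrightarrow> x k) (at x within S)"
  using continuous_on_product_coordinates[of k] continuous_on_def tendsto_within_subset
  by (metis UNIV_I subset_UNIV)

lemma partial_sum_tendsto: "((\<lambda>x. partial_sum x i) \<longlongrightarrow> partial_sum x i) (at x within S)"
  unfolding partial_sum_def by (intro tendsto_intros tendsto_coordinate)

lemma openin_if_eventually:
  assumes "W \<subseteq> S" "\<And>x. x \<in> W \<Longrightarrow> \<forall>\<^sub>F y in at x within S. y \<in> W"
  shows "openin (top_of_set S) W"
proof (subst openin_subopen, intro ballI)
  fix x assume x: "x \<in> W"
  then obtain T where T: "open T" "x \<in> T" "\<forall>y\<in>T. y \<noteq> x \<longrightarrow> y \<in> S \<longrightarrow> y \<in> W"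
    using assms(2)[OF x] unfolding eventually_at_topological by blast
  then have "S \<inter> T \<subseteq> W" using x by auto
  moreover have "openin (top_of_set S) (S \<inter> T)" using T(1) by (rule openin_open_Int)
  ultimately show "\<exists>T. openin (top_of_set S) T \<and> x \<in> T \<and> T \<subseteq> W"
    using T(2) x assms(1) by blast
qed

subsection \<open>A class of smooth functions\<close>

text \<open>The rational functions of the matrix entries and of the eigenvalues, spectral projections and
  reduced resolvents at simple eigenvalues of a partial sum are closed under differentiation.\<close>

inductive spectral_fun :: "nat \<Rightarrow> nat \<Rightarrow> nat set \<Rightarrow> ('d::finite) config set \<Rightarrow> ('d config \<Rightarrow> complex) \<Rightarrow> bool"
  for n i :: nat and J :: "nat set" and W :: "'d config set" where
  const: "spectral_fun n i J W (\<lambda>_. c)"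
| coord: "spectral_fun n i J W (\<lambda>x. x s $ a $ b)"
| eig: "j \<in> J \<Longrightarrow> spectral_fun n i J W (\<lambda>x. of_real (eigvals (partial_sum x i) ! j))"
| proj: "j \<in> J \<Longrightarrow> spectral_fun n i J W (\<lambda>x. eigproj j (partial_sum x i) $ a $ b)"
| res: "j \<in> J \<Longrightarrow> spectral_fun n i J W (\<lambda>x. red_resolvent j (partial_sum x i) $ a $ b)"
| add: "spectral_fun n i J W f \<Longrightarrow> spectral_fun n i J W g \<Longrightarrow> spectral_fun n i J W (\<lambda>x. f x + g x)"
| mult: "spectral_fun n i J W f \<Longrightarrow> spectral_fun n i J W g \<Longrightarrow> spectral_fun n i J W (\<lambda>x. f x * g x)"
| inverse: "spectral_fun n i J W f \<Longrightarrow> (\<And>x. x \<in> W \<Longrightarrow> f x \<noteq> 0) \<Longrightarrow> spectral_fun n i J W (\<lambda>x. inverse (f x))"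

lemma spectral_fun_minus: "spectral_fun n i J W f \<Longrightarrow> spectral_fun n i J W (\<lambda>x. - f x)"
  using spectral_fun.mult[OF spectral_fun.const[of n i J W "-1"]] by force

lemma spectral_fun_diff: "spectral_fun n i J W f \<Longrightarrow> spectral_fun n i J W g \<Longrightarrow> spectral_fun n i J W (\<lambda>x. f x - g x)"
  using spectral_fun.add[OF _ spectral_fun_minus] by force

lemma spectral_fun_sum: "finite I \<Longrightarrow> (\<And>k. k \<in> I \<Longrightarrow> spectral_fun n i J W (f k)) \<Longrightarrow> spectral_fun n i J W (\<lambda>x. \<Sum>k\<in>I. f k x)"
  by (induction I rule: finite_induct) (auto intro: spectral_fun.const spectral_fun.add)

definition spectral_matrix :: "nat \<Rightarrow> nat \<Rightarrow> nat set \<Rightarrow> ('d::finite) config set \<Rightarrow> ('d config \<Rightarrow> complex^'d^'d) \<Rightarrow> bool" where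
  "spectral_matrix n i J W M \<longleftrightarrow> (\<forall>a b. spectral_fun n i J W (\<lambda>x. M x $ a $ b))"

lemma spectral_matrix_const: "spectral_matrix n i J W (\<lambda>x. C)"
  by (auto simp: spectral_matrix_def intro: spectral_fun.intros)

lemma spectral_matrix_basic:
  "spectral_matrix n i J W (\<lambda>x. x s)"
  "j \<in> J \<Longrightarrow> spectral_matrix n i J W (\<lambda>x. eigproj j (partial_sum x i))"
  "j \<in> J \<Longrightarrow> spectral_matrix n i J W (\<lambda>x. red_resolvent j (partial_sum x i))"
  by (auto simp: spectral_matrix_def intro: spectral_fun.intros)

lemma spectral_matrix_mult:
  "spectral_matrix n i J W M \<Longrightarrow> spectral_matrix n i J W M' \<Longrightarrow> spectral_matrix n i J W (\<lambda>x. M x ** M' x)"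
  by (auto simp: spectral_matrix_def matrix_matrix_mult_def intro!: spectral_fun_sum spectral_fun.mult)

lemma spectral_matrix_add:
  "spectral_matrix n i J W M \<Longrightarrow> spectral_matrix n i J W M' \<Longrightarrow> spectral_matrix n i J W (\<lambda>x. M x + M' x)"
  "spectral_matrix n i J W M \<Longrightarrow> spectral_matrix n i J W M' \<Longrightarrow> spectral_matrix n i J W (\<lambda>x. M x - M' x)"
  by (auto simp: spectral_matrix_def intro!: spectral_fun_diff spectral_fun.add)

lemma spectral_fun_trace: "spectral_matrix n i J W M \<Longrightarrow> spectral_fun n i J W (\<lambda>x. trace (M x))"
  unfolding trace_def spectral_matrix_def by (intro spectral_fun_sum) auto

context
  fixes n i :: nat and J :: "nat set" and W :: "('d::finite) config set"
  assumes W: "W \<subseteq> Herm_n n" and J: "\<And>x j. x \<in> W \<Longrightarrow> j \<in> J \<Longrightarrow> simple_eig j (partial_sum x i)" and i: "i + 1 \<le> n"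
begin

lemma spectral_fun_continuous:
  assumes f: "spectral_fun n i J W f"
  shows "continuous_on W f"
  using f
proof induction
  case (coord s a b)
  show ?case
    unfolding continuous_on_def by (intro ballI tendsto_vec_nth tendsto_coordinate)
next
  case (eig j)
  have "((\<lambda>x. eigvals (partial_sum x i) ! j) \<longlongrightarrow> eigvals (partial_sum x i) ! j) (at x within W)" if x: "x \<in> W" for x
    by (rule eigvals_tendsto[OF _ _ partial_sum_tendsto])
      (use x J[OF _ eig] in \<open>auto simp: eventually_at_filter simple_eig_def\<close>)
  then show ?case unfolding continuous_on_def by (intro ballI tendsto_of_real)
next
  case (proj j a b)
  have "((\<lambda>x. eigproj j (partial_sum x i)) \<longlongrightarrow> eigproj j (partial_sum x i)) (at x within W)" if x: "x \<in> W" for x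
    by (rule eigproj_tendsto[OF J[OF x proj] _ partial_sum_tendsto])
      (use J[OF _ proj] in \<open>auto simp: eventually_at_filter\<close>)
  then show ?case unfolding continuous_on_def by (intro ballI tendsto_vec_nth)
next
  case (res j a b)
  have "((\<lambda>x. red_resolvent j (partial_sum x i)) \<longlongrightarrow> red_resolvent j (partial_sum x i)) (at x within W)" if x: "x \<in> W" for x
    by (rule red_resolvent_tendsto[OF J[OF x res] _ partial_sum_tendsto])
      (use J[OF _ res] in \<open>auto simp: eventually_at_filter\<close>)
  then show ?case unfolding continuous_on_def by (intro ballI tendsto_vec_nth)
qed (auto intro: continuous_intros)

text \<open>Algebraic operations use the usual rules. The three spectral generators use
  \<open>simple_eig_derivatives\<close>, whose right-hand sides lie in the class again.\<close>

lemma spectral_fun_derivative: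
  assumes f: "spectral_fun n i J W f" and s: "s \<in> {1..n}" and Y: "hermitian Y"
  shows "\<exists>f'. spectral_fun n i J W f' \<and>
    (\<forall>x\<in>W. ((\<lambda>t. f (x(s := x s + t *\<^sub>R Y))) has_vector_derivative f' x) (at 0))"
  using f
proof induction
  case (const c)
  show ?case by (intro exI[of _ "\<lambda>_. 0"]) (auto intro: spectral_fun.const)
next
  case (coord s' a b)
  have "((\<lambda>t. (x(s := x s + t *\<^sub>R Y)) s' $ a $ b) has_vector_derivative (if s' = s then Y else 0) $ a $ b) (at 0)" for x
  proof (cases "s' = s")
    case True
    have "((\<lambda>t::real. x s $ a $ b + t *\<^sub>R (Y $ a $ b)) has_vector_derivative Y $ a $ b) (at 0)"
      by (auto intro!: derivative_eq_intros)
    then show ?thesis using True by simp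
  qed simp
  then show ?case by (intro exI[of _ "\<lambda>_. (if s' = s then Y else 0) $ a $ b"]) (auto intro: spectral_fun.const)
next
  case (add f g)
  then obtain f' g' where "spectral_fun n i J W f'" "spectral_fun n i J W g'"
    "\<forall>x\<in>W. ((\<lambda>t. f (x(s := x s + t *\<^sub>R Y))) has_vector_derivative f' x) (at 0)"
    "\<forall>x\<in>W. ((\<lambda>t. g (x(s := x s + t *\<^sub>R Y))) has_vector_derivative g' x) (at 0)" by blast
  moreover from this have "((\<lambda>t. f (x(s := x s + t *\<^sub>R Y)) + g (x(s := x s + t *\<^sub>R Y))) has_vector_derivative f' x + g' x) (at 0)" if "x \<in> W" for x
    using that by (intro has_vector_derivative_add) blast+
  ultimately show ?case
    by (intro exI[of _ "\<lambda>x. f' x + g' x"]) (blast intro: spectral_fun.add)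
next
  case (mult f g)
  then obtain f' g' where fg: "spectral_fun n i J W f'" "spectral_fun n i J W g'"
    "\<forall>x\<in>W. ((\<lambda>t. f (x(s := x s + t *\<^sub>R Y))) has_vector_derivative f' x) (at 0)"
    "\<forall>x\<in>W. ((\<lambda>t. g (x(s := x s + t *\<^sub>R Y))) has_vector_derivative g' x) (at 0)" by blast
  have d: "((\<lambda>t. f (x(s := x s + t *\<^sub>R Y)) * g (x(s := x s + t *\<^sub>R Y))) has_vector_derivative f x * g' x + f' x * g x) (at 0)" if "x \<in> W" for x
    using has_vector_derivative_mult[OF fg(3)[rule_format, OF that] fg(4)[rule_format, OF that]] by simp
  show ?case
    by (intro exI[of _ "\<lambda>x. f x * g' x + f' x * g x"] conjI ballI d spectral_fun.add spectral_fun.mult fg mult.hyps)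
next
  case (inverse f)
  then obtain f' where f': "spectral_fun n i J W f'"
    "\<forall>x\<in>W. ((\<lambda>t. f (x(s := x s + t *\<^sub>R Y))) has_vector_derivative f' x) (at 0)" by blast
  have d: "((\<lambda>t. inverse (f (x(s := x s + t *\<^sub>R Y)))) has_vector_derivative - (f' x * (inverse (f x) * inverse (f x)))) (at 0)" if "x \<in> W" for x
    using complex_inverse_has_vector_derivative[OF f'(2)[rule_format, OF that]] inverse.hyps(2)[OF that] by simp
  show ?case
    by (intro exI[of _ "\<lambda>x. - (f' x * (inverse (f x) * inverse (f x)))"] conjI ballI d
        spectral_fun_minus spectral_fun.mult spectral_fun.inverse f' inverse.hyps)
next
  \<comment> \<open>The direction in which the partial sum moves; it does not move if slot
    \<open>s\<close> comes after the summands.\<close>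
  define YA where "YA = (if s \<le> i + 1 then Y else 0)"
  have hY: "hermitian YA" using Y by (simp add: YA_def hermitian_closed)
  have ps: "partial_sum (x(s := x s + t *\<^sub>R Y)) i = partial_sum x i + t *\<^sub>R YA" for x t
    using partial_sum_upd[OF s, of x "t *\<^sub>R Y" i] by (simp add: YA_def)
  let ?P = "\<lambda>j x. eigproj j (partial_sum x i)" and ?S = "\<lambda>j x. red_resolvent j (partial_sum x i)"
  let ?PY = "\<lambda>j x. ?S j x ** YA ** ?P j x + ?P j x ** YA ** ?S j x"
  let ?lY = "\<lambda>j x. Re (trace (?P j x ** YA))"
  have lY: "of_real (?lY j x) = trace (?P j x ** YA)" if x: "x \<in> W" "j \<in> J" for j x
  proof -
    have "hermitian (?P j x)"
      using J[OF x] eigproj_basic(1)[of "partial_sum x i" j] by (auto simp: simple_eig_def hermitian_def)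
    then show ?thesis using trace_overlap[of "?P j x" YA] hY by (simp add: overlap_def)
  qed
  note D = simple_eig_derivatives[OF J hY]
  note M = spectral_matrix_mult spectral_matrix_add spectral_matrix_basic spectral_matrix_const
  {
    case (eig j)
    have "((\<lambda>t. complex_of_real (eigvals (partial_sum x i + t *\<^sub>R YA) ! j)) has_vector_derivative trace (?P j x ** YA)) (at 0)" if x: "x \<in> W" for x
      using bounded_linear_vector_derivative[OF bounded_linear_of_real[where 'a = complex] D(1)[OF x eig]] by (simp add: lY[OF x eig])
    then show ?case
      unfolding ps by (intro exI[of _ "\<lambda>x. trace (?P j x ** YA)"] conjI ballI spectral_fun_trace M eig)
  next
    case (proj j a b)
    have "((\<lambda>t. eigproj j (partial_sum x i + t *\<^sub>R YA) $ a $ b) has_vector_derivative ?PY j x $ a $ b) (at 0)" if x: "x \<in> W" for x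
      by (rule bounded_linear_vector_derivative[OF bounded_linear_compose[OF bounded_linear_vec_nth bounded_linear_vec_nth] D(2)[OF x proj]])
    moreover have "spectral_matrix n i J W (?PY j)" using proj by (intro M)
    ultimately show ?case
      unfolding ps spectral_matrix_def by blast
  next
    case (res j a b)
    let ?SY = "\<lambda>x. (?S j x + ?P j x) ** (YA - cscale (trace (?P j x ** YA)) (mat 1) - ?PY j x) ** (?S j x + ?P j x) - ?PY j x"
    have "((\<lambda>t. red_resolvent j (partial_sum x i + t *\<^sub>R YA) $ a $ b) has_vector_derivative ?SY x $ a $ b) (at 0)" if x: "x \<in> W" for x
      using bounded_linear_vector_derivative[OF bounded_linear_compose[OF bounded_linear_vec_nth[of b] bounded_linear_vec_nth[of a]] D(3)[OF x res]]
      by (simp only: lY[OF x res] flip: cscale_of_real)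
    moreover have "spectral_matrix n i J W (\<lambda>x. cscale (trace (?P j x ** YA)) (mat 1))"
      unfolding spectral_matrix_def cscale_nth
      by (intro allI spectral_fun.mult spectral_fun.const spectral_fun_trace M res)
    then have "spectral_matrix n i J W ?SY" using res by (intro M)
    ultimately show ?case
      unfolding ps spectral_matrix_def by blast
  }
qed

text \<open>\<open>smooth_on\<close> is coinductive, so real parts of a class of continuous
  functions closed under differentiation are smooth; the class itself is the coinduction
  invariant.\<close>

lemma spectral_fun_smooth:
  assumes f: "spectral_fun n i J W f"
  shows "smooth_on n W (\<lambda>x. Re (f x))"
proof (rule smooth_on.coinduct[where X = "\<lambda>F. \<exists>f. F = (\<lambda>x. Re (f x)) \<and> spectral_fun n i J W f"])
  show "\<exists>g. (\<lambda>x. Re (f x)) = (\<lambda>x. Re (g x)) \<and> spectral_fun n i J W g" using f by blast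
next
  fix F assume "\<exists>f. F = (\<lambda>x. Re (f x)) \<and> spectral_fun n i J W f"
  then obtain f where F: "F = (\<lambda>x. Re (f x))" and f: "spectral_fun n i J W f" by blast
  have "continuous_on W F" unfolding F by (intro continuous_intros spectral_fun_continuous f)
  moreover have "\<exists>D. (\<forall>e\<in>W. ((\<lambda>t. F (e(s := e s + t *\<^sub>R Y))) has_real_derivative D e) (at 0)) \<and>
        ((\<exists>f. D = (\<lambda>x. Re (f x)) \<and> spectral_fun n i J W f) \<or> smooth_on n W D)" if sY: "s \<in> {1..n}" "hermitian Y" for s Y
  proof -
    obtain f' where f': "spectral_fun n i J W f'"
      "\<forall>x\<in>W. ((\<lambda>t. f (x(s := x s + t *\<^sub>R Y))) has_vector_derivative f' x) (at 0)"
      using spectral_fun_derivative[OF f sY] by blast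
    have "((\<lambda>t. Re (f (e(s := e s + t *\<^sub>R Y)))) has_real_derivative Re (f' e)) (at 0)" if "e \<in> W" for e
      using bounded_linear_vector_derivative[OF bounded_linear_Re f'(2)[rule_format, OF that]]
      by (simp add: has_real_derivative_iff_has_vector_derivative)
    then show ?thesis using f'(1) unfolding F by (intro exI[of _ "\<lambda>x. Re (f' x)"]) blast
  qed
  ultimately show "\<exists>G. F = G \<and> continuous_on W G \<and> (\<forall>s\<in>{1..n}. \<forall>Y. hermitian Y \<longrightarrow>
      (\<exists>D. (\<forall>e\<in>W. ((\<lambda>t. G (e(s := e s + t *\<^sub>R Y))) has_real_derivative D e) (at 0)) \<and>
        ((\<exists>f. D = (\<lambda>x. Re (f x)) \<and> spectral_fun n i J W f) \<or> smooth_on n W D)))"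
    by blast
qed

end

subsection \<open>Local lifts of the angle variables\<close>

definition angle_trace :: "nat \<Rightarrow> nat \<Rightarrow> nat \<Rightarrow> ('d::finite) config \<Rightarrow> complex" where
  "angle_trace i j j' x = trace (eigproj j (partial_sum x i) ** x (i + 1) ** eigproj j' (partial_sum x i) ** x (i + 2))"

text \<open>After division by \<open>q\<close>, usually the value at the base point, the right
  half-plane avoids the cut of \<open>Ln\<close>. A continuous branch of the argument near
  \<open>q\<close> therefore exists on the whole domain, wherever \<open>q\<close> lies.\<close>

definition angle_domain :: "nat \<Rightarrow> nat \<Rightarrow> nat \<Rightarrow> nat \<Rightarrow> complex \<Rightarrow> ('d::finite) config set" where
  "angle_domain n i j j' q = {x \<in> Herm_n n. simple_eig j (partial_sum x i) \<and> simple_eig j' (partial_sum x i) \<and>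
     Re (angle_trace i j j' x / q) > 0}"

definition angle_lift :: "nat \<Rightarrow> nat \<Rightarrow> nat \<Rightarrow> complex \<Rightarrow> ('d::finite) config \<Rightarrow> real" where
  "angle_lift i j j' q x = Arg q + Im (Ln (angle_trace i j j' x / q))"

lemma angle_trace_tendsto:
  fixes x :: "('d::finite) config"
  assumes i: "i + 1 \<le> n" and x: "x \<in> Herm_n n" and s: "simple_eig j (partial_sum x i)" "simple_eig j' (partial_sum x i)"
  shows "((\<lambda>y. angle_trace i j j' y) \<longlongrightarrow> angle_trace i j j' x) (at x within Herm_n n)"
    and "\<forall>\<^sub>F y in at x within Herm_n n. simple_eig j (partial_sum y i) \<and> simple_eig j' (partial_sum y i)"
proof -
  have h: "\<forall>\<^sub>F y in at x within Herm_n n. hermitian (partial_sum y i)"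
    unfolding eventually_at_filter by (intro always_eventually) (use partial_sum_hermitian[OF _ i] in blast)
  note ev = simple_eig_eventually[OF s(1) h partial_sum_tendsto] simple_eig_eventually[OF s(2) h partial_sum_tendsto]
  then show "\<forall>\<^sub>F y in at x within Herm_n n. simple_eig j (partial_sum y i) \<and> simple_eig j' (partial_sum y i)"
    by (rule eventually_conj)
  show "((\<lambda>y. angle_trace i j j' y) \<longlongrightarrow> angle_trace i j j' x) (at x within Herm_n n)"
    unfolding angle_trace_def
    by (intro tendsto_trace tendsto_matrix_mult tendsto_coordinate
        eigproj_tendsto[OF s(1) ev(1) partial_sum_tendsto] eigproj_tendsto[OF s(2) ev(2) partial_sum_tendsto])
qed

lemma angle_domain_open:
  assumes i: "i + 1 \<le> n" and q: "q \<noteq> 0"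
  shows "openin (top_of_set (Herm_n n)) (angle_domain n i j j' q :: ('d::finite) config set)"
proof (rule openin_if_eventually)
  fix x :: "'d config" assume x: "x \<in> angle_domain n i j j' q"
  then have xs: "x \<in> Herm_n n" "simple_eig j (partial_sum x i)" "simple_eig j' (partial_sum x i)"
    and re: "0 < Re (angle_trace i j j' x / q)" by (auto simp: angle_domain_def)
  have "((\<lambda>y. Re (angle_trace i j j' y / q)) \<longlongrightarrow> Re (angle_trace i j j' x / q)) (at x within Herm_n n)"
    by (intro tendsto_intros angle_trace_tendsto[OF i xs] q)
  then have "\<forall>\<^sub>F y in at x within Herm_n n. 0 < Re (angle_trace i j j' y / q)"
    using re by (rule order_tendstoD)
  moreover have "\<forall>\<^sub>F y in at x within Herm_n n. y \<in> Herm_n n" by (auto simp: eventually_at_filter)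
  ultimately show "\<forall>\<^sub>F y in at x within Herm_n n. y \<in> angle_domain n i j j' q"
    using angle_trace_tendsto(2)[OF i xs] by eventually_elim (auto simp: angle_domain_def)
qed (auto simp: angle_domain_def)

lemma angle_domain_nonzero: "x \<in> angle_domain n i j j' q \<Longrightarrow> angle_trace i j j' x \<noteq> 0 \<and> q \<noteq> 0 \<and> angle_trace i j j' x / q \<notin> \<real>\<^sub>\<le>\<^sub>0"
  by (auto simp: angle_domain_def complex_nonpos_Reals_iff)

lemma angle_lift_derivative:
  assumes x: "x \<in> angle_domain n i j j' q"
    and d: "((\<lambda>t. angle_trace i j j' (x(s := x s + t *\<^sub>R Y))) has_vector_derivative D) (at 0)"
  shows "((\<lambda>t. angle_lift i j j' q (x(s := x s + t *\<^sub>R Y))) has_real_derivative Im (D / angle_trace i j j' x)) (at 0)"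
proof -
  let ?Q = "\<lambda>t. angle_trace i j j' (x(s := x s + t *\<^sub>R Y))"
  have nz: "angle_trace i j j' x \<noteq> 0" "q \<noteq> 0" "angle_trace i j j' x / q \<notin> \<real>\<^sub>\<le>\<^sub>0" using angle_domain_nonzero[OF x] by auto
  have "((\<lambda>z. Ln (z / q)) has_field_derivative (1 / q) * inverse (?Q 0 / q)) (at (?Q 0))"
    using nz by (auto intro!: derivative_eq_intros simp: divide_simps)
  from field_vector_diff_chain_at[OF d this]
  have "((\<lambda>t. Ln (?Q t / q)) has_vector_derivative D * ((1 / q) * inverse (?Q 0 / q))) (at 0)"
    unfolding comp_def .
  moreover have "D * ((1 / q) * inverse (?Q 0 / q)) = D / angle_trace i j j' x"
    using nz by simp
  ultimately have "((\<lambda>t. Ln (?Q t / q)) has_vector_derivative D / angle_trace i j j' x) (at 0)"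
    by (simp only:)
  from bounded_linear_vector_derivative[OF bounded_linear_Im this]
  have "((\<lambda>t. Im (Ln (?Q t / q))) has_vector_derivative Im (D / angle_trace i j j' x)) (at 0)" .
  then have "((\<lambda>t. Arg q + Im (Ln (?Q t / q))) has_vector_derivative 0 + Im (D / angle_trace i j j' x)) (at 0)"
    by (intro has_vector_derivative_add has_vector_derivative_const)
  then show ?thesis
    by (simp add: angle_lift_def has_real_derivative_iff_has_vector_derivative)
qed

text \<open>A logarithm leaves the class of spectral functions, but its derivative is a quotient
  inside the class. One differentiation by hand therefore suffices.\<close>

lemma angle_lift_smooth:
  assumes i: "i + 1 \<le> n"
  shows "smooth_on n (angle_domain n i j j' q) (angle_lift i j j' q :: ('d::finite) config \<Rightarrow> real)"
proof -
  let ?W = "angle_domain n i j j' q :: 'd config set" and ?Q = "angle_trace i j j' :: 'd config \<Rightarrow> complex"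
  have W: "?W \<subseteq> Herm_n n" and J: "\<And>x k. x \<in> ?W \<Longrightarrow> k \<in> {j, j'} \<Longrightarrow> simple_eig k (partial_sum x i)"
    by (auto simp: angle_domain_def)
  have Q: "spectral_fun n i {j, j'} ?W ?Q"
    unfolding angle_trace_def
    by (intro spectral_fun_trace spectral_matrix_mult spectral_matrix_basic) auto
  have nz: "?Q x \<noteq> 0" "q \<noteq> 0" "?Q x / q \<notin> \<real>\<^sub>\<le>\<^sub>0" if "x \<in> ?W" for x using angle_domain_nonzero[OF that] by auto
  show ?thesis
  proof (rule smooth_on.intros)
    have "continuous_on ?W ?Q" by (rule spectral_fun_continuous[OF W J i Q])
    then show "continuous_on ?W (angle_lift i j j' q)"
      unfolding angle_lift_def using nz by (intro continuous_intros) auto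
    show "\<forall>s\<in>{1..n}. \<forall>Y. hermitian Y \<longrightarrow> (\<exists>D. (\<forall>e\<in>?W. ((\<lambda>t. angle_lift i j j' q (e(s := e s + t *\<^sub>R Y))) has_real_derivative D e) (at 0)) \<and> smooth_on n ?W D)"
    proof (intro ballI allI impI)
      fix s and Y :: "complex^'d^'d" assume sY: "s \<in> {1..n}" "hermitian Y"
      obtain Q' where Q': "spectral_fun n i {j, j'} ?W Q'"
        "\<forall>x\<in>?W. ((\<lambda>t. ?Q (x(s := x s + t *\<^sub>R Y))) has_vector_derivative Q' x) (at 0)"
        using spectral_fun_derivative[OF W J i Q sY] by blast
      have "spectral_fun n i {j, j'} ?W (\<lambda>x. - \<i> * (Q' x * inverse (?Q x)))"
        by (intro spectral_fun.mult spectral_fun.const Q' spectral_fun.inverse Q nz)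
      from spectral_fun_smooth[OF W J i this]
      have "smooth_on n ?W (\<lambda>x. Re (- \<i> * (Q' x * inverse (?Q x))))" by blast
      moreover have "((\<lambda>t. angle_lift i j j' q (x(s := x s + t *\<^sub>R Y))) has_real_derivative Re (- \<i> * (Q' x * inverse (?Q x)))) (at 0)" if "x \<in> ?W" for x
        using angle_lift_derivative[OF that Q'(2)[rule_format, OF that]] by (simp add: divide_inverse)
      ultimately show "\<exists>D. (\<forall>e\<in>?W. ((\<lambda>t. angle_lift i j j' q (e(s := e s + t *\<^sub>R Y))) has_real_derivative D e) (at 0)) \<and> smooth_on n ?W D"
        by (intro exI[of _ "\<lambda>x. Re (- \<i> * (Q' x * inverse (?Q x)))"]) blast
    qed
  qed
qed

subsection \<open>The gradient of a lift\<close>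

text \<open>Turns a proportionality supplied by \<open>rank_le_one_exchange\<close> into an equality
  of logarithmic derivatives, in which the long denominator is replaced by a short one.\<close>

lemma cscale_eq_imp_divide:
  assumes "cscale p A = cscale q B" "p \<noteq> 0" "q \<noteq> 0"
  shows "trace (Y ** A) / q = trace (Y ** B) / p"
proof -
  have "trace (Y ** cscale p A) = trace (Y ** cscale q B)" using assms by simp
  then have "p * trace (Y ** A) = q * trace (Y ** B)" by (simp add: cscale_mult_right trace_cscale)
  then show ?thesis using assms by (simp add: field_simps)
qed

context
  fixes A :: "complex ^ 'd ^ 'd" and e e' :: "complex ^ 'd ^ 'd" and j j' :: nat
  assumes s: "simple_eig j A" "simple_eig j' A"
    and e: "rank_le_one e" and e': "rank_le_one e'"
    and nz: "overlap (eigproj j A) e \<noteq> 0" "overlap (eigproj j' A) e \<noteq> 0"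
      "overlap (eigproj j A) e' \<noteq> 0" "overlap (eigproj j' A) e' \<noteq> 0"
    and Qnz: "trace (eigproj j A ** e ** eigproj j' A ** e') \<noteq> 0"
begin

private abbreviation "Pr \<equiv> eigproj j A"
private abbreviation "Pr' \<equiv> eigproj j' A"
private abbreviation "Rs \<equiv> red_resolvent j A"
private abbreviation "Rs' \<equiv> red_resolvent j' A"
private abbreviation "Qt \<equiv> trace (Pr ** e ** Pr' ** e')"

private lemma rk: "rank_le_one Pr" "rank_le_one Pr'" and hm: "hermitian Pr" "hermitian Pr'" "hermitian Rs" "hermitian Rs'" "hermitian e" "hermitian e'"
proof -
  have h: "hermitian A" and j: "j < CARD('d)" "j' < CARD('d)" using s by (auto simp: simple_eig_def)
  show rk: "rank_le_one Pr" "rank_le_one Pr'" using rank_le_one_eigproj[OF h] j by auto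
  show "hermitian Pr" "hermitian Pr'" "hermitian Rs" "hermitian Rs'" "hermitian e" "hermitian e'"
    using rk e e' red_resolvent(1)[OF s(1)] red_resolvent(1)[OF s(2)] rank_le_one_hermitian
    by (auto simp: hermitian_def)
qed

private lemma tr: "trace (Pr ** e) = of_real (overlap Pr e)" "trace (Pr' ** e) = of_real (overlap Pr' e)"
  "trace (Pr ** e') = of_real (overlap Pr e')" "trace (Pr' ** e') = of_real (overlap Pr' e')"
  "trace (e ** Pr) = of_real (overlap Pr e)" "trace (e ** Pr') = of_real (overlap Pr' e)"
  "trace (e' ** Pr) = of_real (overlap Pr e')" "trace (e' ** Pr') = of_real (overlap Pr' e')"
  by (rule trace_overlap trace_overlap' hm)+

private lemma cyc: "trace (e' ** Pr ** e ** Pr') = Qt" "trace (Pr' ** e' ** Pr ** e) = Qt" "trace (e ** Pr' ** e' ** Pr) = Qt"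
  by (metis trace_cycle4)+

text \<open>The logarithmic derivative has four terms. In each, the rank-one factors not touched by
  \<open>Y\<close> cancel against the full trace and leave a single overlap. This is how the
  fourfold trace separates into a part for \<open>e\<close> and a part for
  \<open>e'\<close>.\<close>

lemma angle_trace_frame_derivative:
  assumes Y: "hermitian Y"
  shows "Im ((trace ((Rs ** Y ** Pr + Pr ** Y ** Rs) ** e ** Pr' ** e') + trace (Pr ** e ** (Rs' ** Y ** Pr' + Pr' ** Y ** Rs') ** e')) / Qt)
    = Im (trace ((frame_grad j j' A e - frame_grad j j' A e') ** Y))"
proof -
  \<comment> \<open>In two of the four terms the resolvent ends up on the far side of the product.
    Passing to the adjoint reverses the order at the cost of a sign, which is the origin of the
    minus signs in the result.\<close>
  have adjIm: "Im (trace (Y ** (X ** Z ** T))) = - Im (trace (T ** Z ** X ** Y))"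
    if "hermitian X" "hermitian Z" "hermitian T" for X Z T
  proof -
    have "adj (Y ** (X ** Z ** T)) = T ** Z ** X ** Y"
      using that Y by (simp add: adj_mult hermitianD matrix_mul_assoc)
    then have "trace (T ** Z ** X ** Y) = cnj (trace (Y ** (X ** Z ** T)))" by (metis trace_adj)
    then show ?thesis by simp
  qed
  have 1: "trace (Rs ** Y ** Pr ** e ** Pr' ** e') / Qt = trace (Y ** (Pr ** e' ** Rs)) / of_real (overlap Pr e')"
  proof -
    have "cscale (trace (e' ** Pr)) (Pr ** (e ** Pr') ** e') = cscale (trace (e' ** Pr ** (e ** Pr'))) (Pr ** e')"
      by (rule rank_le_one_exchange[OF rk(1) e'])
    then have "cscale (of_real (overlap Pr e')) (Pr ** e ** Pr' ** e') = cscale Qt (Pr ** e')"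
      by (simp add: tr cyc matrix_mul_assoc)
    from cscale_eq_imp_divide[OF this, of "Rs ** Y"] nz Qnz
    have "trace (Rs ** Y ** (Pr ** e ** Pr' ** e')) / Qt = trace (Rs ** Y ** (Pr ** e')) / of_real (overlap Pr e')" by simp
    moreover have "trace (Rs ** Y ** (Pr ** e')) = trace (Y ** (Pr ** e' ** Rs))"
      using trace_mul_sym[of Rs "Y ** (Pr ** e')"] by (simp add: matrix_mul_assoc)
    ultimately show ?thesis by (simp add: matrix_mul_assoc)
  qed
  have 2: "trace (Pr ** Y ** Rs ** e ** Pr' ** e') / Qt = trace (Rs ** e ** Pr ** Y) / of_real (overlap Pr e)"
  proof -
    have "cscale (trace (Pr ** e)) (e ** (Pr' ** e') ** Pr) = cscale (trace (Pr ** e ** (Pr' ** e'))) (e ** Pr)"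
      by (rule rank_le_one_exchange[OF e rk(1)])
    then have "cscale (of_real (overlap Pr e)) (e ** Pr' ** e' ** Pr) = cscale Qt (e ** Pr)"
      by (simp add: tr cyc matrix_mul_assoc)
    from cscale_eq_imp_divide[OF this, of "Y ** Rs"] nz Qnz
    have "trace (Y ** Rs ** (e ** Pr' ** e' ** Pr)) / Qt = trace (Y ** Rs ** (e ** Pr)) / of_real (overlap Pr e)" by simp
    moreover have "trace (Y ** Rs ** (e ** Pr)) = trace (Rs ** e ** Pr ** Y)"
      using trace_mul_sym[of Y "Rs ** (e ** Pr)"] by (simp add: matrix_mul_assoc)
    moreover have "trace (Y ** Rs ** (e ** Pr' ** e' ** Pr)) = trace (Pr ** Y ** Rs ** e ** Pr' ** e')"
      using trace_mul_sym[of Pr "Y ** Rs ** e ** Pr' ** e'"] by (simp add: matrix_mul_assoc)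
    ultimately show ?thesis by simp
  qed
  have 3: "trace (Pr ** e ** Rs' ** Y ** Pr' ** e') / Qt = trace (Y ** (Pr' ** e ** Rs')) / of_real (overlap Pr' e)"
  proof -
    have "cscale (trace (e ** Pr')) (Pr' ** (e' ** Pr) ** e) = cscale (trace (e ** Pr' ** (e' ** Pr))) (Pr' ** e)"
      by (rule rank_le_one_exchange[OF rk(2) e])
    then have "cscale (of_real (overlap Pr' e)) (Pr' ** e' ** Pr ** e) = cscale Qt (Pr' ** e)"
      by (simp add: tr cyc matrix_mul_assoc)
    from cscale_eq_imp_divide[OF this, of "Rs' ** Y"] nz Qnz
    have "trace (Rs' ** Y ** (Pr' ** e' ** Pr ** e)) / Qt = trace (Rs' ** Y ** (Pr' ** e)) / of_real (overlap Pr' e)" by simp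
    moreover have "trace (Rs' ** Y ** (Pr' ** e)) = trace (Y ** (Pr' ** e ** Rs'))"
      using trace_mul_sym[of Rs' "Y ** (Pr' ** e)"] by (simp add: matrix_mul_assoc)
    moreover have "trace (Rs' ** Y ** (Pr' ** e' ** Pr ** e)) = trace (Pr ** e ** Rs' ** Y ** Pr' ** e')"
      using trace_mul_sym[of "Pr ** e" "Rs' ** Y ** Pr' ** e'"] by (simp add: matrix_mul_assoc)
    ultimately show ?thesis by simp
  qed
  have 4: "trace (Pr ** e ** Pr' ** Y ** Rs' ** e') / Qt = trace (Rs' ** e' ** Pr' ** Y) / of_real (overlap Pr' e')"
  proof -
    have "cscale (trace (Pr' ** e')) (e' ** (Pr ** e) ** Pr') = cscale (trace (Pr' ** e' ** (Pr ** e))) (e' ** Pr')"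
      by (rule rank_le_one_exchange[OF e' rk(2)])
    then have "cscale (of_real (overlap Pr' e')) (e' ** Pr ** e ** Pr') = cscale Qt (e' ** Pr')"
      by (simp add: tr cyc matrix_mul_assoc)
    from cscale_eq_imp_divide[OF this, of "Y ** Rs'"] nz Qnz
    have "trace (Y ** Rs' ** (e' ** Pr ** e ** Pr')) / Qt = trace (Y ** Rs' ** (e' ** Pr')) / of_real (overlap Pr' e')" by simp
    moreover have "trace (Y ** Rs' ** (e' ** Pr')) = trace (Rs' ** e' ** Pr' ** Y)"
      using trace_mul_sym[of Y "Rs' ** (e' ** Pr')"] by (simp add: matrix_mul_assoc)
    moreover have "trace (Y ** Rs' ** (e' ** Pr ** e ** Pr')) = trace (Pr ** e ** Pr' ** Y ** Rs' ** e')"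
      using trace_mul_sym[of "Pr ** e ** Pr'" "Y ** Rs' ** e'"] by (simp add: matrix_mul_assoc)
    ultimately show ?thesis by simp
  qed
  have div: "Im (z / of_real r) = Im z / r" for z r by (simp add: Im_divide_of_real)
  have "Im ((trace ((Rs ** Y ** Pr + Pr ** Y ** Rs) ** e ** Pr' ** e') + trace (Pr ** e ** (Rs' ** Y ** Pr' + Pr' ** Y ** Rs') ** e')) / Qt)
     = Im (trace (Rs ** Y ** Pr ** e ** Pr' ** e') / Qt) + Im (trace (Pr ** Y ** Rs ** e ** Pr' ** e') / Qt)
       + Im (trace (Pr ** e ** Rs' ** Y ** Pr' ** e') / Qt) + Im (trace (Pr ** e ** Pr' ** Y ** Rs' ** e') / Qt)"
    by (simp add: mat_distribs trace_simps matrix_mul_assoc add_divide_distrib)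
  also have "\<dots> = - Im (trace (Rs ** e' ** Pr ** Y)) / overlap Pr e' + Im (trace (Rs ** e ** Pr ** Y)) / overlap Pr e
       - Im (trace (Rs' ** e ** Pr' ** Y)) / overlap Pr' e + Im (trace (Rs' ** e' ** Pr' ** Y)) / overlap Pr' e'"
    unfolding 1 2 3 4 div by (simp add: adjIm hm)
  also have "\<dots> = Im (trace ((frame_grad j j' A e - frame_grad j j' A e') ** Y))"
    by (simp add: frame_grad_def mat_distribs(4) trace_sub skew_part_pairing Y) (simp add: mat_distribs trace_simps)
  finally show ?thesis .
qed

text \<open>Three sandwiches show that the full trace times \<open>Pr' ** e ** Pr\<close> is the
  product of the two overlaps with \<open>e\<close> times \<open>Pr' ** e' ** Pr\<close>. Replacing
  \<open>e\<close> by \<open>e'\<close> reverses the order of the product, hence the opposite sign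
  in the second claim.\<close>

lemma angle_trace_orbit_derivative:
  assumes Y: "hermitian Y"
  shows "Im (trace (Pr ** Y ** Pr' ** e') / Qt) = Im (trace (orbit_grad j j' A e ** Y))"
    and "Im (trace (Pr ** e ** Pr' ** Y) / Qt) = - Im (trace (orbit_grad j j' A e' ** Y))"
proof -
  have "cscale Qt (Pr' ** e ** Pr) = Pr' ** e ** cscale (trace ((e ** Pr' ** e') ** Pr)) Pr"
    by (simp add: cyc cscale_mult_right)
  also have "\<dots> = Pr' ** e ** (Pr ** (e ** Pr' ** e') ** Pr)"
    by (simp only: rank_le_one_sandwich[OF rk(1), of "e ** Pr' ** e'"])
  also have "\<dots> = Pr' ** (e ** Pr ** e) ** Pr' ** e' ** Pr"
    by (simp add: matrix_mul_assoc)
  also have "\<dots> = cscale (of_real (overlap Pr e)) ((Pr' ** e ** Pr') ** e' ** Pr)"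
    by (simp only: rank_le_one_sandwich[OF e] tr cscale_mult_left cscale_mult_right)
  also have "\<dots> = cscale (of_real (overlap Pr e * overlap Pr' e)) (Pr' ** e' ** Pr)"
    by (simp only: rank_le_one_sandwich[OF rk(2)] tr cscale_mult_left cscale_mult_right cscale_cscale of_real_mult)
  finally have "cscale (of_real (overlap Pr e * overlap Pr' e)) (Pr' ** e' ** Pr) = cscale Qt (Pr' ** e ** Pr)" by simp
  from cscale_eq_imp_divide[OF this, of Y] nz Qnz
  have "trace (Y ** (Pr' ** e' ** Pr)) / Qt = trace (Y ** (Pr' ** e ** Pr)) / of_real (overlap Pr e * overlap Pr' e)" by simp
  moreover have "trace (Pr ** Y ** Pr' ** e') = trace (Y ** (Pr' ** e' ** Pr))"
    using trace_mul_sym[of Pr "Y ** Pr' ** e'"] by (simp add: matrix_mul_assoc)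
  ultimately have "Im (trace (Pr ** Y ** Pr' ** e') / Qt) = Im (trace (Pr' ** e ** Pr ** Y)) / (overlap Pr e * overlap Pr' e)"
    by (simp only: trace_mul_sym[of Y] Im_divide_of_real)
  then show "Im (trace (Pr ** Y ** Pr' ** e') / Qt) = Im (trace (orbit_grad j j' A e ** Y))"
    by (simp add: orbit_grad_def skew_part_pairing Y mat_distribs trace_simps)
  have "cscale Qt (Pr ** e' ** Pr') = Pr ** e' ** cscale (trace ((e' ** Pr ** e) ** Pr')) Pr'"
    by (simp add: cyc cscale_mult_right)
  also have "\<dots> = Pr ** e' ** (Pr' ** (e' ** Pr ** e) ** Pr')"
    by (simp only: rank_le_one_sandwich[OF rk(2), of "e' ** Pr ** e"])
  also have "\<dots> = Pr ** (e' ** Pr' ** e') ** Pr ** e ** Pr'"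
    by (simp add: matrix_mul_assoc)
  also have "\<dots> = cscale (of_real (overlap Pr' e')) ((Pr ** e' ** Pr) ** e ** Pr')"
    by (simp only: rank_le_one_sandwich[OF e'] tr cscale_mult_left cscale_mult_right)
  also have "\<dots> = cscale (of_real (overlap Pr' e' * overlap Pr e')) (Pr ** e ** Pr')"
    by (simp only: rank_le_one_sandwich[OF rk(1)] tr cscale_mult_left cscale_mult_right cscale_cscale of_real_mult)
  finally have "cscale (of_real (overlap Pr' e' * overlap Pr e')) (Pr ** e ** Pr') = cscale Qt (Pr ** e' ** Pr')" by simp
  from cscale_eq_imp_divide[OF this, of Y] nz Qnz
  have "trace (Y ** (Pr ** e ** Pr')) / Qt = trace (Y ** (Pr ** e' ** Pr')) / of_real (overlap Pr' e' * overlap Pr e')" by simp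
  moreover have "trace (Pr ** e ** Pr' ** Y) = trace (Y ** (Pr ** e ** Pr'))"
    by (rule trace_mul_sym)
  ultimately have "Im (trace (Pr ** e ** Pr' ** Y) / Qt) = Im (trace (Y ** (Pr ** e' ** Pr'))) / (overlap Pr' e' * overlap Pr e')"
    by (simp only: Im_divide_of_real)
  moreover have "trace (Y ** (Pr ** e' ** Pr')) = cnj (trace (Pr' ** e' ** Pr ** Y))"
  proof -
    have "adj (Pr' ** e' ** Pr ** Y) = Y ** (Pr ** e' ** Pr')"
      using hm Y by (simp add: adj_mult hermitianD matrix_mul_assoc)
    then show ?thesis by (metis trace_adj)
  qed
  ultimately show "Im (trace (Pr ** e ** Pr' ** Y) / Qt) = - Im (trace (orbit_grad j j' A e' ** Y))"
    by (simp add: orbit_grad_def skew_part_pairing Y mat_distribs trace_simps)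
qed

end

text \<open>Slots up to \<open>i + 1\<close> enter through the partial sum. Slots
  \<open>i + 1\<close> and \<open>i + 2\<close> also occur as explicit factors of the trace, so slot
  \<open>i + 1\<close> receives two contributions.\<close>

lemma angle_lift_gradient:
  fixes x :: "('d::finite) config"
  defines "A \<equiv> \<lambda>i. partial_sum x i"
  assumes i: "i + 2 \<le> n" and x: "x \<in> angle_domain n i j j' q" and k: "k \<in> {1..n}"
    and r: "rank_le_one (x (i + 1))" "rank_le_one (x (i + 2))"
    and nz: "overlap (eigproj j (A i)) (x (i + 1)) \<noteq> 0" "overlap (eigproj j' (A i)) (x (i + 1)) \<noteq> 0"
      "overlap (eigproj j (A i)) (x (i + 2)) \<noteq> 0" "overlap (eigproj j' (A i)) (x (i + 2)) \<noteq> 0"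
  shows "gradient (angle_lift i j j' q) x k =
    (if k \<le> i + 1 then frame_grad j j' (A i) (x (i + 1)) - frame_grad j j' (A i) (x (i + 2)) else 0)
    + (if k = i + 1 then orbit_grad j j' (A i) (x (i + 1)) else 0)
    - (if k = i + 2 then orbit_grad j j' (A i) (x (i + 2)) else 0)" (is "_ = ?G + ?D - ?D'")
proof (rule gradient_eqI)
  have sk: "skew_hermitian (frame_grad j j' B y)" "skew_hermitian (orbit_grad j j' B y)" for B :: "complex^'d^'d" and y
    by (simp_all add: frame_grad_def orbit_grad_def skew_part_skew)
  show "skew_hermitian (?G + ?D - ?D')"
    using sk by (auto simp: skew_hermitian_def adj_simps)
next
  fix Y :: "complex ^ 'd ^ 'd" assume Y: "hermitian Y"
  have s: "simple_eig j (A i)" "simple_eig j' (A i)" using x by (auto simp: angle_domain_def A_def)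
  have Qnz: "angle_trace i j j' x \<noteq> 0" using angle_domain_nonzero[OF x] by simp
  define YA where "YA = (if k \<le> i + 1 then Y else 0)"
  define Y1 where "Y1 = (if k = i + 1 then Y else 0)"
  define Y2 where "Y2 = (if k = i + 2 then Y else 0)"
  have hY: "hermitian YA" "hermitian Y1" "hermitian Y2" using Y by (simp_all add: YA_def Y1_def Y2_def hermitian_closed)
  let ?P = "eigproj j (A i)" and ?P' = "eigproj j' (A i)" and ?S = "red_resolvent j (A i)" and ?S' = "red_resolvent j' (A i)"
  let ?e = "x (i + 1)" and ?e' = "x (i + 2)"
  have ps: "partial_sum (x(k := x k + t *\<^sub>R Y)) i = A i + t *\<^sub>R YA" for t
    using partial_sum_upd[OF k, of x "t *\<^sub>R Y" i] by (simp add: YA_def A_def)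
  have c1: "(x(k := x k + t *\<^sub>R Y)) (i + 1) = ?e + t *\<^sub>R Y1" "(x(k := x k + t *\<^sub>R Y)) (i + 2) = ?e' + t *\<^sub>R Y2" for t
    by (auto simp: Y1_def Y2_def)
  have d1: "((\<lambda>t. M + t *\<^sub>R Z) has_vector_derivative Z) (at 0)" for M Z :: "complex^'d^'d"
    by (auto intro!: derivative_eq_intros)
  let ?PY = "?S ** YA ** ?P + ?P ** YA ** ?S" and ?PY' = "?S' ** YA ** ?P' + ?P' ** YA ** ?S'"
  have "((\<lambda>t. angle_trace i j j' (x(k := x k + t *\<^sub>R Y))) has_vector_derivative
      trace (?P ** ?e ** ?P' ** Y2 + (?P ** ?e ** ?PY' + (?P ** Y1 + ?PY ** ?e) ** ?P') ** ?e')) (at 0)"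
    unfolding angle_trace_def ps c1
    using bounded_linear_vector_derivative[OF bounded_linear_trace
        matrix_mult_has_vector_derivative[OF matrix_mult_has_vector_derivative[OF matrix_mult_has_vector_derivative[OF
          simple_eig_derivatives(2)[OF s(1) hY(1)] d1[of ?e Y1]] simple_eig_derivatives(2)[OF s(2) hY(1)]] d1[of ?e' Y2]]]
    by simp
  from angle_lift_derivative[OF x this]
  have d: "((\<lambda>t. angle_lift i j j' q (x(k := x k + t *\<^sub>R Y))) has_real_derivative
      Im (trace (?P ** ?e ** ?P' ** Y2 + (?P ** ?e ** ?PY' + (?P ** Y1 + ?PY ** ?e) ** ?P') ** ?e') / angle_trace i j j' x)) (at 0)" .
  have "Im (trace (?P ** ?e ** ?P' ** Y2 + (?P ** ?e ** ?PY' + (?P ** Y1 + ?PY ** ?e) ** ?P') ** ?e') / angle_trace i j j' x)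
     = Im ((trace (?PY ** ?e ** ?P' ** ?e') + trace (?P ** ?e ** ?PY' ** ?e')) / angle_trace i j j' x)
       + Im (trace (?P ** Y1 ** ?P' ** ?e') / angle_trace i j j' x) + Im (trace (?P ** ?e ** ?P' ** Y2) / angle_trace i j j' x)"
    by (simp only: matrix_add_rdistrib trace_add add_divide_distrib plus_complex.sel)
  also have "\<dots> = Im (trace ((frame_grad j j' (A i) ?e - frame_grad j j' (A i) ?e') ** YA))
      + Im (trace (orbit_grad j j' (A i) ?e ** Y1)) - Im (trace (orbit_grad j j' (A i) ?e' ** Y2))"
    using angle_trace_frame_derivative[OF s r nz _ hY(1)] angle_trace_orbit_derivative(1)[OF s r nz _ hY(2)]
      angle_trace_orbit_derivative(2)[OF s r nz _ hY(3)] Qnz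
    by (simp add: angle_trace_def A_def)
  also have "\<dots> = Im (trace ((?G + ?D - ?D') ** Y))"
    by (auto simp: YA_def Y1_def Y2_def mat_distribs trace_simps)
  finally show "((\<lambda>t. angle_lift i j j' q (x(k := x k + t *\<^sub>R Y))) has_real_derivative Im (trace ((?G + ?D - ?D') ** Y))) (at 0)"
    using d by (simp only:)
qed

subsection \<open>Consequences of strict interlacing\<close>

lemma eigenvalue_in_eigvals:
  fixes B :: "complex ^ 'd ^ 'd"
  assumes h: "hermitian B" and u: "B *v u = v *\<^sub>R u" "u \<noteq> 0"
  shows "\<exists>a<CARD('d). eigvals B ! a = v"
proof (rule ccontr)
  assume no: "\<not> ?thesis"
  obtain f where f: "orthoframe f" "\<And>a. a < CARD('d) \<Longrightarrow> B *v f a = eigvals B ! a *\<^sub>R f a"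
    by (rule spectral_theorem[OF h]) blast
  have "hinner u (f a) = 0" if a: "a < CARD('d)" for a
  proof -
    have "hinner (B *v u) (f a) = hinner u (B *v f a)" by (rule hinner_hermitian[OF h])
    then have "of_real v * hinner u (f a) = of_real (eigvals B ! a) * hinner u (f a)"
      by (simp add: u(1) f(2)[OF a] hinner_simps)
    then show ?thesis using no a by auto
  qed
  then have "u = 0" using orthoframe_expand[OF f(1), of u] by simp
  then show False using u(2) by simp
qed

text \<open>Here \<open>b\<close> is the number of eigenvalues above \<open>v\<close>. The guards
  admit the gap above the largest eigenvalue and the one below the smallest.\<close>

lemma not_eigenvalue_between:
  fixes B :: "complex ^ 'd ^ 'd"
  assumes h: "hermitian B" and u: "B *v u = v *\<^sub>R u" "u \<noteq> 0"
    and lo: "b < CARD('d) \<Longrightarrow> eigvals B ! b < v" and hi: "b > 0 \<Longrightarrow> v < eigvals B ! (b - 1)" and b: "b \<le> CARD('d)"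
  shows False
proof -
  obtain a where a: "a < CARD('d)" "eigvals B ! a = v" using eigenvalue_in_eigvals[OF h u] by blast
  show False
  proof (cases "a < b")
    case True
    then have "eigvals B ! (b - 1) \<le> eigvals B ! a" using b by (intro eigvals_antimono[OF h]) auto
    then show False using hi True a(2) by simp
  next
    case False
    then have "eigvals B ! a \<le> eigvals B ! b" using a by (intro eigvals_antimono[OF h]) auto
    then show False using lo False a by simp
  qed
qed

lemma simple_eigI:
  fixes A :: "complex ^ 'd ^ 'd"
  assumes h: "hermitian A" and j: "j < CARD('d)"
    and hi: "j > 0 \<Longrightarrow> eigvals A ! j < eigvals A ! (j - 1)"
    and lo: "j + 1 < CARD('d) \<Longrightarrow> eigvals A ! (j + 1) < eigvals A ! j"
  shows "simple_eig j A"
proof -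
  have "eigvals A ! a \<noteq> eigvals A ! j" if a: "a < CARD('d)" "a \<noteq> j" for a
  proof (cases "a < j")
    case True
    then have "eigvals A ! (j - 1) \<le> eigvals A ! a" using j by (intro eigvals_antimono[OF h]) auto
    then show ?thesis using hi True by simp
  next
    case False
    then have "eigvals A ! a \<le> eigvals A ! (j + 1)" using a by (intro eigvals_antimono[OF h]) auto
    moreover have "j + 1 < CARD('d)" using False a by simp
    ultimately show ?thesis using lo by simp
  qed
  then show ?thesis using h j by (simp add: simple_eig_def)
qed

lemma eigvals_mono_rank_one:
  fixes A :: "complex ^ 'd ^ 'd"
  assumes h: "hermitian A" and j: "j < CARD('d)" and "\<rho> \<ge> 0"
  shows "eigvals A ! j \<le> eigvals (A + \<rho> *\<^sub>R rank_one w) ! j"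
proof -
  have "eigvals A ! j \<le> eigvals (A + \<rho> *\<^sub>R rank_one w) ! j + 0"
  proof (rule eigvals_compare[OF h _ j])
    show "hermitian (A + \<rho> *\<^sub>R rank_one w)" by (intro hermitian_closed h)
    fix x :: "complex ^ 'd"
    have "hinner (rank_one w *v x) x = of_real ((cmod (hinner x w))\<^sup>2)"
    proof -
      have "hinner (rank_one w *v x) x = hinner x w * cnj (hinner x w)"
        by (simp add: rank_one_mult hinner_scale hinner_cnj)
      then show ?thesis by (simp only: complex_norm_square)
    qed
    then show "Re (hinner (A *v x) x) \<le> Re (hinner ((A + \<rho> *\<^sub>R rank_one w) *v x) x) + 0"
      using assms(3) by (simp add: matrix_vector_mult_add_rdistrib scaleR_matrix_vector hinner_simps)
  qed
  then show ?thesis by simp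
qed

lemma overlap_scaled_rank_one:
  "overlap (eigproj a A) (\<rho> *\<^sub>R rank_one w) = \<rho> * (cmod (hinner w (eigvec a A)))\<^sup>2"
proof -
  have "trace (eigproj a A ** rank_one w) = hinner w (eigvec a A) * cnj (hinner w (eigvec a A))"
    by (simp add: trace_rank_one eigproj_def rank_one_mult hinner_scale hinner_cnj)
  then have "trace (eigproj a A ** rank_one w) = of_real ((cmod (hinner w (eigvec a A)))\<^sup>2)"
    by (simp only: complex_norm_square)
  then show ?thesis by (simp add: overlap_def mat_distribs trace_simps)
qed

lemma partial_sum_Suc: "partial_sum x (Suc i) = partial_sum x i + x (i + 2)"
  by (simp add: partial_sum_def)

lemma N_tilde_rank_one:
  assumes "x \<in> N_tilde n r" "s \<in> {1..n}"
  obtains w where "norm w = 1" "x s = r s *\<^sub>R rank_one w"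
proof -
  have "x s \<in> coadj_orbit (r s)" using assms unfolding N_tilde_def by (rule PiE_mem)
  then show thesis unfolding coadj_orbit_def using that by blast
qed

lemma N_tilde_subset_Herm: "N_tilde n r \<subseteq> (Herm_n n :: ('d::finite) config set)"
proof -
  have "coadj_orbit \<rho> \<subseteq> {B :: complex ^ 'd ^ 'd. hermitian B}" for \<rho>
    unfolding coadj_orbit_def using hermitian_closed(3,7) by blast
  then show ?thesis unfolding N_tilde_def Herm_n_def by (intro PiE_mono)
qed

lemma scaleR_smult: "c *\<^sub>R (z *s v) = (of_real c * z) *s (v :: complex ^ 'n)"
  by (simp add: vec_eq_iff) (simp add: scaleR_conv_of_real)

text \<open>Fixes one configuration with strict interlacing, so that the consequences can be stated
  at it and later be reused at every representative of an orbit.\<close>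

locale interlacing =
  fixes m n :: nat and r :: "nat \<Rightarrow> real" and x :: "('d::finite) config"
  assumes card_d: "CARD('d) = m + 1" and nm: "m + 2 \<le> n" and rpos: "\<And>s. s \<in> {1..n} \<Longrightarrow> 0 < r s"
    and xM: "x \<in> M_tilde0 m n r"
begin

abbreviation "A i \<equiv> partial_sum x i"
abbreviation "\<Lambda> i j \<equiv> lam m x i j"

lemma x_N: "x \<in> N_tilde n r" and x_M: "x \<in> M_tilde m n r"
  using xM by (auto simp: M_tilde0_def M_tilde_def)

lemma x_H: "x \<in> Herm_n n"
  using x_N N_tilde_subset_Herm by blast

lemma A_hermitian: "i < n \<Longrightarrow> hermitian (A i)"
  by (rule partial_sum_hermitian[OF x_H]) simp

lemma lam_eigvals: "j \<le> m + 1 \<Longrightarrow> \<Lambda> i j = eigvals (A i) ! (j - 1)"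
  by (simp add: lam_def)

lemma lam_mono: "i + 1 < n \<Longrightarrow> 1 \<le> j \<Longrightarrow> \<Lambda> i j \<le> \<Lambda> (i + 1) j"
proof (cases "j \<le> m + 1")
  case True
  assume a: "i + 1 < n" "1 \<le> j"
  then obtain w where w: "norm w = 1" "x (i + 2) = r (i + 2) *\<^sub>R rank_one w"
    using N_tilde_rank_one[OF x_N, of "i + 2"] by auto
  have "0 \<le> r (i + 2)" using rpos[of "i + 2"] a by simp
  then show ?thesis
    using True a w eigvals_mono_rank_one[of "A i" "j - 1" "r (i + 2)" w]
    by (simp add: lam_eigvals partial_sum_Suc A_hermitian card_d)
qed (simp add: lam_def)

lemma quadratic_form:
  assumes i: "i < n" and w: "\<And>s. s \<in> {1..n} \<Longrightarrow> x s = r s *\<^sub>R rank_one (w s)"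
  shows "A i *v v = (\<Sum>s=1..i+1. (of_real (r s) * hinner v (w s)) *s w s)"
  unfolding partial_sum_def matrix_vector_mult_sum_l
proof (intro sum.cong refl)
  fix s assume "s \<in> {1..i+1}"
  then have "x s = r s *\<^sub>R rank_one (w s)" using i by (intro w) simp
  then show "x s *v v = (of_real (r s) * hinner v (w s)) *s w s"
    by (simp only: scaleR_matrix_vector rank_one_mult scaleR_smult)
qed

lemma rank_one_choice: "\<exists>w. \<forall>s\<in>{1..n}. norm (w s) = 1 \<and> x s = r s *\<^sub>R rank_one (w s)"
proof -
  have "\<forall>s\<in>{1..n}. \<exists>w. norm w = 1 \<and> x s = r s *\<^sub>R rank_one w"
    using N_tilde_rank_one[OF x_N] by metis
  then show ?thesis by metis
qed

lemma lam_nonneg: "i < n \<Longrightarrow> 0 \<le> \<Lambda> i j"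
proof (cases "j \<le> m + 1")
  case True
  assume i: "i < n"
  have "eigvals (A i) ! k \<ge> 0" if k: "k < CARD('d)" for k
  proof -
    obtain w where w: "\<And>s. s \<in> {1..n} \<Longrightarrow> x s = r s *\<^sub>R rank_one (w s)" using rank_one_choice by blast
    let ?u = "eigvec k (A i)"
    note u = eigvec[OF A_hermitian[OF i] k]
    have "of_real (eigvals (A i) ! k) = hinner (A i *v ?u) ?u"
      by (simp add: u hinner_simps hinner_self)
    also have "\<dots> = (\<Sum>s=1..i+1. of_real (r s) * (hinner ?u (w s) * cnj (hinner ?u (w s))))"
      by (subst quadratic_form[OF i w]) (simp_all only: hinner_sum hinner_scale hinner_cnj mult_ac)
    also have "\<dots> = of_real (\<Sum>s=1..i+1. r s * (cmod (hinner ?u (w s)))\<^sup>2)"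
      by (simp flip: complex_norm_square)
    finally have "eigvals (A i) ! k = (\<Sum>s=1..i+1. r s * (cmod (hinner ?u (w s)))\<^sup>2)"
      using of_real_eq_iff by blast
    also have "\<dots> \<ge> 0"
      using i rpos by (intro sum_nonneg mult_nonneg_nonneg) (auto intro: less_imp_le)
    finally show ?thesis .
  qed
  then show ?thesis using True card_d by (simp add: lam_eigvals)
qed (simp add: lam_def)

text \<open>\<open>A i\<close> is a sum of \<open>i + 1\<close> matrices of rank one. If its
  eigenvalue number \<open>j\<close> were positive, a unit vector orthogonal to all the
  \<open>w s\<close> involved and to the eigenvectors after number \<open>j\<close> would give the
  form both the value 0 and a positive value.\<close>

lemma lam_rank: "i < n \<Longrightarrow> i + 2 \<le> j \<Longrightarrow> \<Lambda> i j = 0"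
proof (rule ccontr)
  assume i: "i < n" and j: "i + 2 \<le> j" and "\<Lambda> i j \<noteq> 0"
  then have pos: "0 < \<Lambda> i j" and jm: "j \<le> m + 1" using lam_nonneg[OF i, of j] by (auto simp: lam_def split: if_splits)
  obtain w where w: "\<And>s. s \<in> {1..n} \<Longrightarrow> x s = r s *\<^sub>R rank_one (w s)" using rank_one_choice by blast
  obtain f where f: "orthoframe f" "\<And>a. a < CARD('d) \<Longrightarrow> A i *v f a = eigvals (A i) ! a *\<^sub>R f a"
    by (rule spectral_theorem[OF A_hermitian[OF i]]) blast
  let ?V = "w ` {1..i+1} \<union> f ` {j..<CARD('d)}"
  have "card ?V \<le> card (w ` {1..i+1}) + card (f ` {j..<CARD('d)})" by (rule card_Un_le)
  also have "\<dots> \<le> (i + 1) + (CARD('d) - j)"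
    by (intro add_mono) (metis card_image_le card_atLeastAtMost finite_atLeastAtMost diff_Suc_1 Suc_eq_plus1, metis card_image_le card_atLeastLessThan finite_atLeastLessThan)
  also have "\<dots> < CARD('d)" using j jm card_d by simp
  finally obtain v where v: "norm v = 1" "\<forall>y\<in>?V. hinner v y = 0"
    using exists_unit_orthogonal[of ?V] by auto
  have z: "hinner v (w s) = 0" if "s \<in> {1..i+1}" for s using v(2) that by auto
  have "A i *v v = 0"
    by (subst quadratic_form[OF i w], assumption, intro sum.neutral) (use z in auto)
  then have "0 = Re (hinner (A i *v v) v)" by simp
  also have "\<dots> = (\<Sum>a<CARD('d). eigvals (A i) ! a * (cmod (hinner v (f a)))\<^sup>2)"
    by (simp add: frame_quadratic_form[OF f])
  also have "\<dots> \<ge> (\<Sum>a<CARD('d). \<Lambda> i j * (cmod (hinner v (f a)))\<^sup>2)"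
  proof (rule sum_mono)
    fix a assume a: "a \<in> {..<CARD('d)}"
    show "\<Lambda> i j * (cmod (hinner v (f a)))\<^sup>2 \<le> eigvals (A i) ! a * (cmod (hinner v (f a)))\<^sup>2"
    proof (cases "a < j")
      case True
      have "eigvals (A i) ! (j - 1) \<le> eigvals (A i) ! a"
        using True jm card_d by (intro eigvals_antimono[OF A_hermitian[OF i]]) auto
      then show ?thesis using jm by (simp add: lam_eigvals mult_right_mono)
    next
      case False
      then show ?thesis using v(2) a by simp
    qed
  qed
  also have "(\<Sum>a<CARD('d). \<Lambda> i j * (cmod (hinner v (f a)))\<^sup>2) = \<Lambda> i j"
    using orthoframe_norm_expand[OF f(1), of v] v(1) by (simp flip: sum_distrib_left)
  finally show False using pos by simp
qed

text \<open>The negations of \<open>forced_Lam\<close> and \<open>forced_0\<close>, rearranged so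
  that no subtraction occurs.\<close>

definition unforced :: "nat \<Rightarrow> nat \<Rightarrow> bool" where
  "unforced i j \<longleftrightarrow> m + 2 + i < n + j \<and> j \<le> m + 1"

lemma unforced_not_both: "unforced i j \<or> unforced i' j' \<Longrightarrow> \<not> both_forced m n i j i' j'"
  by (auto simp: unforced_def both_forced_def forced_0_def forced_Lam_def)

lemma interlace: "\<forall>i\<in>{1..n-1}. \<forall>j\<in>{1..i}.
     (\<not> both_forced m n i j (i - 1) j \<longrightarrow> \<Lambda> i j > \<Lambda> (i - 1) j) \<and>
     (\<not> both_forced m n (i - 1) j i (j + 1) \<longrightarrow> \<Lambda> (i - 1) j > \<Lambda> i (j + 1))"
  using xM unfolding M_tilde0_def by blast

lemma strict_up: "1 \<le> j \<Longrightarrow> j \<le> i + 1 \<Longrightarrow> i + 1 < n \<Longrightarrow> unforced (i + 1) j \<or> unforced i j \<Longrightarrow> \<Lambda> i j < \<Lambda> (i + 1) j"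
proof -
  assume a: "1 \<le> j" "j \<le> i + 1" "i + 1 < n" "unforced (i + 1) j \<or> unforced i j"
  then have "i + 1 \<in> {1..n-1}" "j \<in> {1..i+1}" by auto
  from bspec[OF bspec[OF interlace this(1)] this(2)] show ?thesis using unforced_not_both[OF a(4)] by simp
qed

lemma strict_down: "1 \<le> j \<Longrightarrow> j \<le> i + 1 \<Longrightarrow> i + 1 < n \<Longrightarrow> unforced i j \<or> unforced (i + 1) (j + 1) \<Longrightarrow> \<Lambda> (i + 1) (j + 1) < \<Lambda> i j"
proof -
  assume a: "1 \<le> j" "j \<le> i + 1" "i + 1 < n" "unforced i j \<or> unforced (i + 1) (j + 1)"
  then have "i + 1 \<in> {1..n-1}" "j \<in> {1..i+1}" by auto
  from bspec[OF bspec[OF interlace this(1)] this(2)] show ?thesis using unforced_not_both[OF a(4)] by simp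
qed

text \<open>If the overlap vanishes, the added summand kills the eigenvector, so the two consecutive
  partial sums would share an eigenvalue. Strict interlacing is what excludes this.\<close>

lemma eigenvector_of_neighbour:
  assumes i: "i + 1 < n" and a: "a < CARD('d)"
  shows "overlap (eigproj a (A i)) (x (i + 2)) = 0 \<Longrightarrow> A (i + 1) *v eigvec a (A i) = eigvals (A i) ! a *\<^sub>R eigvec a (A i)"
    and "overlap (eigproj a (A (i + 1))) (x (i + 2)) = 0 \<Longrightarrow> A i *v eigvec a (A (i + 1)) = eigvals (A (i + 1)) ! a *\<^sub>R eigvec a (A (i + 1))"
proof -
  obtain w where w: "norm w = 1" "x (i + 2) = r (i + 2) *\<^sub>R rank_one w"
    using N_tilde_rank_one[OF x_N, of "i + 2"] i by auto
  have r: "0 < r (i + 2)" using rpos[of "i + 2"] i by simp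
  have z: "x (i + 2) *v eigvec a B = 0" if "overlap (eigproj a B) (x (i + 2)) = 0" for B
  proof -
    have "hinner w (eigvec a B) = 0" using that r unfolding w(2) overlap_scaled_rank_one by simp
    then have "hinner (eigvec a B) w = 0" by (metis hinner_cnj complex_cnj_zero)
    then show ?thesis unfolding w(2) by (simp add: scaleR_matrix_vector rank_one_mult)
  qed
  have h: "hermitian (A i)" "hermitian (A (i + 1))" using i by (auto intro: A_hermitian)
  show "A (i + 1) *v eigvec a (A i) = eigvals (A i) ! a *\<^sub>R eigvec a (A i)" if "overlap (eigproj a (A i)) (x (i + 2)) = 0"
    using z[OF that] eigvec[OF h(1) a] by (simp add: partial_sum_Suc matrix_vector_mult_add_rdistrib)
  show "A i *v eigvec a (A (i + 1)) = eigvals (A (i + 1)) ! a *\<^sub>R eigvec a (A (i + 1))" if "overlap (eigproj a (A (i + 1))) (x (i + 2)) = 0"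
  proof -
    have "A (i + 1) *v eigvec a (A (i + 1)) = A i *v eigvec a (A (i + 1))"
      using z[OF that] by (simp add: partial_sum_Suc matrix_vector_mult_add_rdistrib)
    then show ?thesis using eigvec[OF h(2) a] by simp
  qed
qed

text \<open>In both lemmas below, \<open>\<Lambda> i (b + 1)\<close> is the eigenvalue with index \<open>b\<close> counted from 0.\<close>

lemma overlap_next_nonzero:
  assumes i: "i + 1 < n" and b: "b < CARD('d)"
    and lo: "b + 1 < CARD('d) \<Longrightarrow> \<Lambda> (i + 1) (b + 2) < \<Lambda> i (b + 1)" and hi: "\<Lambda> i (b + 1) < \<Lambda> (i + 1) (b + 1)"
  shows "overlap (eigproj b (A i)) (x (i + 2)) \<noteq> 0"
proof
  assume z: "overlap (eigproj b (A i)) (x (i + 2)) = 0"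
  have h: "hermitian (A i)" "hermitian (A (i + 1))" using i by (auto intro: A_hermitian)
  show False
  proof (rule not_eigenvalue_between[OF h(2) eigenvector_of_neighbour(1)[OF i b z], of "b + 1"])
    show "eigvec b (A i) \<noteq> 0" using eigvec(1)[OF h(1) b] by auto
    show "eigvals (A (i + 1)) ! (b + 1) < eigvals (A i) ! b" if "b + 1 < CARD('d)"
      using lo[OF that] that b card_d by (simp add: lam_def)
    show "eigvals (A i) ! b < eigvals (A (i + 1)) ! (b + 1 - 1)"
      using hi b card_d by (simp add: lam_def)
  qed (use b in simp)
qed

lemma overlap_previous_nonzero:
  assumes i: "i + 1 < n" and b: "b < CARD('d)"
    and lo: "\<Lambda> i (b + 1) < \<Lambda> (i + 1) (b + 1)" and hi: "b > 0 \<Longrightarrow> \<Lambda> (i + 1) (b + 1) < \<Lambda> i b"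
  shows "overlap (eigproj b (A (i + 1))) (x (i + 2)) \<noteq> 0"
proof
  assume z: "overlap (eigproj b (A (i + 1))) (x (i + 2)) = 0"
  have h: "hermitian (A i)" "hermitian (A (i + 1))" using i by (auto intro: A_hermitian)
  show False
  proof (rule not_eigenvalue_between[OF h(1) eigenvector_of_neighbour(2)[OF i b z], of b])
    show "eigvec b (A (i + 1)) \<noteq> 0" using eigvec(1)[OF h(2) b] by auto
    show "eigvals (A i) ! b < eigvals (A (i + 1)) ! b"
      using lo b card_d by (simp add: lam_def)
    show "eigvals (A (i + 1)) ! b < eigvals (A i) ! (b - 1)" if "b > 0"
      using hi[OF that] b card_d that by (simp add: lam_def)
  qed (use b in simp)
qed

text \<open>Both eigenvalues of the angle lie strictly between entries of the two neighbouring rows.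
  Squeezing between two entries of one row gives simplicity, and separation from a neighbouring row
  gives the nonzero overlaps.\<close>

lemma angle_nondegenerate:
  assumes ij: "(i, j) \<in> angle_index m n"
  shows "simple_eig (j - 1) (A i)" "simple_eig j (A i)"
    "overlap (eigproj (j - 1) (A i)) (x (i + 1)) \<noteq> 0" "overlap (eigproj j (A i)) (x (i + 1)) \<noteq> 0"
    "overlap (eigproj (j - 1) (A i)) (x (i + 2)) \<noteq> 0" "overlap (eigproj j (A i)) (x (i + 2)) \<noteq> 0"
proof -
  have I: "1 \<le> i" "i + 3 \<le> n" "1 \<le> j" "m + 3 + i \<le> n + j" "j \<le> i" "j \<le> m"
    using ij by (auto simp: angle_index_def)
  obtain i0 where i0: "i = i0 + 1" using I(1) by (metis add.commute le_Suc_ex plus_1_eq_Suc)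
  obtain j0 where j0: "j = j0 + 1" using I(3) by (metis add.commute le_Suc_ex plus_1_eq_Suc)
  have unf: "unforced i j" "unforced i (j + 1)" using I by (auto simp: unforced_def)
  have U1: "\<Lambda> i0 j < \<Lambda> i j" using strict_up[of j i0] unf I i0 by auto
  have U2: "\<Lambda> i (j + 1) < \<Lambda> i0 j" using strict_down[of j i0] unf I i0 by auto
  have U3: "\<Lambda> i j < \<Lambda> i0 j0" if "j0 \<ge> 1" using strict_down[of j0 i0] unf I i0 j0 that by auto
  have U4: "\<Lambda> (i + 1) (j + 2) < \<Lambda> i (j + 1)" using strict_down[of "j + 1" i] unf I by auto
  have U5: "\<Lambda> (i + 1) (j + 1) < \<Lambda> i j" using strict_down[of j i] unf I by auto
  have U6: "\<Lambda> i j < \<Lambda> (i + 1) j" using strict_up[of j i] unf I by auto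
  have U7: "\<Lambda> i (j + 1) < \<Lambda> (i + 1) (j + 1)" using strict_up[of "j + 1" i] unf I by auto
  \<comment> \<open>For \<open>j = i\<close> the previous row has no entry \<open>j + 1\<close>
    constrained by interlacing. The rank bound makes it 0, and \<open>U4\<close> with nonnegativity
    makes the entry in row \<open>i\<close> positive.\<close>
  have U8: "\<Lambda> i0 (j + 1) < \<Lambda> i (j + 1)"
  proof (cases "j + 1 \<le> i")
    case True
    then show ?thesis using strict_up[of "j + 1" i0] unf I i0 by auto
  next
    case False
    then have "\<Lambda> i0 (j + 1) = 0" using I i0 by (intro lam_rank) auto
    then show ?thesis using U4 lam_nonneg[of "i + 1" "j + 2"] I by simp
  qed
  have h: "hermitian (A i)" using I by (intro A_hermitian) simp
  show "simple_eig (j - 1) (A i)"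
  proof (rule simple_eigI[OF h])
    show "eigvals (A i) ! (j - 1) < eigvals (A i) ! (j - 1 - 1)" if "0 < j - 1"
      using U3 lam_mono[of i0 j0] I that i0 j0 by (simp add: lam_def)
    show "eigvals (A i) ! (j - 1 + 1) < eigvals (A i) ! (j - 1)"
      using U1 U2 I by (simp add: lam_def)
  qed (use I card_d in simp)
  show "simple_eig j (A i)"
  proof (rule simple_eigI[OF h])
    show "eigvals (A i) ! j < eigvals (A i) ! (j - 1)"
      using U1 U2 I by (simp add: lam_def)
    show "eigvals (A i) ! (j + 1) < eigvals (A i) ! j" if "j + 1 < CARD('d)"
      using U4 lam_mono[of i "j + 2"] I that card_d by (simp add: lam_def)
  qed (use I card_d in simp)
  show "overlap (eigproj (j - 1) (A i)) (x (i + 1)) \<noteq> 0"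
    using overlap_previous_nonzero[of i0 j0] U1 U3 I i0 j0 card_d by simp
  show "overlap (eigproj j (A i)) (x (i + 1)) \<noteq> 0"
    using overlap_previous_nonzero[of i0 j] U8 U2 I i0 card_d by simp
  show "overlap (eigproj (j - 1) (A i)) (x (i + 2)) \<noteq> 0"
    using overlap_next_nonzero[of i j0] U6 U5 I j0 card_d by simp
  show "overlap (eigproj j (A i)) (x (i + 2)) \<noteq> 0"
    using overlap_next_nonzero[of i j] U7 U4 I card_d by simp
qed

text \<open>Commutation makes every \<open>w s\<close> an eigenvector of \<open>Y\<close>. Each new
  vector has nonzero overlap with an eigenvector of the preceding partial sum at a positive
  eigenvalue, so its eigenvalue agrees with the earlier ones. After \<open>m + 1\<close> steps the
  partial sum is positive definite and the vectors span the space.\<close>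

lemma irreducible:
  assumes Y: "hermitian Y" and comm: "\<And>s. s \<in> {1..n} \<Longrightarrow> commutator Y (x s) = 0"
  shows "\<exists>y. Y = y *\<^sub>R mat 1"
proof -
  obtain w where w: "\<And>s. s \<in> {1..n} \<Longrightarrow> norm (w s) = 1" "\<And>s. s \<in> {1..n} \<Longrightarrow> x s = r s *\<^sub>R rank_one (w s)"
    using rank_one_choice by blast
  define y where "y s = Re (hinner (Y *v w s) (w s))" for s
  have Yw: "Y *v w s = y s *\<^sub>R w s" if s: "s \<in> {1..n}" for s
  proof -
    have "r s *\<^sub>R (Y ** rank_one (w s) - rank_one (w s) ** Y) = 0"
      using comm[OF s] by (simp add: w(2)[OF s] commutator_def mat_distribs scaleR_diff_right)
    then have "Y ** rank_one (w s) = rank_one (w s) ** Y" using rpos[OF s] by simp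
    then have "(Y ** rank_one (w s)) *v w s = (rank_one (w s) ** Y) *v w s" by simp
    then have e: "Y *v w s = hinner (Y *v w s) (w s) *s w s"
      by (simp add: rank_one_mult matrix_vector_mult_smult hinner_self w(1)[OF s] flip: matrix_vector_mul_assoc)
    have "cnj (hinner (Y *v w s) (w s)) = hinner (Y *v w s) (w s)"
      by (simp add: hinner_cnj hinner_hermitian Y)
    then have "hinner (Y *v w s) (w s) = of_real (y s)" by (simp add: y_def complex_eq_iff)
    with e have "Y *v w s = of_real (y s) *s w s" by simp
    then show ?thesis by (simp add: vec_eq_iff) (simp add: scaleR_conv_of_real)
  qed
  \<comment> \<open>An eigenvector of \<open>A i\<close> at a nonzero eigenvalue lies in the span of
    the first \<open>i + 1\<close> vectors \<open>w s\<close>, on which \<open>Y\<close> is the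
    scalar \<open>c\<close>.\<close>
  have span: "Y *v v = c *\<^sub>R v" if v: "A i *v v = \<mu> *\<^sub>R v" "\<mu> \<noteq> 0" and i: "i < n" and eq: "\<And>s. s \<in> {1..i+1} \<Longrightarrow> y s = c" for i v \<mu> c
  proof -
    have "Y *v (A i *v v) = (\<Sum>s=1..i+1. c *\<^sub>R ((of_real (r s) * hinner v (w s)) *s w s))"
    proof (subst quadratic_form[OF i w(2)], assumption, subst matrix_vector_mult_sum_r, intro sum.cong refl)
      fix s assume s: "s \<in> {1..i+1}"
      then have "s \<in> {1..n}" using i by simp
      then show "Y *v ((of_real (r s) * hinner v (w s)) *s w s) = c *\<^sub>R ((of_real (r s) * hinner v (w s)) *s w s)"
        by (simp add: matrix_vector_mult_smult Yw eq[OF s] vec_eq_iff)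
    qed
    also have "\<dots> = c *\<^sub>R (A i *v v)" by (subst quadratic_form[OF i w(2)]) (simp_all only: scaleR_right.sum)
    finally have "\<mu> *\<^sub>R (Y *v v) = \<mu> *\<^sub>R (c *\<^sub>R v)" by (simp add: v(1) matrix_vector_mult_scaleR_r)
    then show ?thesis using v(2) by (simp only: scaleR_cancel_left) simp
  qed
  have "\<forall>s\<in>{1..k+1}. y s = y 1" if "k \<le> m" for k
    using that
  proof (induction k)
    case (Suc k)
    have IH: "\<And>s. s \<in> {1..k+1} \<Longrightarrow> y s = y 1"
      using Suc.IH Suc_leD[OF Suc.prems] by blast
    have kn: "k + 1 < n" "k < n" "k < CARD('d)" using Suc.prems nm card_d by auto
    have unf: "unforced k (k + 1)" using Suc.prems nm by (simp add: unforced_def)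
    have up: "\<Lambda> k (k + 1) < \<Lambda> (k + 1) (k + 1)" by (rule strict_up) (use kn unf in auto)
    have down: "\<Lambda> (k + 1) (k + 2) < \<Lambda> k (k + 1)" using strict_down[of "k + 1" k] kn unf by auto
    have h: "hermitian (A k)" using kn by (intro A_hermitian)
    let ?v = "eigvec k (A k)"
    have "0 < \<Lambda> k (k + 1)" using down lam_nonneg[of "k + 1" "k + 2"] kn by simp
    then have "eigvals (A k) ! k \<noteq> 0" using Suc.prems by (simp add: lam_def)
    then have Yv: "Y *v ?v = y 1 *\<^sub>R ?v" by (rule span[OF eigvec(2)[OF h kn(3)]]) (use kn in simp, rule IH)
    have k2: "k + 2 \<in> {1..n}" using kn by simp
    have "y (k + 2) = y 1"
    proof (rule ccontr)
      assume ne: "y (k + 2) \<noteq> y 1"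
      have "hinner (Y *v ?v) (w (k + 2)) = hinner ?v (Y *v w (k + 2))" by (rule hinner_hermitian[OF Y])
      then have "of_real (y 1) * hinner ?v (w (k + 2)) = of_real (y (k + 2)) * hinner ?v (w (k + 2))"
        unfolding Yv Yw[OF k2] hinner_scaleR .
      then have "hinner ?v (w (k + 2)) = 0" using ne by auto
      then have "hinner (w (k + 2)) ?v = 0" by (metis hinner_cnj complex_cnj_zero)
      then have "overlap (eigproj k (A k)) (x (k + 2)) = 0"
        unfolding w(2)[OF k2] overlap_scaled_rank_one by simp
      then show False
        using overlap_next_nonzero[of k k] kn up down by auto
    qed
    moreover have "s = k + 2 \<or> s \<in> {1..k+1}" if "s \<in> {1..Suc k + 1}" for s using that by auto
    ultimately show ?case using IH by blast
  qed simp
  then have all: "\<And>s. s \<in> {1..m+1} \<Longrightarrow> y s = y 1" by blast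
  have mn: "m < n" "m + 1 < n" using nm by auto
  have "unforced m (m + 1)" using nm by (simp add: unforced_def)
  \<comment> \<open>The left entry has index beyond the dimension and is 0 by the convention in
    \<open>lam\<close>, so this inequality says that the smallest eigenvalue of \<open>A m\<close>
    is positive.\<close>
  then have "\<Lambda> (m + 1) (m + 2) < \<Lambda> m (m + 1)" using strict_down[of "m + 1" m] mn by auto
  then have pos: "0 < \<Lambda> m (m + 1)" by (simp add: lam_def)
  obtain f where f: "orthoframe f" "\<And>a. a < CARD('d) \<Longrightarrow> A m *v f a = eigvals (A m) ! a *\<^sub>R f a"
    by (rule spectral_theorem[OF A_hermitian[OF mn(1)]]) blast
  have "Y = y 1 *\<^sub>R mat 1"
  proof (rule matrix_eqI_frame[OF f(1)])
    fix a assume a: "a < CARD('d)"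
    have "eigvals (A m) ! m \<le> eigvals (A m) ! a"
      using a card_d by (intro eigvals_antimono[OF A_hermitian[OF mn(1)]]) auto
    then have "eigvals (A m) ! a \<noteq> 0" using pos by (simp add: lam_def)
    then have "Y *v f a = y 1 *\<^sub>R f a"
      by (rule span[OF f(2)[OF a]]) (use mn in simp, rule all)
    then show "Y *v f a = (y 1 *\<^sub>R mat 1) *v f a" by (simp add: scaleR_matrix_vector)
  qed
  then show ?thesis by blast
qed

end

subsection \<open>Curves in the product of orbits\<close>

text \<open>Each line is moved by the identity plus \<open>L\<close> and renormalised to its orbit.
  For skew-Hermitian \<open>L\<close> this agrees to first order with the unitary action and needs
  no matrix exponential. The parameter \<open>y\<close> may range over a space of any
  dimension.\<close>

definition orbit_curve :: "nat \<Rightarrow> (nat \<Rightarrow> real) \<Rightarrow> (nat \<Rightarrow> complex ^ 'd) \<Rightarrow> ('a \<Rightarrow> nat \<Rightarrow> complex ^ 'd ^ 'd) \<Rightarrow> 'a \<Rightarrow> ('d::finite) config" where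
  "orbit_curve n r w L y = (\<lambda>s\<in>{1..n}. (r s / (norm ((mat 1 + L y s) *v w s))\<^sup>2) *\<^sub>R rank_one ((mat 1 + L y s) *v w s))"

lemma orbit_curve_in_N_tilde:
  assumes "\<And>s. s \<in> {1..n} \<Longrightarrow> (mat 1 + L y s) *v w s \<noteq> 0"
  shows "orbit_curve n r w L y \<in> N_tilde n r"
proof -
  have "(\<rho> / (norm v)\<^sup>2) *\<^sub>R rank_one v \<in> coadj_orbit \<rho>" if "v \<noteq> 0" for v :: "complex ^ 'd" and \<rho>
  proof -
    have "rank_one ((1 / norm v) *\<^sub>R v) = (1 / (norm v)\<^sup>2) *\<^sub>R rank_one v"
      by (simp add: vec_eq_iff power2_eq_square)
    then have "(\<rho> / (norm v)\<^sup>2) *\<^sub>R rank_one v = \<rho> *\<^sub>R rank_one ((1 / norm v) *\<^sub>R v)" by simp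
    moreover have "norm ((1 / norm v) *\<^sub>R v) = 1" using that by simp
    ultimately show ?thesis unfolding coadj_orbit_def by blast
  qed
  then show ?thesis
    unfolding orbit_curve_def N_tilde_def using assms by (intro restrict_PiE_iff[THEN iffD2]) blast
qed

lemma orbit_curve_0:
  assumes w: "\<And>s. s \<in> {1..n} \<Longrightarrow> norm (w s) = 1 \<and> x s = r s *\<^sub>R rank_one (w s)" and x: "x \<in> N_tilde n r"
    and L: "\<And>s. L y s = 0"
  shows "orbit_curve n r w L y = x"
proof
  fix s
  show "orbit_curve n r w L y s = x s"
  proof (cases "s \<in> {1..n}")
    case True
    then show ?thesis using w[OF True] L by (simp add: orbit_curve_def)
  next
    case False
    then have "x s = undefined" using x unfolding N_tilde_def by (intro PiE_arb[of x])
    then show ?thesis unfolding orbit_curve_def restrict_def using False by (simp only: if_False)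
  qed
qed

lemma bounded_linear_matrix_vector_left: "bounded_linear (\<lambda>M :: complex^'d^'d. M *v v)"
  by (subst linear_conv_bounded_linear[symmetric])
    (auto simp: matrix_vector_mult_add_rdistrib scaleR_matrix_vector intro!: linearI)

lemma continuous_on_rank_one: "continuous_on S f \<Longrightarrow> continuous_on S (\<lambda>x. rank_one (f x :: complex ^ 'd))"
  unfolding rank_one_def
  by (intro continuous_on_vec_lambda continuous_on_mult continuous_on_cnj continuous_on_component)

lemma orbit_curve_continuous:
  fixes L :: "'a::real_normed_vector \<Rightarrow> nat \<Rightarrow> complex ^ 'd ^ 'd"
  assumes L: "\<And>s. bounded_linear (\<lambda>y. L y s)"
    and nz: "\<And>s y. s \<in> {1..n} \<Longrightarrow> y \<in> S \<Longrightarrow> (mat 1 + L y s) *v w s \<noteq> 0"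
  shows "continuous_on S (orbit_curve n r w L :: 'a \<Rightarrow> ('d::finite) config)"
proof (rule continuous_on_coordinatewise_then_product)
  fix s
  have c: "continuous_on S (\<lambda>y. (mat 1 + L y s) *v w s)"
    by (intro bounded_linear.continuous_on[OF bounded_linear_matrix_vector_left] continuous_intros bounded_linear.continuous_on[OF L])
  show "continuous_on S (\<lambda>y. orbit_curve n r w L y s)"
  proof (cases "s \<in> {1..n}")
    case True
    then show ?thesis
      unfolding orbit_curve_def restrict_def
      using nz by (auto intro!: continuous_intros continuous_on_rank_one c)
  next
    case False
    then show ?thesis
      unfolding orbit_curve_def restrict_def by (simp only: if_False continuous_on_const)
  qed
qed

text \<open>Because \<open>L\<close> is skew-Hermitian, the numerator is
  \<open>(mat 1 + L) ** X ** (mat 1 - L)\<close>, whose first-order term is a commutator.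
  Commutators are traceless, so the normalising factor is stationary and contributes
  nothing.\<close>

lemma orbit_curve_derivative:
  fixes L :: "'a::real_normed_vector \<Rightarrow> nat \<Rightarrow> complex ^ 'd ^ 'd"
  assumes L: "\<And>s. bounded_linear (\<lambda>y. L y s)" and sk: "\<And>y s. skew_hermitian (L y s)" and s: "s \<in> {1..n}"
    and w: "norm (w s) = 1" and x: "x = r s *\<^sub>R rank_one (w s)"
  shows "((\<lambda>y. orbit_curve n r w L y s) has_derivative (\<lambda>h. commutator (L h s) x)) (at 0)"
proof -
  let ?X = "rank_one (w s)"
  define R where "R y = (mat 1 + L y s) ** ?X ** (mat 1 - L y s)" for y
  interpret L: bounded_linear "\<lambda>y. L y s" by (rule L)
  have R: "rank_one ((mat 1 + L y s) *v w s) = R y" for y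
    using matrix_rank_one[of "mat 1 + L y s" "w s"] sk[of y s]
    by (simp add: R_def adj_add skew_hermitianD)
  have nR: "(norm ((mat 1 + L y s) *v w s))\<^sup>2 = Re (trace (R y))" for y
    by (simp flip: R add: trace_rank_one_self flip: of_real_power)
  have L0: "L 0 s = 0" by (rule L.zero)
  have dL: "((\<lambda>y. L y s) has_derivative (\<lambda>h. L h s)) (at 0)" by (rule L.has_derivative[OF has_derivative_ident])
  have "((\<lambda>y. (mat 1 + L y s) ** ?X) has_derivative (\<lambda>h. (mat 1 + L 0 s) ** 0 + (0 + L h s) ** ?X)) (at 0)"
    by (intro bounded_bilinear.FDERIV[OF bounded_bilinear_matrix_mult] has_derivative_add has_derivative_const dL)
  from bounded_bilinear.FDERIV[OF bounded_bilinear_matrix_mult this has_derivative_diff[OF has_derivative_const dL], of "mat 1"]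
  have dR: "(R has_derivative (\<lambda>h. commutator (L h s) ?X)) (at 0)"
    by (simp add: R_def[abs_def] L0 commutator_def matrix_minus_right)
  have "((\<lambda>y. Re (trace (R y))) has_derivative (\<lambda>h. Re (trace (commutator (L h s) ?X)))) (at 0)"
    by (intro bounded_linear.has_derivative[OF bounded_linear_Re] bounded_linear.has_derivative[OF bounded_linear_trace] dR)
  then have dt: "((\<lambda>y. Re (trace (R y))) has_derivative (\<lambda>h. 0)) (at 0)" by simp
  have t0: "Re (trace (R 0)) = 1" using nR[of 0] w by (simp add: L0)
  have "((\<lambda>y. r s / Re (trace (R y))) has_derivative (\<lambda>h. 0)) (at 0)"
    using has_derivative_divide[OF has_derivative_const[of "r s"] dt] t0 by simp
  from has_derivative_scaleR[OF this dR]
  have "((\<lambda>y. (r s / Re (trace (R y))) *\<^sub>R R y) has_derivative (\<lambda>h. r s *\<^sub>R commutator (L h s) ?X)) (at 0)"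
    by (simp add: t0)
  moreover have "orbit_curve n r w L y s = (r s / Re (trace (R y))) *\<^sub>R R y" for y
    using s by (simp add: orbit_curve_def R nR)
  ultimately show ?thesis by (simp add: x commutator_scaleR)
qed

lemma N_tilde_choice:
  assumes "x \<in> N_tilde n r"
  obtains w where "\<And>s. s \<in> {1..n} \<Longrightarrow> norm (w s) = 1 \<and> x s = r s *\<^sub>R rank_one (w s)"
proof -
  have "\<forall>s\<in>{1..n}. \<exists>w. norm w = 1 \<and> x s = r s *\<^sub>R rank_one w"
    using N_tilde_rank_one[OF assms] by metis
  then show thesis using that by metis
qed

lemma orbit_curve_regular_open:
  fixes L :: "'a::real_normed_vector \<Rightarrow> nat \<Rightarrow> complex ^ 'd ^ 'd"
  assumes L: "\<And>s. bounded_linear (\<lambda>y. L y s)"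
  shows "open {y. \<forall>s\<in>{1..n}. (mat 1 + L y s) *v w s \<noteq> 0}"
proof -
  have "continuous_on UNIV (\<lambda>y. (mat 1 + L y s) *v w s)" for s
    by (intro bounded_linear.continuous_on[OF bounded_linear_matrix_vector_left] continuous_intros bounded_linear.continuous_on[OF L])
  then have "open {y. (mat 1 + L y s) *v w s \<noteq> 0}" for s
    by (intro open_Collect_neq continuous_on_const)
  moreover have "{y. \<forall>s\<in>{1..n}. (mat 1 + L y s) *v w s \<noteq> 0} = (\<Inter>s\<in>{1..n}. {y. (mat 1 + L y s) *v w s \<noteq> 0})"
    by auto
  ultimately show ?thesis by (simp only:) (intro open_INT, auto)
qed

lemma commutator_hermitian_coordinate:
  "skew_hermitian L \<Longrightarrow> x \<in> N_tilde n r \<Longrightarrow> s \<in> {1..n} \<Longrightarrow> hermitian (commutator L (x s))"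
  by (rule hermitian_commutator_skew) (auto elim!: N_tilde_rank_one simp: hermitian_closed)

lemma orbit_curve_chain_rule:
  fixes L :: "'a::real_normed_vector \<Rightarrow> nat \<Rightarrow> complex ^ 'd ^ 'd" and x :: "('d::finite) config"
  assumes L: "\<And>s. bounded_linear (\<lambda>y. L y s)" and sk: "\<And>y s. skew_hermitian (L y s)"
    and x: "x \<in> N_tilde n r" and w: "\<And>s. s \<in> {1..n} \<Longrightarrow> norm (w s) = 1 \<and> x s = r s *\<^sub>R rank_one (w s)"
    and W: "openin (top_of_set (Herm_n n)) W" "smooth_on n W F" "x \<in> W"
  shows "((\<lambda>y. F (orbit_curve n r w L y)) has_derivative
    (\<lambda>h. \<Sum>s=1..n. Im (trace (gradient F x s ** commutator (L h s) (x s))))) (at 0)"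
proof -
  let ?\<gamma> = "orbit_curve n r w L"
  have L0: "L 0 s = 0" for s using L by (rule bounded_linear.linear[THEN linear_0])
  have \<gamma>0: "?\<gamma> 0 = x" by (rule orbit_curve_0[where L = L and y = 0, OF w x L0])
  let ?S = "{y. \<forall>s\<in>{1..n}. (mat 1 + L y s) *v w s \<noteq> 0}"
  have "w s \<noteq> 0" if "s \<in> {1..n}" for s using w[OF that] by auto
  then have "0 \<in> ?S" by (simp add: L0)
  then have "\<forall>\<^sub>F y in nhds 0. y \<in> ?S"
    by (rule eventually_nhds_in_open[OF orbit_curve_regular_open[OF L]])
  then have ev: "\<forall>\<^sub>F y in nhds 0. ?\<gamma> y \<in> Herm_n n"
  proof eventually_elim
    case (elim y)
    then have "?\<gamma> y \<in> N_tilde n r" by (intro orbit_curve_in_N_tilde) blast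
    then show ?case by (rule subsetD[OF N_tilde_subset_Herm])
  qed
  have "((\<lambda>y. F (?\<gamma> y)) has_derivative (\<lambda>h. \<Sum>s=1..n. Im (trace (gradient F (?\<gamma> 0) s ** commutator (L h s) (x s))))) (at 0)"
  proof (rule smooth_on_chain_rule[OF W(1,2) _ ev])
    show "((\<lambda>y. ?\<gamma> y s) has_derivative (\<lambda>h. commutator (L h s) (x s))) (at 0)" if "s \<in> {1..n}" for s
      by (rule orbit_curve_derivative[OF L sk that]) (use w[OF that] in auto)
    show "hermitian (commutator (L h s) (x s))" if "s \<in> {1..n}" for s h
      by (rule commutator_hermitian_coordinate[OF sk x that])
  qed (simp add: \<gamma>0 W)
  then show ?thesis by (simp only: \<gamma>0)
qed

subsection \<open>Well-definedness of the bracket\<close>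

text \<open>Two local extensions agree along an orbit curve, since the curve remains in
  \<open>V\<close>. Their gradients may differ, but not when paired with a vector tangent to the
  orbits.\<close>

lemma gradient_tangent_unique:
  fixes x :: "('d::finite) config"
  assumes V: "openin (top_of_set (N_tilde n r)) V" and x: "x \<in> V"
    and F: "local_extension n V f x F" "local_extension n V f x F'" and sk: "\<And>s. skew_hermitian (\<xi> s)"
  shows "(\<Sum>s=1..n. Im (trace (gradient F x s ** commutator (\<xi> s) (x s))))
    = (\<Sum>s=1..n. Im (trace (gradient F' x s ** commutator (\<xi> s) (x s))))"
proof -
  obtain W W' where W: "openin (top_of_set (Herm_n n)) W" "x \<in> W" "smooth_on n W F" "\<And>y. y \<in> W \<inter> V \<Longrightarrow> F y = f y"
    and W': "openin (top_of_set (Herm_n n)) W'" "x \<in> W'" "smooth_on n W' F'" "\<And>y. y \<in> W' \<inter> V \<Longrightarrow> F' y = f y"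
    using F unfolding local_extension_def by metis
  have xN: "x \<in> N_tilde n r" using V x openin_imp_subset by blast
  obtain w where w: "\<And>s. s \<in> {1..n} \<Longrightarrow> norm (w s) = 1 \<and> x s = r s *\<^sub>R rank_one (w s)"
    using N_tilde_choice[OF xN] by blast
  define L where "L t s = t *\<^sub>R \<xi> s" for t :: real and s
  have L: "bounded_linear (\<lambda>t. L t s)" for s unfolding L_def by (rule bounded_linear_scaleR_left)
  have skL: "skew_hermitian (L t s)" for t s
    using sk by (simp add: L_def skew_hermitian_def adj_scaleR)
  let ?\<gamma> = "orbit_curve n r w L"
  obtain T T' TV where T: "open T" "W = Herm_n n \<inter> T" "open T'" "W' = Herm_n n \<inter> T'" "open TV" "V = N_tilde n r \<inter> TV"
    using W(1) W'(1) V unfolding openin_open by metis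
  let ?S = "{y. \<forall>s\<in>{1..n}. (mat 1 + L y s) *v w s \<noteq> 0}"
  have L0: "L 0 s = 0" for s by (simp add: L_def)
  have \<gamma>0: "?\<gamma> 0 = x" by (rule orbit_curve_0[where L = L and y = 0, OF w xN L0])
  have S: "open ?S" by (rule orbit_curve_regular_open[OF L])
  have "w s \<noteq> 0" if "s \<in> {1..n}" for s using w[OF that] by auto
  then have "0 \<in> ?S" by (simp add: L0)
  have c: "continuous_on ?S ?\<gamma>" by (rule orbit_curve_continuous[OF L]) auto
  have "open (?S \<inter> ?\<gamma> -` (T \<inter> T' \<inter> TV))"
    by (rule continuous_open_preimage[OF c S]) (intro open_Int T)
  moreover have "0 \<in> ?S \<inter> ?\<gamma> -` (T \<inter> T' \<inter> TV)"
    using \<open>0 \<in> ?S\<close> W(2) W'(2) x T \<gamma>0 by simp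
  ultimately have ev: "\<forall>\<^sub>F t in nhds 0. t \<in> ?S \<inter> ?\<gamma> -` (T \<inter> T' \<inter> TV)"
    by (rule eventually_nhds_in_open)
  have eq: "\<forall>\<^sub>F t in nhds 0. F (?\<gamma> t) = F' (?\<gamma> t)"
    using ev
  proof eventually_elim
    case (elim t)
    then have "?\<gamma> t \<in> N_tilde n r" by (intro orbit_curve_in_N_tilde) auto
    then have "?\<gamma> t \<in> W \<inter> V" "?\<gamma> t \<in> W' \<inter> V" using elim T N_tilde_subset_Herm by auto
    then show ?case using W(4) W'(4) by simp
  qed
  have d: "((\<lambda>t. F (?\<gamma> t)) has_derivative (\<lambda>h. \<Sum>s=1..n. Im (trace (gradient F x s ** commutator (L h s) (x s))))) (at 0)"
    by (rule orbit_curve_chain_rule[OF L skL xN w W(1,3,2)])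
  have d': "((\<lambda>t. F' (?\<gamma> t)) has_derivative (\<lambda>h. \<Sum>s=1..n. Im (trace (gradient F' x s ** commutator (L h s) (x s))))) (at 0)"
    by (rule orbit_curve_chain_rule[OF L skL xN w W'(1,3,2)])
  have "((\<lambda>t. F' (?\<gamma> t)) has_derivative (\<lambda>h. \<Sum>s=1..n. Im (trace (gradient F x s ** commutator (L h s) (x s))))) (at 0)"
  proof (rule has_derivative_transform_eventually[OF d])
    show "\<forall>\<^sub>F t in at 0. F (?\<gamma> t) = F' (?\<gamma> t)" using eq by (simp add: eventually_at_filter eventually_mono)
    show "F (?\<gamma> 0) = F' (?\<gamma> 0)" using eventually_nhds_x_imp_x[OF eq] .
  qed (rule UNIV_I)
  from has_derivative_unique[OF this d']
  have "(\<Sum>s=1..n. Im (trace (gradient F x s ** commutator (L 1 s) (x s)))) = (\<Sum>s=1..n. Im (trace (gradient F' x s ** commutator (L 1 s) (x s))))"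
    by (rule fun_cong)
  then show ?thesis by (simp add: L_def)
qed

lemma local_extension_gradient_skew:
  assumes "local_extension n V f x F" "s \<in> {1..n}"
  shows "skew_hermitian (gradient F x s)"
  using assms smooth_on_gradient(1) unfolding local_extension_def by blast

lemma lie_pairing_tangent: "lie_pairing e X Y = Im (trace (X ** commutator Y e))"
  "lie_pairing e X Y = - Im (trace (Y ** commutator X e))"
  using lie_pairing_cyclic lie_pairing_antisym by metis+

text \<open>The bracket is the derivative of one function along the Hamiltonian vector of the other,
  and this vector is tangent to the orbits. One slot can thus be replaced directly and the other
  after exchanging the two by antisymmetry.\<close>

lemma bracket_eq:
  fixes x :: "('d::finite) config"
  assumes V: "openin (top_of_set (N_tilde n r)) V" and x: "x \<in> V"
    and F: "local_extension n V f x F" and G: "local_extension n V g x G"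
  shows "bracket n V f g x = (\<Sum>s=1..n. lie_pairing (x s) (gradient F x s) (gradient G x s))"
  unfolding bracket_def
proof (rule the_equality)
  fix c assume "\<exists>F G. local_extension n V f x F \<and> local_extension n V g x G \<and>
    c = (\<Sum>s=1..n. lie_pairing (x s) (gradient F x s) (gradient G x s))"
  then obtain F' G' where F': "local_extension n V f x F'" and G': "local_extension n V g x G'"
    and c: "c = (\<Sum>s=1..n. lie_pairing (x s) (gradient F' x s) (gradient G' x s))" by blast
  have key: "(\<Sum>s=1..n. Im (trace (gradient F1 x s ** commutator (gradient H x s) (x s)))) =
     (\<Sum>s=1..n. Im (trace (gradient F2 x s ** commutator (gradient H x s) (x s))))"
    if "local_extension n V f1 x F1" "local_extension n V f1 x F2" "local_extension n V h x H" for f1 F1 F2 h H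
  proof -
    define \<xi> where "\<xi> s = (if s \<in> {1..n} then gradient H x s else 0)" for s
    have "skew_hermitian (\<xi> s)" for s
      using local_extension_gradient_skew[OF that(3)] by (simp add: \<xi>_def skew_hermitian_def)
    from gradient_tangent_unique[OF V x that(1,2), of \<xi>, OF this]
    show ?thesis by (simp add: \<xi>_def)
  qed
  have "c = (\<Sum>s=1..n. Im (trace (gradient F' x s ** commutator (gradient G' x s) (x s))))"
    unfolding c by (intro sum.cong refl lie_pairing_tangent(1))
  also have "\<dots> = (\<Sum>s=1..n. Im (trace (gradient F x s ** commutator (gradient G' x s) (x s))))"
    by (rule key[OF F' F G'])
  also have "\<dots> = (\<Sum>s=1..n. lie_pairing (x s) (gradient F x s) (gradient G' x s))"
    by (intro sum.cong refl lie_pairing_tangent(1)[symmetric])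
  also have "\<dots> = - (\<Sum>s=1..n. Im (trace (gradient G' x s ** commutator (gradient F x s) (x s))))"
    unfolding sum_negf[symmetric] by (intro sum.cong refl lie_pairing_tangent(2))
  also have "\<dots> = - (\<Sum>s=1..n. Im (trace (gradient G x s ** commutator (gradient F x s) (x s))))"
    by (simp only: key[OF G' G F])
  also have "\<dots> = (\<Sum>s=1..n. lie_pairing (x s) (gradient F x s) (gradient G x s))"
    unfolding sum_negf[symmetric] by (intro sum.cong refl lie_pairing_tangent(2)[symmetric])
  finally show "c = (\<Sum>s=1..n. lie_pairing (x s) (gradient F x s) (gradient G x s))" .
qed (use F G in blast)

subsection \<open>Invariant functions\<close>

lemma cscale_add_left: "cscale (a + b) M = cscale a M + cscale b M"
  by (simp add: vec_eq_iff algebra_simps)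

lemma conj_by_Herm: "x \<in> Herm_n n \<Longrightarrow> conj_by n U x \<in> Herm_n n"
  by (auto simp: conj_by_def Herm_n_def PiE_iff hermitian_def adj_simps matrix_mul_assoc)

text \<open>Multiplication by \<open>cis t\<close> on the line of \<open>u\<close> and the identity
  on its complement.\<close>

lemma rotation_unitary:
  assumes "norm u = 1"
  shows "unitary (mat 1 + cscale (cis t - 1) (rank_one u))"
proof -
  have PP: "rank_one u ** rank_one u = rank_one u"
    using rank_one_sandwich[of u "mat 1"] assms by (simp add: trace_rank_one_self)
  have z: "(c - 1) + (cnj c - 1) + (c - 1) * (cnj c - 1) = 0" if "cmod c = 1" for c
  proof -
    have "(c - 1) + (cnj c - 1) + (c - 1) * (cnj c - 1) = c * cnj c - 1" by (simp add: algebra_simps)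
    then show ?thesis using that by (simp flip: complex_norm_square)
  qed
  have "(mat 1 + cscale a (rank_one u)) ** (mat 1 + cscale b (rank_one u)) = mat 1 + cscale (a + b + a * b) (rank_one u)" for a b
    by (simp add: matrix_add_ldistrib matrix_add_rdistrib cscale_mult_left cscale_mult_right cscale_cscale PP) (simp add: vec_eq_iff algebra_simps)
  note mult = this
  have adj: "adj (mat 1 + cscale (cis t - 1) (rank_one u)) = mat 1 + cscale (cnj (cis t) - 1) (rank_one u)"
    by (simp add: adj_simps)
  show ?thesis
    unfolding unitary_def adj mult using z[of "cis t"] z[of "cnj (cis t)"] by simp
qed

text \<open>Noether's theorem: the Hamiltonian vector field of an invariant function annihilates the
  momentum. Rotations in a single line suffice as test unitaries. They show that the Hermitian
  matrix \<open>Z\<close> has zero quadratic form on unit vectors, so all its eigenvalues are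
  0.\<close>

lemma invariant_gradient_moment:
  fixes x :: "('d::finite) config"
  assumes V: "V \<subseteq> N_tilde n r" and x: "x \<in> V" and F: "local_extension n V f x F"
    and inv: "\<And>U. unitary U \<Longrightarrow> conj_by n U x \<in> V \<and> f (conj_by n U x) = f x"
  shows "(\<Sum>s=1..n. commutator (gradient F x s) (x s)) = 0"
proof -
  obtain W where W: "openin (top_of_set (Herm_n n)) W" "x \<in> W" "smooth_on n W F" "\<And>y. y \<in> W \<inter> V \<Longrightarrow> F y = f y"
    using F unfolding local_extension_def by metis
  have xN: "x \<in> N_tilde n r" using V x by blast
  have xH: "x \<in> Herm_n n" using xN N_tilde_subset_Herm by blast
  define Z where "Z = (\<Sum>s=1..n. commutator (gradient F x s) (x s))"
  have hZ: "hermitian Z" unfolding Z_def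
    by (intro hermitian_sum commutator_hermitian_coordinate[OF local_extension_gradient_skew[OF F] xN])
  have zero: "hinner (Z *v u) u = 0" if u: "norm u = 1" for u
  proof -
    let ?P = "rank_one u" and ?K = "cscale \<i> (rank_one u)"
    define U where "U t = mat 1 + cscale (cis t - 1) ?P" for t
    define \<gamma> where "\<gamma> t = conj_by n (U t) x" for t
    have U0: "U 0 = mat 1" by (simp add: U_def)
    have \<gamma>0: "\<gamma> 0 = x"
      unfolding \<gamma>_def U0 conj_by_def using xH by (auto simp: Herm_n_def PiE_iff extensional_def)
    have un: "unitary (U t)" for t unfolding U_def by (rule rotation_unitary[OF u])
    have \<gamma>V: "\<gamma> t \<in> V" "f (\<gamma> t) = f x" for t using inv[OF un] by (auto simp: \<gamma>_def)
    have \<gamma>H: "\<gamma> t \<in> Herm_n n" for t unfolding \<gamma>_def by (rule conj_by_Herm[OF xH])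
    have cs: "bounded_linear (\<lambda>c. cscale c ?P)"
      by (subst linear_conv_bounded_linear[symmetric])
        (auto simp: cscale_scaleR cscale_add_left intro!: linearI)
    have "(cis has_vector_derivative \<i>) (at 0)"
      using has_derivative_cis[OF has_derivative_ident, of 0 UNIV] by (simp add: has_vector_derivative_def)
    then have "((\<lambda>t. cscale (cis t - 1) ?P) has_vector_derivative cscale (\<i> - 0) ?P) (at 0)"
      by (intro bounded_linear_vector_derivative[OF cs] has_vector_derivative_diff has_vector_derivative_const)
    then have dU: "(U has_vector_derivative ?K) (at 0)"
      unfolding U_def[abs_def] using has_vector_derivative_add[OF has_vector_derivative_const[of "mat 1"]] by fastforce
    have dU': "((\<lambda>t. adj (U t)) has_vector_derivative adj ?K) (at 0)"
      by (rule bounded_linear_vector_derivative[OF bounded_linear_adj dU])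
    have aK: "adj ?K = - ?K" by (simp add: adj_simps) (simp add: vec_eq_iff)
    have d\<gamma>: "((\<lambda>t. \<gamma> t s) has_derivative (\<lambda>h. h *\<^sub>R commutator ?K (x s))) (at 0)" if s: "s \<in> {1..n}" for s
    proof -
      have "((\<lambda>t. U t ** x s ** adj (U t)) has_vector_derivative (U 0 ** x s ** adj ?K + (U 0 ** 0 + ?K ** x s) ** adj (U 0))) (at 0)"
        by (intro matrix_mult_has_vector_derivative dU dU' has_vector_derivative_const)
      then have "((\<lambda>t. U t ** x s ** adj (U t)) has_vector_derivative commutator ?K (x s)) (at 0)"
        unfolding aK by (simp add: U0 commutator_def matrix_minus_right)
      then show ?thesis using s by (simp add: \<gamma>_def conj_by_def has_vector_derivative_def)
    qed
    have "((\<lambda>t. F (\<gamma> t)) has_derivative (\<lambda>h. \<Sum>s=1..n. Im (trace (gradient F (\<gamma> 0) s ** (h *\<^sub>R commutator ?K (x s)))))) (at 0)"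
    proof (rule smooth_on_chain_rule[OF W(1,3)])
      show "hermitian (h *\<^sub>R commutator ?K (x s))" if "s \<in> {1..n}" for h s
        using aK by (intro hermitian_closed commutator_hermitian_coordinate[OF _ xN that]) (simp add: skew_hermitian_def)
    qed (use \<gamma>H \<gamma>0 W d\<gamma> in auto)
    then have d: "((\<lambda>t. F (\<gamma> t)) has_derivative (\<lambda>h. \<Sum>s=1..n. Im (trace (gradient F x s ** (h *\<^sub>R commutator ?K (x s)))))) (at 0)"
      by (simp only: \<gamma>0)
    obtain T where T: "open T" "W = Herm_n n \<inter> T" using W(1) unfolding openin_open by blast
    have "(\<gamma> \<longlongrightarrow> \<gamma> 0) (nhds 0)"
    proof (rule tendsto_fun_coordinatewise)
      fix s
      show "((\<lambda>t. \<gamma> t s) \<longlongrightarrow> \<gamma> 0 s) (nhds 0)"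
      proof (cases "s \<in> {1..n}")
        case True
        then show ?thesis
          using has_derivative_continuous[OF d\<gamma>[OF True]] unfolding continuous_at
          by (simp only: tendsto_at_iff_tendsto_nhds[of "\<lambda>t. \<gamma> t s" 0])
      next
        case False
        then show ?thesis
          unfolding \<gamma>_def conj_by_def restrict_def by (simp only: if_False tendsto_const)
      qed
    qed
    then have "\<forall>\<^sub>F t in nhds 0. \<gamma> t \<in> T"
      using T W(2) \<gamma>0 by (intro topological_tendstoD[where l = "\<gamma> 0"]) auto
    then have eq: "\<forall>\<^sub>F t in nhds 0. F (\<gamma> t) = f x"
      by eventually_elim (use W(4) \<gamma>V \<gamma>H T in auto)
    have "((\<lambda>t. f x) has_derivative (\<lambda>h. \<Sum>s=1..n. Im (trace (gradient F x s ** (h *\<^sub>R commutator ?K (x s)))))) (at 0)"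
    proof (rule has_derivative_transform_eventually[OF d])
      show "\<forall>\<^sub>F t in at 0. F (\<gamma> t) = f x" using eq by (simp add: eventually_at_filter eventually_mono)
      show "F (\<gamma> 0) = f x" using eventually_nhds_x_imp_x[OF eq] .
    qed simp
    from fun_cong[OF has_derivative_unique[OF this has_derivative_const], of 1]
    have "0 = (\<Sum>s=1..n. Im (trace (gradient F x s ** commutator ?K (x s))))" by simp
    also have "\<dots> = (\<Sum>s=1..n. - Im (trace (?K ** commutator (gradient F x s) (x s))))"
      by (intro sum.cong refl) (metis lie_pairing_tangent)
    also have "\<dots> = - Im (trace (?K ** Z))"
      by (simp add: Z_def matrix_sum_right trace_sum sum_negf)
    also have "trace (?K ** Z) = \<i> * hinner (Z *v u) u"
      by (simp add: cscale_mult_left trace_cscale trace_mul_sym[of ?P] trace_rank_one)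
    finally have "Re (hinner (Z *v u) u) = 0" by simp
    moreover have "cnj (hinner (Z *v u) u) = hinner (Z *v u) u"
      by (simp add: hinner_cnj hinner_hermitian hZ)
    ultimately show ?thesis by (simp add: complex_eq_iff)
  qed
  obtain v where v: "orthoframe v" "\<And>a. a < CARD('d) \<Longrightarrow> Z *v v a = eigvals Z ! a *\<^sub>R v a"
    by (rule spectral_theorem[OF hZ]) blast
  have "Z = 0"
  proof (rule matrix_eqI_frame[OF v(1)])
    fix a assume a: "a < CARD('d)"
    have "of_real (eigvals Z ! a) * hinner (v a) (v a) = (0::complex)"
      using zero[OF orthoframe_norm[OF v(1) a]] by (simp add: v(2)[OF a] hinner_scaleR)
    then have "eigvals Z ! a = 0" using orthoframe_hinner[OF v(1) a a] by simp
    then show "Z *v v a = 0 *v v a" using v(2)[OF a] by simp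
  qed
  then show ?thesis by (simp add: Z_def)
qed

subsection \<open>Reduction to the momentum level\<close>

context interlacing
begin

lemma lam_tendsto:
  assumes "i < n"
  shows "((\<lambda>y. lam m y i j) \<longlongrightarrow> lam m x i j) (at x within Herm_n n)"
proof (cases "j \<le> m + 1")
  case True
  have "((\<lambda>y. eigvals (partial_sum y i) ! (j - 1)) \<longlongrightarrow> eigvals (partial_sum x i) ! (j - 1)) (at x within Herm_n n)"
  proof (rule eigvals_tendsto[OF A_hermitian[OF assms] _ partial_sum_tendsto])
    show "\<forall>\<^sub>F y in at x within Herm_n n. hermitian (partial_sum y i)"
      unfolding eventually_at_filter
      by (intro always_eventually allI impI partial_sum_hermitian) (use assms in auto)
    show "j - 1 < CARD('d)" using True card_d by simp
  qed
  then show ?thesis using True by (simp add: lam_def)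
qed (simp add: lam_def)

lemma M_tilde0_locally_open:
  obtains T where "open T" "x \<in> T" "\<And>y. y \<in> T \<Longrightarrow> y \<in> M_tilde m n r \<Longrightarrow> y \<in> M_tilde0 m n r"
proof -
  let ?C = "\<lambda>y i j. (\<not> both_forced m n i j (i - 1) j \<longrightarrow> lam m y i j > lam m y (i - 1) j) \<and>
     (\<not> both_forced m n (i - 1) j i (j + 1) \<longrightarrow> lam m y (i - 1) j > lam m y i (j + 1))"
  have "\<forall>\<^sub>F y in at x within Herm_n n. \<forall>i\<in>{1..n-1}. \<forall>j\<in>{1..i}. ?C y i j"
  proof (intro eventually_ball_finite ballI finite_atLeastAtMost)
    fix i j assume ij: "i \<in> {1..n-1}" "j \<in> {1..i}"
    then have "i < n" "i - 1 < n" by auto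
    note l = lam_tendsto[OF this(1)] lam_tendsto[OF this(2)]
    have less: "\<forall>\<^sub>F y in at x within Herm_n n. f y < g y"
      if "(f \<longlongrightarrow> f x) (at x within Herm_n n)" "(g \<longlongrightarrow> g x) (at x within Herm_n n)" "f x < g x" for f g :: "'d config \<Rightarrow> real"
    proof -
      have "((\<lambda>y. g y - f y) \<longlongrightarrow> g x - f x) (at x within Herm_n n)" by (intro tendsto_diff that)
      then have "\<forall>\<^sub>F y in at x within Herm_n n. 0 < g y - f y" using that(3) by (intro order_tendstoD(1)) auto
      then show ?thesis by eventually_elim simp
    qed
    have Cx: "?C x i j" using interlace ij by blast
    show "\<forall>\<^sub>F y in at x within Herm_n n. ?C y i j"
    proof (intro eventually_conj)
      show "\<forall>\<^sub>F y in at x within Herm_n n. \<not> both_forced m n i j (i - 1) j \<longrightarrow> lam m y i j > lam m y (i - 1) j"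
        using less[OF l(2) l(1), of j j] Cx by (cases "both_forced m n i j (i - 1) j") auto
      show "\<forall>\<^sub>F y in at x within Herm_n n. \<not> both_forced m n (i - 1) j i (j + 1) \<longrightarrow> lam m y (i - 1) j > lam m y i (j + 1)"
        using less[OF l(1) l(2), of "j + 1" j] Cx by (cases "both_forced m n (i - 1) j i (j + 1)") auto
    qed
  qed
  then obtain T where T: "open T" "x \<in> T" "\<And>y. y \<in> T \<Longrightarrow> y \<noteq> x \<Longrightarrow> y \<in> Herm_n n \<Longrightarrow> \<forall>i\<in>{1..n-1}. \<forall>j\<in>{1..i}. ?C y i j"
    unfolding eventually_at_topological by blast
  have "y \<in> M_tilde0 m n r" if y: "y \<in> T" "y \<in> M_tilde m n r" for y
  proof (cases "y = x")
    case False
    have "y \<in> Herm_n n" using y(2) N_tilde_subset_Herm unfolding M_tilde_def by blast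
    then show ?thesis using T(3)[OF y(1) False] y(2) unfolding M_tilde0_def by blast
  qed (use xM in simp)
  then show thesis using that T(1,2) by blast
qed

text \<open>The moment map \<open>x \<mapsto> \<Sum>s. x s\<close> is a submersion at a point of \<open>M_tilde0\<close>; no implicit function theorem
  is needed: if \<open>F1 - F\<close> had a nonzero derivative along the level set, then the moment map paired with
  \<open>F1 - F\<close> would be open at \<open>x\<close>, contradicting that \<open>F1 - F\<close> takes discrete values on the level set.\<close>

lemma level_set_derivative:
  assumes W: "openin (top_of_set (Herm_n n)) W" "smooth_on n W F" "x \<in> W"
    and W1: "openin (top_of_set (Herm_n n)) W1" "smooth_on n W1 F1" "x \<in> W1"
    and T: "open T" "x \<in> T" and cong: "\<And>y. y \<in> M_tilde0 m n r \<Longrightarrow> y \<in> T \<Longrightarrow> y \<in> W \<Longrightarrow> y \<in> W1 \<Longrightarrow> [F1 y = F y] (rmod (2 * pi))"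
    and sk: "\<And>s. skew_hermitian (\<xi> s)" and \<xi>: "(\<Sum>s=1..n. commutator (\<xi> s) (x s)) = 0"
  shows "(\<Sum>s=1..n. Im (trace (gradient F1 x s ** commutator (\<xi> s) (x s))))
    = (\<Sum>s=1..n. Im (trace (gradient F x s ** commutator (\<xi> s) (x s))))"
proof (rule ccontr)
  assume neq: "\<not> ?thesis"
  define D where "D X = (\<Sum>s=1..n. Im (trace (gradient F1 x s ** commutator (X s) (x s))))
     - (\<Sum>s=1..n. Im (trace (gradient F x s ** commutator (X s) (x s))))" for X
  have c: "D \<xi> \<noteq> 0" using neq by (simp add: D_def)
  obtain w where w: "\<And>s. s \<in> {1..n} \<Longrightarrow> norm (w s) = 1 \<and> x s = r s *\<^sub>R rank_one (w s)"
    using N_tilde_choice[OF x_N] by blast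
  define H :: "complex ^ 'd ^ 'd \<Rightarrow> complex ^ 'd ^ 'd" where "H Y = (1 / 2) *\<^sub>R (Y + adj Y)" for Y
  have hH: "hermitian (H Y)" for Y by (simp add: H_def hermitian_def adj_simps add.commute)
  have linH: "linear H" unfolding H_def by (auto intro!: linearI simp: adj_simps scaleR_add_right algebra_simps)
  have linS: "linear (skew_part :: complex^'d^'d \<Rightarrow> _)" unfolding skew_part_def
    by (auto intro!: linearI simp: adj_simps algebra_simps)
  have dec: "Y = H Y + skew_part Y" for Y
    by (simp add: H_def skew_part_def flip: scaleR_add_right)
  have xh: "hermitian (x s)" if "s \<in> {1..n}" for s using x_H that by (auto simp: Herm_n_def PiE_iff)
  \<comment> \<open>A configuration is undefined outside its slots, whereas \<open>L\<close> must be
    skew-Hermitian at every index.\<close>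
  define x' where "x' s = (if s \<in> {1..n} then x s else 0)" for s
  have x'h: "hermitian (x' s)" for s using xh by (simp add: x'_def hermitian_closed)
  \<comment> \<open>The matrix parameter moves the momentum, with derivative the sum of the double
    commutators of \<open>H\<close> with the \<open>x s\<close>. The real parameter moves along
    \<open>\<xi>\<close>, which leaves the momentum stationary but changes
    \<open>F1 - F\<close>.\<close>
  define L where "L p s = commutator (H (fst p)) (x' s) + snd p *\<^sub>R \<xi> s" for p :: "(complex ^ 'd ^ 'd) \<times> real" and s
  have linL: "linear (\<lambda>p. L p s)" for s
    unfolding L_def by (auto intro!: linearI simp: linear_add[OF linH] linear_cmul[OF linH] commutator_add commutator_scaleR algebra_simps)
  then have L: "bounded_linear (\<lambda>p. L p s)" for s by (simp add: linear_conv_bounded_linear)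
  have skL: "skew_hermitian (L p s)" for p s
    using skew_commutator_hermitian[OF hH x'h, of "fst p" s] sk[of s] by (simp add: L_def skew_hermitian_def adj_simps)
  let ?\<gamma> = "orbit_curve n r w L"
  define S0 where "S0 = {p. \<forall>s\<in>{1..n}. (mat 1 + L p s) *v w s \<noteq> 0}"
  have L0: "L 0 s = 0" for s using linL by (rule linear_0)
  have \<gamma>0: "?\<gamma> 0 = x" by (rule orbit_curve_0[where L = L and y = 0, OF w x_N L0])
  have S0: "open S0" unfolding S0_def by (rule orbit_curve_regular_open[OF L])
  have "w s \<noteq> 0" if "s \<in> {1..n}" for s using w[OF that] by auto
  then have "0 \<in> S0" by (simp add: L0 S0_def)
  have c\<gamma>: "continuous_on S0 ?\<gamma>" by (rule orbit_curve_continuous[OF L]) (auto simp: S0_def)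
  obtain TW TW1 where TW: "open TW" "W = Herm_n n \<inter> TW" "open TW1" "W1 = Herm_n n \<inter> TW1"
    using W(1) W1(1) unfolding openin_open by metis
  obtain TM where TM: "open TM" "x \<in> TM" "\<And>y. y \<in> TM \<Longrightarrow> y \<in> M_tilde m n r \<Longrightarrow> y \<in> M_tilde0 m n r"
    using M_tilde0_locally_open by blast
  define S where "S = S0 \<inter> ?\<gamma> -` (T \<inter> TW \<inter> TW1 \<inter> TM)"
  have S: "open S" unfolding S_def
    by (rule continuous_open_preimage[OF c\<gamma> S0]) (intro open_Int T TW TM)
  have S_0: "0 \<in> S" using \<open>0 \<in> S0\<close> W(3) W1(3) T(2) TM(2) TW \<gamma>0 by (simp add: S_def)
  have \<gamma>N: "?\<gamma> p \<in> N_tilde n r" if "p \<in> S" for p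
    using that by (intro orbit_curve_in_N_tilde) (auto simp: S_def S0_def)
  have \<gamma>W: "?\<gamma> p \<in> W" "?\<gamma> p \<in> W1" "?\<gamma> p \<in> T" "?\<gamma> p \<in> TM" if "p \<in> S" for p
    using \<gamma>N[OF that] N_tilde_subset_Herm that TW by (auto simp: S_def)
  have c\<gamma>S: "continuous_on S ?\<gamma>" using c\<gamma> by (rule continuous_on_subset) (auto simp: S_def)
  \<comment> \<open>The momentum is Hermitian with constant trace, so it cannot move in
    skew-Hermitian or scalar directions. Adding these components of the parameter makes the
    derivative of \<open>\<Phi>\<close> a bijection of the whole space.\<close>
  define pr :: "complex ^ 'd ^ 'd \<Rightarrow> complex ^ 'd ^ 'd" where "pr Y = skew_part Y + Re (trace (H Y)) *\<^sub>R mat 1" for Y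
  have linpr: "linear pr" unfolding pr_def
    by (auto intro!: linearI simp: linear_add[OF linS] linear_cmul[OF linS] linear_add[OF linH] linear_cmul[OF linH] trace_simps algebra_simps)
  then have blpr: "bounded_linear pr" by (simp add: linear_conv_bounded_linear)
  define \<Phi> where "\<Phi> p = ((\<Sum>s=1..n. ?\<gamma> p s) + pr (fst p), F1 (?\<gamma> p) - F (?\<gamma> p))" for p
  define \<Phi>' where "\<Phi>' p = ((\<Sum>s=1..n. commutator (L p s) (x s)) + pr (fst p), D (L p))" for p
  have cont: "continuous_on S \<Phi>"
  proof -
    have "?\<gamma> ` S \<subseteq> W1" "?\<gamma> ` S \<subseteq> W" using \<gamma>W(1,2) by auto
    then have "continuous_on S (\<lambda>p. F1 (?\<gamma> p))" "continuous_on S (\<lambda>p. F (?\<gamma> p))"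
      using continuous_on_compose2[OF smooth_on_continuous[OF W1(2)] c\<gamma>S]
        continuous_on_compose2[OF smooth_on_continuous[OF W(2)] c\<gamma>S] by auto
    then show ?thesis unfolding \<Phi>_def
      by (intro continuous_intros continuous_on_product_then_coordinatewise[OF c\<gamma>S] bounded_linear.continuous_on[OF blpr])
  qed
  have chain: "((\<lambda>p. F' (?\<gamma> p)) has_derivative (\<lambda>h. \<Sum>s=1..n. Im (trace (gradient F' x s ** commutator (L h s) (x s))))) (at 0)"
    if "openin (top_of_set (Herm_n n)) W'" "smooth_on n W' F'" "x \<in> W'" for W' F'
    by (rule orbit_curve_chain_rule[OF L skL x_N w that])
  have deriv: "(\<Phi> has_derivative \<Phi>') (at 0)"
    unfolding \<Phi>_def[abs_def] \<Phi>'_def[abs_def] D_def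
  proof (intro has_derivative_Pair has_derivative_add has_derivative_diff has_derivative_sum
      chain[OF W] chain[OF W1] bounded_linear.has_derivative[OF blpr] bounded_linear.has_derivative[OF bounded_linear_fst] has_derivative_ident)
    show "((\<lambda>p. ?\<gamma> p s) has_derivative (\<lambda>h. commutator (L h s) (x s))) (at 0)" if "s \<in> {1..n}" for s
      by (rule orbit_curve_derivative[OF L skL that]) (use w[OF that] in auto)
  qed
  \<comment> \<open>The traceless Hermitian, skew-Hermitian and scalar parts are independent, so the
    padding must vanish on its own. This is used both for injectivity of the derivative and for the
    point found at the end.\<close>
  have slice: "skew_part Y = 0 \<and> Re (trace (H Y)) = 0" if K: "hermitian K" "K + pr Y = 0" "Re (trace K) = 0" for K Y
  proof -
    have a: "adj (K + pr Y) = K - skew_part Y + Re (trace (H Y)) *\<^sub>R mat 1"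
      using K(1) skew_part_skew[of Y] by (simp add: pr_def adj_simps hermitianD skew_hermitianD)
    have "2 *\<^sub>R skew_part Y = (K + pr Y) - adj (K + pr Y)" unfolding a by (simp add: pr_def scaleR_2)
    also have "\<dots> = 0" by (simp add: K(2))
    finally have "2 *\<^sub>R skew_part Y = 0" .
    then have z: "skew_part Y = 0" by simp
    then have "Re (trace (K + Re (trace (H Y)) *\<^sub>R mat 1)) = 0" using K(2) by (simp add: pr_def)
    then have "Re (trace (H Y)) = 0" by (simp add: trace_simps trace_I K(3))
    then show ?thesis using z by simp
  qed
  have inj: "p = 0" if p0: "\<Phi>' p = 0" for p
  proof -
    define Y where "Y = fst p"
    let ?K = "\<Sum>s=1..n. commutator (commutator (H Y) (x s)) (x s)"
    have "(\<Sum>s=1..n. commutator (L p s) (x s)) = (\<Sum>s=1..n. commutator (commutator (H Y) (x s)) (x s) + snd p *\<^sub>R commutator (\<xi> s) (x s))"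
      by (intro sum.cong refl) (simp add: L_def Y_def x'_def commutator_add commutator_scaleR)
    also have "\<dots> = ?K" by (simp only: sum.distrib \<xi> scaleR_right.sum[symmetric] scaleR_zero_right add_0_right)
    finally have KP: "?K + pr Y = 0" using p0 by (simp add: \<Phi>'_def Y_def zero_prod_def)
    have hK: "hermitian ?K"
      by (intro hermitian_sum hermitian_commutator_skew skew_commutator_hermitian hH xh)
    have "trace ?K = 0" by (simp add: trace_sum)
    then have sp: "skew_part Y = 0" "Re (trace (H Y)) = 0" using slice[OF hK KP] by auto
    then have K0: "?K = 0" using KP by (simp add: pr_def)
    \<comment> \<open>Paired with \<open>H Y\<close>, the double commutators become a sum of squared
      norms. If they vanish, \<open>H Y\<close> commutes with every \<open>x s\<close>, and
      \<open>irreducible\<close> makes it scalar.\<close>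
    have "trace (H Y ** commutator (commutator (H Y) (x s)) (x s)) = of_real ((norm (commutator (H Y) (x s)))\<^sup>2)" if s: "s \<in> {1..n}" for s
    proof -
      let ?C = "commutator (H Y) (x s)"
      have "adj ?C = - ?C" by (intro skew_hermitianD skew_commutator_hermitian hH xh s)
      then have "trace (?C ** adj ?C) = trace (?C ** commutator (x s) (H Y))"
        by (simp add: commutator_antisym[of "x s"])
      also have "\<dots> = trace (H Y ** commutator ?C (x s))"
        by (rule trace_commutator_cyclic[symmetric])
      finally show ?thesis by (simp add: norm_matrix_trace)
    qed
    then have "trace (H Y ** ?K) = of_real (\<Sum>s=1..n. (norm (commutator (H Y) (x s)))\<^sup>2)"
      by (simp add: matrix_sum_right trace_sum)
    then have "complex_of_real (\<Sum>s=1..n. (norm (commutator (H Y) (x s)))\<^sup>2) = 0"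
      by (simp only: K0 matrix_zero_right trace_zero)
    then have "(\<Sum>s=1..n. (norm (commutator (H Y) (x s)))\<^sup>2) = 0" by (simp only: of_real_eq_0_iff)
    then have "commutator (H Y) (x s) = 0" if "s \<in> {1..n}" for s
      using that by (simp add: sum_nonneg_eq_0_iff)
    then obtain y where y: "H Y = y *\<^sub>R mat 1" using irreducible[OF hH] by blast
    then have "y * CARD('d) = 0" using sp(2) by (simp add: trace_simps trace_I)
    then have "H Y = 0" using y by simp
    then have Y0: "Y = 0" using dec[of Y] sp(1) by simp
    have "L p s = snd p *\<^sub>R \<xi> s" for s using Y0 \<open>H Y = 0\<close> by (simp add: L_def Y_def)
    then have "D (L p) = snd p * D \<xi>"
      by (simp add: D_def commutator_scaleR matrix_scaleR_right trace_simps sum_distrib_left right_diff_distrib)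
    then have "snd p = 0" using p0 c by (simp add: \<Phi>'_def zero_prod_def)
    then show "p = 0" using Y0 by (simp add: Y_def prod_eq_iff)
  qed
  have lin\<Phi>': "linear \<Phi>'" using deriv has_derivative_linear by blast
  then have "inj \<Phi>'" using inj by (simp add: linear_injective_0)
  then obtain g where g: "linear g" "\<And>p. \<Phi>' (g p) = p"
    using linear_injective_isomorphism[OF lin\<Phi>'] by blast
  have "\<Phi> 0 \<in> interior (\<Phi> ` S)"
  proof (rule sussmann_open_mapping[OF S cont S_0 deriv])
    show "bounded_linear g" using g(1) by (simp add: linear_conv_bounded_linear)
    show "\<Phi>' \<circ> g = id" using g(2) by auto
    show "0 \<in> interior S" using S S_0 by (simp add: interior_open)
  qed simp
  then obtain \<epsilon> where \<epsilon>: "\<epsilon> > 0" "ball (\<Phi> 0) \<epsilon> \<subseteq> \<Phi> ` S" unfolding mem_interior by blast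
  \<comment> \<open>A shift of at most 1 is too small to be a nonzero multiple of
    \<open>2 * pi\<close>. The point \<open>p\<close> below has the same momentum as
    \<open>x\<close> but a value of \<open>F1 - F\<close> larger by \<open>\<delta>\<close>.\<close>
  define \<delta> where "\<delta> = min (\<epsilon> / 2) 1"
  have \<delta>: "0 < \<delta>" "\<delta> < \<epsilon>" "\<delta> \<le> 1" using \<epsilon>(1) by (auto simp: \<delta>_def)
  have "dist (\<Phi> 0) (fst (\<Phi> 0), snd (\<Phi> 0) + \<delta>) = \<delta>"
    using \<delta> by (simp add: dist_Pair_Pair[of "fst (\<Phi> 0)" "snd (\<Phi> 0)", simplified] dist_real_def)
  then have "(fst (\<Phi> 0), snd (\<Phi> 0) + \<delta>) \<in> \<Phi> ` S" using \<epsilon>(2) \<delta> by (auto simp: subset_iff)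
  then obtain p where p: "p \<in> S" "\<Phi> p = (fst (\<Phi> 0), snd (\<Phi> 0) + \<delta>)" by force
  \<comment> \<open>The trace of the momentum is constant on the product of orbits; this accounts
    for the scalar direction in \<open>slice\<close>.\<close>
  have tr: "Re (trace (\<Sum>s=1..n. y s)) = (\<Sum>s=1..n. r s)" if y: "y \<in> N_tilde n r" for y :: "'d config"
  proof -
    have "Re (trace (y s)) = r s" if "s \<in> {1..n}" for s
      using N_tilde_rank_one[OF y that] by (metis Re_complex_of_real mult.right_neutral norm_one one_power2 of_real_1 scaleR_conv_of_real trace_rank_one_self trace_scaleR of_real_mult)
    then show ?thesis by (simp add: trace_sum)
  qed
  have sumx: "(\<Sum>s=1..n. x s) = Lam m n r *\<^sub>R mat 1" using x_M by (simp add: M_tilde_def)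
  have "pr 0 = 0" by (rule linear_0[OF linpr])
  then have eq1: "(\<Sum>s=1..n. ?\<gamma> p s) + pr (fst p) = (\<Sum>s=1..n. x s)"
    and eq2: "F1 (?\<gamma> p) - F (?\<gamma> p) = F1 x - F x + \<delta>"
    using p(2) by (simp_all add: \<Phi>_def \<gamma>0)
  have "skew_part (fst p) = 0 \<and> Re (trace (H (fst p))) = 0"
  proof (rule slice[where K = "(\<Sum>s=1..n. ?\<gamma> p s) - (\<Sum>s=1..n. x s)"])
    have "\<And>s. s \<in> {1..n} \<Longrightarrow> hermitian (?\<gamma> p s)" using \<gamma>W(1)[OF p(1)] TW(2) by (auto simp: Herm_n_def PiE_iff)
    then show "hermitian ((\<Sum>s=1..n. ?\<gamma> p s) - (\<Sum>s=1..n. x s))"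
      by (intro hermitian_closed hermitian_sum xh)
    show "(\<Sum>s=1..n. ?\<gamma> p s) - (\<Sum>s=1..n. x s) + pr (fst p) = 0" using eq1 by (simp add: algebra_simps)
    show "Re (trace ((\<Sum>s=1..n. ?\<gamma> p s) - (\<Sum>s=1..n. x s))) = 0"
      using tr[OF \<gamma>N[OF p(1)]] tr[OF x_N] by (simp add: trace_sub)
  qed
  then have "(\<Sum>s=1..n. ?\<gamma> p s) = Lam m n r *\<^sub>R mat 1" using eq1 sumx by (simp add: pr_def)
  then have "?\<gamma> p \<in> M_tilde m n r" using \<gamma>N[OF p(1)] by (simp add: M_tilde_def)
  then have "?\<gamma> p \<in> M_tilde0 m n r" using TM(3) \<gamma>W[OF p(1)] by blast
  then have "[F1 (?\<gamma> p) = F (?\<gamma> p)] (rmod (2 * pi))" by (intro cong \<gamma>W p)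
  moreover have "[F1 x = F x] (rmod (2 * pi))" by (intro cong xM T W W1)
  ultimately obtain k k' :: int where "F (?\<gamma> p) = F1 (?\<gamma> p) + k * (2 * pi)" "F x = F1 x + k' * (2 * pi)"
    unfolding rcong_altdef by blast
  then have \<delta>k: "\<delta> = (k' - k) * (2 * pi)" using eq2 by (simp add: algebra_simps)
  have "0 < k' - k"
    using \<delta>k \<delta>(1) by (metis mult_pos_pos not_less of_int_0_less_iff of_int_diff pi_gt_zero zero_less_mult_pos2 zero_less_numeral)
  then have "1 \<le> real_of_int (k' - k)" by linarith
  then have "1 * (2 * pi) \<le> real_of_int (k' - k) * (2 * pi)" by (intro mult_right_mono) auto
  then show False using \<delta>k \<delta>(3) pi_gt3 by linarith
qed

end

subsection \<open>Unitary invariance\<close>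

lemma conj_by_nth: "s \<in> {1..n} \<Longrightarrow> conj_by n U y s = U ** y s ** adj U"
  by (simp add: conj_by_def)

lemma partial_sum_conj_by:
  assumes "i + 1 \<le> n"
  shows "partial_sum (conj_by n U y) i = U ** partial_sum y i ** adj U"
proof -
  have "partial_sum (conj_by n U y) i = (\<Sum>s=1..i+1. U ** y s ** adj U)"
    unfolding partial_sum_def using assms by (intro sum.cong refl conj_by_nth) auto
  then show ?thesis by (simp only: partial_sum_def matrix_sum_left matrix_sum_right)
qed

lemma conj_by_N_tilde:
  assumes U: "unitary U" and y: "y \<in> N_tilde n r"
  shows "conj_by n U y \<in> N_tilde n r"
proof -
  have "U ** y s ** adj U \<in> coadj_orbit (r s)" if s: "s \<in> {1..n}" for s
  proof -
    obtain w where w: "norm w = 1" "y s = r s *\<^sub>R rank_one w" using N_tilde_rank_one[OF y s] by blast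
    have "hinner (U *v w) (U *v w) = hinner w ((adj U ** U) *v w)"
      by (simp only: hinner_adj matrix_vector_mul_assoc)
    then have "of_real ((norm (U *v w))\<^sup>2) = (of_real 1 :: complex)"
      using U w(1) by (simp add: unitary_def hinner_self)
    then have "(norm (U *v w))\<^sup>2 = 1" by (simp only: of_real_eq_iff)
    then have "norm (U *v w) = 1" by (simp add: power2_eq_1_iff) (smt (verit) norm_ge_zero)
    moreover have "U ** y s ** adj U = r s *\<^sub>R rank_one (U *v w)"
      by (simp add: w(2) mat_distribs matrix_rank_one)
    ultimately show ?thesis unfolding coadj_orbit_def by blast
  qed
  then show ?thesis unfolding conj_by_def N_tilde_def by (intro restrict_PiE_iff[THEN iffD2]) blast
qed

lemma lam_conj_by:
  fixes y :: "('d::finite) config"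
  assumes "unitary U" "y \<in> Herm_n n" "i + 1 \<le> n"
  shows "lam m (conj_by n U y) i j = lam m y i j"
  using eigvals_conj[OF partial_sum_hermitian[OF assms(2,3)] assms(1)]
  by (simp add: lam_def partial_sum_conj_by[OF assms(3)])

lemma unitary_scalar: "unitary U \<Longrightarrow> U ** (c *\<^sub>R mat 1) ** adj U = c *\<^sub>R mat 1"
  by (simp add: mat_distribs unitary_def)

lemma conj_by_M_tilde0:
  fixes y :: "('d::finite) config"
  assumes U: "unitary U" and y: "y \<in> M_tilde0 m n r"
  shows "conj_by n U y \<in> M_tilde0 m n r"
proof -
  have yM: "y \<in> M_tilde m n r" and yN: "y \<in> N_tilde n r" using y by (auto simp: M_tilde0_def M_tilde_def)
  then have yH: "y \<in> Herm_n n" using N_tilde_subset_Herm by blast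
  have "(\<Sum>s=1..n. conj_by n U y s) = (\<Sum>s=1..n. U ** y s ** adj U)"
    by (intro sum.cong refl conj_by_nth)
  also have "\<dots> = U ** (\<Sum>s=1..n. y s) ** adj U" by (simp only: matrix_sum_left matrix_sum_right)
  also have "\<dots> = Lam m n r *\<^sub>R mat 1" using yM U by (simp only: M_tilde_def mem_Collect_eq unitary_scalar)
  finally have "conj_by n U y \<in> M_tilde m n r" using conj_by_N_tilde[OF U yN] by (simp add: M_tilde_def)
  moreover have "lam m (conj_by n U y) i j = lam m y i j" if "i < n" for i j
    using lam_conj_by[OF U yH] that by simp
  moreover have "i < n" "i - 1 < n" if "i \<in> {1..n-1}" for i using that by auto
  ultimately show ?thesis using y unfolding M_tilde0_def by simp
qed

lemma simple_eig_conj: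
  fixes A :: "complex ^ 'd ^ 'd"
  assumes U: "unitary U" and s: "simple_eig j A"
  shows "simple_eig j (U ** A ** adj U)" "eigproj j (U ** A ** adj U) = U ** eigproj j A ** adj U"
proof -
  have h: "hermitian A" and j: "j < CARD('d)" using s by (auto simp: simple_eig_def)
  have UU: "adj U ** U = mat 1" using U by (simp add: unitary_def)
  have hU: "hermitian (U ** A ** adj U)" using h by (simp add: hermitian_def adj_simps matrix_mul_assoc)
  show sU: "simple_eig j (U ** A ** adj U)"
    using s hU eigvals_conj[OF h U] by (simp add: simple_eig_def)
  note P = eigproj_basic[OF h j]
  show "eigproj j (U ** A ** adj U) = U ** eigproj j A ** adj U"
  proof (rule eigproj_unique[OF sU, symmetric])
    have "(U ** A ** adj U) ** (U ** eigproj j A ** adj U) = U ** A ** (adj U ** U) ** eigproj j A ** adj U"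
      by (simp add: matrix_mul_assoc)
    also have "\<dots> = U ** (A ** eigproj j A) ** adj U" by (simp add: UU matrix_mul_assoc)
    finally show "(U ** A ** adj U) ** (U ** eigproj j A ** adj U) = eigvals (U ** A ** adj U) ! j *\<^sub>R (U ** eigproj j A ** adj U)"
      by (simp add: P eigvals_conj[OF h U] mat_distribs)
    show "adj (U ** eigproj j A ** adj U) = U ** eigproj j A ** adj U"
      by (simp add: adj_simps P matrix_mul_assoc)
    have "trace (U ** eigproj j A ** adj U) = trace (adj U ** U ** eigproj j A)" by (rule trace_cycle3)
    then show "trace (U ** eigproj j A ** adj U) = 1" by (simp add: UU P)
  qed
qed

lemma angle_trace_conj_by:
  fixes y :: "('d::finite) config"
  assumes U: "unitary U" and i: "i + 2 \<le> n"
    and s: "simple_eig j (partial_sum y i)" "simple_eig j' (partial_sum y i)"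
  shows "angle_trace i j j' (conj_by n U y) = angle_trace i j j' y"
proof -
  have UU: "adj U ** U = mat 1" using U by (simp add: unitary_def)
  have c: "conj_by n U y (i + 1) = U ** y (i + 1) ** adj U" "conj_by n U y (i + 2) = U ** y (i + 2) ** adj U"
    using i by (auto intro!: conj_by_nth)
  have red: "(U ** X ** adj U) ** (U ** Y ** adj U) = U ** (X ** Y) ** adj U" for X Y
    by (metis UU matrix_mul_assoc matrix_mul_rid)
  have "angle_trace i j j' (conj_by n U y) = trace (U ** (eigproj j (partial_sum y i) ** y (i + 1) ** eigproj j' (partial_sum y i) ** y (i + 2)) ** adj U)"
    using i by (simp only: angle_trace_def partial_sum_conj_by simple_eig_conj(2)[OF U s(1)] simple_eig_conj(2)[OF U s(2)] c red)
  also have "\<dots> = trace (adj U ** U ** (eigproj j (partial_sum y i) ** y (i + 1) ** eigproj j' (partial_sum y i) ** y (i + 2)))"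
    by (rule trace_cycle3)
  finally show ?thesis by (simp add: UU angle_trace_def)
qed

lemma angle_domain_conj_by:
  fixes y :: "('d::finite) config"
  assumes U: "unitary U" and i: "i + 2 \<le> n" and y: "y \<in> angle_domain n i j j' q"
  shows "conj_by n U y \<in> angle_domain n i j j' q" "angle_lift i j j' q (conj_by n U y) = angle_lift i j j' q y"
proof -
  have s: "simple_eig j (partial_sum y i)" "simple_eig j' (partial_sum y i)" and yH: "y \<in> Herm_n n"
    using y by (auto simp: angle_domain_def)
  note t = angle_trace_conj_by[OF U i s]
  show "angle_lift i j j' q (conj_by n U y) = angle_lift i j j' q y" by (simp add: angle_lift_def t)
  show "conj_by n U y \<in> angle_domain n i j j' q"
    using y i simple_eig_conj(1)[OF U s(1)] simple_eig_conj(1)[OF U s(2)] conj_by_Herm[OF yH]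
    by (simp add: angle_domain_def t partial_sum_conj_by)
qed

subsection \<open>The lifts represent the angle variables\<close>

lemma trace_four_rank_one:
  "trace (rank_one u ** (\<rho> *\<^sub>R rank_one w) ** rank_one u' ** (\<rho>' *\<^sub>R rank_one w'))
    = of_real (\<rho> * \<rho>') * (hinner w u * hinner u w' * hinner w' u' * hinner u' w)"
proof -
  have "trace (rank_one u ** rank_one w ** rank_one u' ** rank_one w')
      = hinner w u * hinner u w' * hinner w' u' * hinner u' w"
    by (simp add: trace_rank_one rank_one_mult matrix_vector_mult_smult hinner_scale mult_ac flip: matrix_vector_mul_assoc)
  then show ?thesis
    by (simp add: mat_distribs trace_simps scaleR_conv_of_real[where 'a = complex])
qed

text \<open>Arguments add only modulo \<open>2 * pi\<close>, so the comparison is made between the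
  corresponding values of \<open>cis\<close>.\<close>

lemma angle_lift_cong_Arg:
  assumes "angle_trace i j j' y \<noteq> 0" "q \<noteq> 0"
  shows "[angle_lift i j j' q y = Arg (angle_trace i j j' y)] (rmod (2 * pi))"
proof -
  let ?Q = "angle_trace i j j' y"
  have "cis (angle_lift i j j' q y) = cis (Arg q) * cis (Arg (?Q / q))"
    using assms by (simp add: angle_lift_def Arg_eq_Im_Ln flip: cis_mult)
  also have "\<dots> = sgn q * sgn (?Q / q)" using assms by (simp add: cis_Arg)
  also have "\<dots> = sgn (q * (?Q / q))" by (rule sgn_mult[symmetric])
  also have "\<dots> = cis (Arg ?Q)" using assms by (simp add: cis_Arg)
  finally show ?thesis by (simp add: cis_eq_iff)
qed

context interlacing
begin

lemma angle_index_bounds: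
  assumes "(i, j) \<in> angle_index m n"
  shows "1 \<le> i" "i + 3 \<le> n" "1 \<le> j" "j \<le> m" "i + 2 \<le> n" "i + 1 \<in> {1..n}" "i + 2 \<in> {1..n}"
  using assms by (auto simp: angle_index_def)

lemma angle_trace_nonzero:
  assumes ij: "(i, j) \<in> angle_index m n"
  shows "angle_trace i (j - 1) j x \<noteq> 0"
proof -
  obtain w where w: "\<And>s. s \<in> {1..n} \<Longrightarrow> norm (w s) = 1 \<and> x s = r s *\<^sub>R rank_one (w s)"
    using N_tilde_choice[OF x_N] by blast
  note b = angle_index_bounds[OF ij]
  have xs: "x (i + 1) = r (i + 1) *\<^sub>R rank_one (w (i + 1))" "x (i + 2) = r (i + 2) *\<^sub>R rank_one (w (i + 2))"
    using w[OF b(6)] w[OF b(7)] by auto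
  have r: "r (i + 1) \<noteq> 0" "r (i + 2) \<noteq> 0" using rpos[OF b(6)] rpos[OF b(7)] by auto
  have "hinner (w (i + 1)) (eigvec a (A i)) \<noteq> 0 \<and> hinner (w (i + 2)) (eigvec a (A i)) \<noteq> 0" if "a = j - 1 \<or> a = j" for a
    using angle_nondegenerate(3-6)[OF ij] that unfolding xs overlap_scaled_rank_one by auto
  moreover have "hinner v u \<noteq> 0 \<longleftrightarrow> hinner u v \<noteq> 0" for u v :: "complex ^ 'd"
    by (metis hinner_cnj complex_cnj_zero_iff)
  ultimately show ?thesis
    unfolding angle_trace_def xs eigproj_def trace_four_rank_one using r by simp
qed

lemma in_angle_domain:
  assumes ij: "(i, j) \<in> angle_index m n"
  shows "x \<in> angle_domain n i (j - 1) j (angle_trace i (j - 1) j x)"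
  using angle_nondegenerate(1,2)[OF ij] angle_trace_nonzero[OF ij] x_H by (simp add: angle_domain_def)

lemma bracketed_quantity_Arg:
  assumes ij: "(i, j) \<in> angle_index m n"
    and w: "x (i + 1) = r (i + 1) *\<^sub>R rank_one w" "x (i + 2) = r (i + 2) *\<^sub>R rank_one w'"
    and u: "norm u = 1" "A i *v u = \<Lambda> i j *\<^sub>R u" and u': "norm u' = 1" "A i *v u' = \<Lambda> i (j + 1) *\<^sub>R u'"
  shows "Arg (hinner w u * hinner u w' * hinner w' u' * hinner u' w) = Arg (angle_trace i (j - 1) j x)"
proof -
  note b = angle_index_bounds[OF ij]
  have "rank_one u = eigproj (j - 1) (A i)"
    by (rule eigproj_eq_rank_one[OF angle_nondegenerate(1)[OF ij] _ u(1)]) (use u(2) b in \<open>simp add: lam_def\<close>)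
  moreover have "rank_one u' = eigproj j (A i)"
    by (rule eigproj_eq_rank_one[OF angle_nondegenerate(2)[OF ij] _ u'(1)]) (use u'(2) b in \<open>simp add: lam_def\<close>)
  ultimately have "angle_trace i (j - 1) j x = of_real (r (i + 1) * r (i + 2)) * (hinner w u * hinner u w' * hinner w' u' * hinner u' w)"
    unfolding angle_trace_def w by (simp only: trace_four_rank_one flip: \<open>rank_one u = _\<close> \<open>rank_one u' = _\<close>)
  moreover have "0 < r (i + 1) * r (i + 2)" using rpos[OF b(6)] rpos[OF b(7)] by simp
  ultimately show ?thesis by (simp only: Arg_times_of_real)
qed

end

text \<open>For an arbitrary representative the four vectors are eliminated in favour of
  \<open>angle_trace\<close>, which unitary conjugation does not change. Conversely, the chosen
  eigenvectors at \<open>y\<close> itself provide admissible witnesses.\<close>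

lemma angle_var_iff:
  fixes y :: "('d::finite) config"
  assumes card_d: "CARD('d) = m + 1" and nm: "m + 2 \<le> n" and rpos: "\<And>s. s \<in> {1..n} \<Longrightarrow> 0 < r s"
    and y: "y \<in> M_tilde0 m n r" and ij: "(i, j) \<in> angle_index m n"
  shows "t \<in> angle_var m r i j (U_orbit n y) \<longleftrightarrow> [t = Arg (angle_trace i (j - 1) j y)] (rmod (2 * pi))"
proof
  interpret y: interlacing m n r y by unfold_locales (use assms in auto)
  note b = y.angle_index_bounds[OF ij]
  {
    assume "t \<in> angle_var m r i j (U_orbit n y)"
    then obtain e w w' u u' where e: "e \<in> U_orbit n y"
      and H: "e (i + 1) = r (i + 1) *\<^sub>R rank_one w" "e (i + 2) = r (i + 2) *\<^sub>R rank_one w'"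
       "norm u = 1" "partial_sum e i *v u = lam m e i j *\<^sub>R u" "norm u' = 1" "partial_sum e i *v u' = lam m e i (j + 1) *\<^sub>R u'"
      and t: "[t = Arg (hinner w u * hinner u w' * hinner w' u' * hinner u' w)] (rmod (2 * pi))"
      unfolding angle_var_def by blast
    obtain U where U: "unitary U" "e = conj_by n U y" using e by (auto simp: U_orbit_def)
    interpret e: interlacing m n r e
      by unfold_locales (use assms conj_by_M_tilde0[OF U(1) y] U(2) in auto)
    have "Arg (hinner w u * hinner u w' * hinner w' u' * hinner u' w) = Arg (angle_trace i (j - 1) j e)"
      by (rule e.bracketed_quantity_Arg[OF ij H])
    also have "angle_trace i (j - 1) j e = angle_trace i (j - 1) j y"
      unfolding U(2) by (rule angle_trace_conj_by[OF U(1) b(5) y.angle_nondegenerate(1,2)[OF ij]])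
    finally show "[t = Arg (angle_trace i (j - 1) j y)] (rmod (2 * pi))" using t by simp
  }
  assume t: "[t = Arg (angle_trace i (j - 1) j y)] (rmod (2 * pi))"
  have "conj_by n (mat 1) y = y"
    using y.x_H by (auto simp: conj_by_def Herm_n_def PiE_iff extensional_def)
  moreover have "unitary (mat 1 :: complex ^ 'd ^ 'd)" by (simp add: unitary_def)
  ultimately have yU: "y \<in> U_orbit n y" unfolding U_orbit_def by (metis (mono_tags, lifting) mem_Collect_eq)
  obtain w where w: "norm w = 1" "y (i + 1) = r (i + 1) *\<^sub>R rank_one w" using N_tilde_rank_one[OF y.x_N b(6)] by blast
  obtain w' where w': "norm w' = 1" "y (i + 2) = r (i + 2) *\<^sub>R rank_one w'" using N_tilde_rank_one[OF y.x_N b(7)] by blast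
  have h: "hermitian (partial_sum y i)" using b by (intro y.A_hermitian) simp
  have jd: "j - 1 < CARD('d)" "j < CARD('d)" using b card_d by auto
  note u = eigvec[OF h jd(1)] and u' = eigvec[OF h jd(2)]
  have ul: "partial_sum y i *v eigvec (j - 1) (partial_sum y i) = lam m y i j *\<^sub>R eigvec (j - 1) (partial_sum y i)"
    "partial_sum y i *v eigvec j (partial_sum y i) = lam m y i (j + 1) *\<^sub>R eigvec j (partial_sum y i)"
    using u(2) u'(2) b by (simp_all add: lam_def)
  have "[t = Arg (hinner w (eigvec (j - 1) (partial_sum y i)) * hinner (eigvec (j - 1) (partial_sum y i)) w' *
      hinner w' (eigvec j (partial_sum y i)) * hinner (eigvec j (partial_sum y i)) w)] (rmod (2 * pi))"
    unfolding y.bracketed_quantity_Arg[OF ij w(2) w'(2) u(1) ul(1) u'(1) ul(2)] by (rule t)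
  then show "t \<in> angle_var m r i j (U_orbit n y)"
    unfolding angle_var_def using yU w w' u(1) u'(1) ul by blast
qed

lemma angle_lift_local_extension:
  fixes y :: "('d::finite) config"
  assumes "i + 1 \<le> n" "q \<noteq> 0" "y \<in> angle_domain n i j j' q"
  shows "local_extension n V (angle_lift i j j' q) y (angle_lift i j j' q)"
  unfolding local_extension_def
  by (intro exI[of _ "angle_domain n i j j' q"] conjI ballI refl angle_domain_open[OF assms(1,2)]
      assms(3) angle_lift_smooth[OF assms(1)])

text \<open>The additional invariant open set \<open>D\<close> makes room for restricting two
  different lifts to one common domain, as the reduced bracket demands.\<close>

lemma angle_lift_invariant_extension:
  fixes D :: "('d::finite) config set"
  assumes card_d: "CARD('d) = m + 1" and nm: "m + 2 \<le> n" and rpos: "\<And>s. s \<in> {1..n} \<Longrightarrow> 0 < r s"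
    and ij: "(i, j) \<in> angle_index m n" and q: "q \<noteq> 0"
    and D: "openin (top_of_set (Herm_n n)) D" "\<And>y U. y \<in> D \<Longrightarrow> unitary U \<Longrightarrow> conj_by n U y \<in> D"
  shows "invariant_extension m n r (angle_var m r i j) (N_tilde n r \<inter> (angle_domain n i (j - 1) j q \<inter> D))
    (angle_lift i (j - 1) j q)"
proof -
  have b: "i + 2 \<le> n" "i + 1 \<le> n" using ij by (auto simp: angle_index_def)
  let ?E = "angle_domain n i (j - 1) j q :: 'd config set"
  have "openin (top_of_set (Herm_n n)) (?E \<inter> D)" by (intro openin_Int angle_domain_open b q D)
  then obtain T where "open T" "?E \<inter> D = Herm_n n \<inter> T" unfolding openin_open by blast
  then have "openin (top_of_set (N_tilde n r)) (N_tilde n r \<inter> (?E \<inter> D))"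
    unfolding openin_open using N_tilde_subset_Herm by (intro exI[of _ T]) blast
  moreover have "conj_by n U y \<in> N_tilde n r \<inter> (?E \<inter> D) \<and> angle_lift i (j - 1) j q (conj_by n U y) = angle_lift i (j - 1) j q y"
    if "y \<in> N_tilde n r \<inter> (?E \<inter> D)" "unitary U" for y U
    using that conj_by_N_tilde angle_domain_conj_by[OF that(2) b(1)] D(2) by blast
  moreover have "\<exists>F. local_extension n (N_tilde n r \<inter> (?E \<inter> D)) (angle_lift i (j - 1) j q) y F" if "y \<in> N_tilde n r \<inter> (?E \<inter> D)" for y
    using angle_lift_local_extension[OF b(2) q] that by blast
  moreover have "angle_lift i (j - 1) j q y \<in> angle_var m r i j (U_orbit n y)"
    if "y \<in> N_tilde n r \<inter> (?E \<inter> D)" "y \<in> M_tilde0 m n r" for y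
  proof -
    have "angle_trace i (j - 1) j y \<noteq> 0" using angle_domain_nonzero that(1) by blast
    then have "[angle_lift i (j - 1) j q y = Arg (angle_trace i (j - 1) j y)] (rmod (2 * pi))"
      by (rule angle_lift_cong_Arg[OF _ q])
    then show ?thesis using angle_var_iff[OF card_d nm rpos that(2) ij] by blast
  qed
  ultimately show ?thesis unfolding invariant_extension_def by blast
qed

subsection \<open>The bracket of the lifts vanishes\<close>

lemma sum_lie_pairing_split:
  fixes x :: "('d::finite) config"
  assumes i: "i + 2 \<le> n"
  shows "(\<Sum>s=1..n. lie_pairing (x s) ((if s \<le> i + 1 then G else 0) + (if s = i + 1 then E else 0) - (if s = i + 2 then E' else 0)) (\<beta> s))
    = (\<Sum>s=1..i+1. lie_pairing (x s) G (\<beta> s)) + lie_pairing (x (i + 1)) E (\<beta> (i + 1)) + lie_pairing (x (i + 2)) (- E') (\<beta> (i + 2))"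
proof -
  have "(\<Sum>s=1..n. lie_pairing (x s) (if s \<le> i + 1 then G else 0) (\<beta> s)) = (\<Sum>s\<in>{1..n}. if s \<in> {1..i+1} then lie_pairing (x s) G (\<beta> s) else 0)"
    by (intro sum.cong refl) (auto simp: lie_pairing_linear)
  also have "\<dots> = (\<Sum>s\<in>{1..n} \<inter> {1..i+1}. lie_pairing (x s) G (\<beta> s))"
    by (simp only: sum.inter_restrict[OF finite_atLeastAtMost])
  also have "{1..n} \<inter> {1..i+1} = {1..i+1}" using i by auto
  finally have 1: "(\<Sum>s=1..n. lie_pairing (x s) (if s \<le> i + 1 then G else 0) (\<beta> s)) = (\<Sum>s=1..i+1. lie_pairing (x s) G (\<beta> s))" .
  have 2: "(\<Sum>s=1..n. lie_pairing (x s) (if s = k then E else 0) (\<beta> s)) = lie_pairing (x k) E (\<beta> k)" if "k \<in> {1..n}" for k E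
  proof -
    have "(\<Sum>s=1..n. lie_pairing (x s) (if s = k then E else 0) (\<beta> s)) = (\<Sum>s=1..n. if s = k then lie_pairing (x k) E (\<beta> k) else 0)"
      by (intro sum.cong refl) (auto simp: lie_pairing_linear)
    then show ?thesis using that by simp
  qed
  have "i + 1 \<in> {1..n}" "i + 2 \<in> {1..n}" using i by auto
  then show ?thesis
    by (simp only: lie_pairing_linear sum.distrib sum_subtractf 1 2)
qed

context interlacing
begin

lemma lift_gradient:
  assumes ij: "(i, j) \<in> angle_index m n" and s: "s \<in> {1..n}"
  shows "gradient (angle_lift i (j - 1) j (angle_trace i (j - 1) j x)) x s =
    (if s \<le> i + 1 then frame_grad (j - 1) j (A i) (x (i + 1)) - frame_grad (j - 1) j (A i) (x (i + 2)) else 0)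
    + (if s = i + 1 then orbit_grad (j - 1) j (A i) (x (i + 1)) else 0)
    - (if s = i + 2 then orbit_grad (j - 1) j (A i) (x (i + 2)) else 0)"
proof -
  note b = angle_index_bounds[OF ij]
  have "rank_le_one (x k)" if "k \<in> {1..n}" for k
    using N_tilde_rank_one[OF x_N that] rank_le_one_scaled by metis
  from this[OF b(6)] this[OF b(7)] show ?thesis
    by (intro angle_lift_gradient[where n = n] b in_angle_domain ij s angle_nondegenerate)
qed

text \<open>The lower lift depends only on the first \<open>i + 2\<close> slots. If
  \<open>k > i\<close>, the upper gradient is the constant \<open>H\<close> there, except for one
  extra term in slot \<open>i + 2\<close> when \<open>k = i + 1\<close>. Equivariance disposes of
  the constant and \<open>angle_gradients_consecutive\<close> of the extra term;
  \<open>k = i\<close> is the same-level identity.\<close>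

lemma lifts_commute_le:
  assumes ij: "(i, j) \<in> angle_index m n" and kl: "(k, l) \<in> angle_index m n" and ik: "i \<le> k"
  shows "(\<Sum>s=1..n. lie_pairing (x s) (gradient (angle_lift i (j - 1) j (angle_trace i (j - 1) j x)) x s)
    (gradient (angle_lift k (l - 1) l (angle_trace k (l - 1) l x)) x s)) = 0"
proof -
  note b = angle_index_bounds[OF ij] and b' = angle_index_bounds[OF kl]
  note nd = angle_nondegenerate[OF ij] and nd' = angle_nondegenerate[OF kl]
  define G where "G = frame_grad (j - 1) j (A i) (x (i + 1)) - frame_grad (j - 1) j (A i) (x (i + 2))"
  define E where "E = orbit_grad (j - 1) j (A i) (x (i + 1))"
  define E' where "E' = orbit_grad (j - 1) j (A i) (x (i + 2))"
  define H where "H = frame_grad (l - 1) l (A k) (x (k + 1)) - frame_grad (l - 1) l (A k) (x (k + 2))"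
  define B where "B = orbit_grad (l - 1) l (A k) (x (k + 1))"
  define B' where "B' = orbit_grad (l - 1) l (A k) (x (k + 2))"
  define \<beta> where "\<beta> s = (if s \<le> k + 1 then H else 0) + (if s = k + 1 then B else 0) - (if s = k + 2 then B' else 0)" for s
  have "skew_hermitian (frame_grad (l - 1) l (A k) y)" for y
    by (simp only: frame_grad_def skew_part_skew)
  then have skH: "skew_hermitian H"
    by (simp add: H_def skew_hermitian_def adj_diff)
  obtain w where w: "\<And>s. s \<in> {1..n} \<Longrightarrow> norm (w s) = 1 \<and> x s = r s *\<^sub>R rank_one (w s)"
    using N_tilde_choice[OF x_N] by blast
  have x1: "x (i + 1) = r (i + 1) *\<^sub>R rank_one (w (i + 1))" and x2: "x (i + 2) = r (i + 2) *\<^sub>R rank_one (w (i + 2))"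
    using w[OF b(6)] w[OF b(7)] by auto
  note data = nd(1,2) x1 x2 nd(3-6)
  have "(\<Sum>s=1..n. lie_pairing (x s) (gradient (angle_lift i (j - 1) j (angle_trace i (j - 1) j x)) x s)
      (gradient (angle_lift k (l - 1) l (angle_trace k (l - 1) l x)) x s))
    = (\<Sum>s=1..n. lie_pairing (x s) ((if s \<le> i + 1 then G else 0) + (if s = i + 1 then E else 0) - (if s = i + 2 then E' else 0)) (\<beta> s))"
    by (intro sum.cong refl) (simp only: lift_gradient[OF ij] lift_gradient[OF kl] G_def E_def E'_def H_def B_def B'_def \<beta>_def)
  also have "\<dots> = (\<Sum>s=1..i+1. lie_pairing (x s) G (\<beta> s)) + lie_pairing (x (i + 1)) E (\<beta> (i + 1)) + lie_pairing (x (i + 2)) (- E') (\<beta> (i + 2))"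
    by (rule sum_lie_pairing_split[OF b(5)])
  also have "\<dots> = 0"
  proof (cases "i = k")
    case False
    have "(\<Sum>s=1..i+1. lie_pairing (x s) G (\<beta> s)) = (\<Sum>s=1..i+1. lie_pairing (x s) G H)"
      using ik False by (intro sum.cong refl) (simp add: \<beta>_def)
    also have "\<dots> = lie_pairing (A i) G H" by (simp only: partial_sum_def lie_pairing_sum_l)
    finally have 1: "(\<Sum>s=1..i+1. lie_pairing (x s) G (\<beta> s)) = lie_pairing (A i) G H" .
    have 2: "\<beta> (i + 1) = H" using ik False by (simp add: \<beta>_def)
    have inv: "lie_pairing (A i) G H + lie_pairing (x (i + 1)) E H + lie_pairing (x (i + 2)) (- E') H = 0"
      unfolding G_def E_def E'_def by (rule angle_gradient_invariant[OF data skH])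
    show ?thesis
    proof (cases "k = i + 1")
      case True
      then have 3: "\<beta> (i + 2) = H + B" by (simp add: \<beta>_def)
      have Ak: "A k = A i + x (i + 2)" using True by (simp add: partial_sum_Suc)
      have s: "simple_eig (l - 1) (A i + x (i + 2))" "simple_eig l (A i + x (i + 2))" using nd' Ak by simp_all
      have xk: "x (k + 1) = x (i + 2)" using True by simp
      have "lie_pairing (x (i + 2)) (- E') B = 0"
        unfolding E'_def B_def Ak xk by (rule angle_gradients_consecutive[OF data s])
      then show ?thesis using inv unfolding 1 2 3 by (simp only: lie_pairing_linear)
    next
      case False
      then have 3: "\<beta> (i + 2) = H" using ik \<open>i \<noteq> k\<close> by (simp add: \<beta>_def)
      show ?thesis using inv unfolding 1 2 3 .
    qed
  next
    case True
    have "(\<Sum>s=1..i+1. lie_pairing (x s) G (\<beta> s)) = (\<Sum>s=1..i+1. lie_pairing (x s) G H + (if s = i + 1 then lie_pairing (x (i + 1)) G B else 0))"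
      using True by (intro sum.cong refl) (auto simp: \<beta>_def lie_pairing_linear)
    also have "\<dots> = (\<Sum>s=1..i+1. lie_pairing (x s) G H) + lie_pairing (x (i + 1)) G B"
      by (simp only: sum.distrib) simp
    also have "(\<Sum>s=1..i+1. lie_pairing (x s) G H) = lie_pairing (A i) G H" by (simp only: partial_sum_def lie_pairing_sum_l)
    finally have 1: "(\<Sum>s=1..i+1. lie_pairing (x s) G (\<beta> s)) = lie_pairing (A i) G H + lie_pairing (x (i + 1)) G B" .
    have 2: "\<beta> (i + 1) = H + B" "\<beta> (i + 2) = - B'" using True by (simp_all add: \<beta>_def)
    have "lie_pairing (A i) G H + lie_pairing (x (i + 1)) E H + lie_pairing (x (i + 1)) G B
       + lie_pairing (x (i + 1)) E B + lie_pairing (x (i + 2)) (- E') (- B') = 0"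
      unfolding G_def E_def E'_def H_def B_def B'_def True[symmetric]
      by (rule angle_gradients_same_level[OF data]) (use nd' True in auto)
    then show ?thesis unfolding 1 2 by (simp only: lie_pairing_linear)
  qed
  finally show ?thesis .
qed

lemma lifts_commute:
  assumes ij: "(i, j) \<in> angle_index m n" and kl: "(k, l) \<in> angle_index m n"
  shows "(\<Sum>s=1..n. lie_pairing (x s) (gradient (angle_lift i (j - 1) j (angle_trace i (j - 1) j x)) x s)
    (gradient (angle_lift k (l - 1) l (angle_trace k (l - 1) l x)) x s)) = 0"
proof (cases "i \<le> k")
  case False
  let ?g = "\<lambda>s. gradient (angle_lift i (j - 1) j (angle_trace i (j - 1) j x)) x s"
  let ?h = "\<lambda>s. gradient (angle_lift k (l - 1) l (angle_trace k (l - 1) l x)) x s"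
  have "(\<Sum>s=1..n. lie_pairing (x s) (?g s) (?h s)) = - (\<Sum>s=1..n. lie_pairing (x s) (?h s) (?g s))"
    unfolding sum_negf[symmetric] by (intro sum.cong refl lie_pairing_antisym)
  then show ?thesis using lifts_commute_le[OF kl ij] False by simp
qed (rule lifts_commute_le[OF ij kl])

text \<open>By invariance the gradient of either function defines a tangent vector of the momentum level, so
  each function may be replaced by the corresponding lift.\<close>

lemma invariant_extensions_commute:
  assumes ij: "(i, j) \<in> angle_index m n" and kl: "(k, l) \<in> angle_index m n"
    and f: "invariant_extension m n r (angle_var m r i j) V f" and g: "invariant_extension m n r (angle_var m r k l) V g"
    and x: "x \<in> V"
  shows "bracket n V f g x = 0"
proof -
  have V: "openin (top_of_set (N_tilde n r)) V" using f by (simp add: invariant_extension_def)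
  then have VN: "V \<subseteq> N_tilde n r" using openin_imp_subset by blast
  obtain TV where TV: "open TV" "V = N_tilde n r \<inter> TV" using V unfolding openin_open by blast
  let ?tangent = "\<lambda>F H. \<Sum>s=1..n. Im (trace (gradient F x s ** commutator (gradient H x s) (x s)))"
  have moment: "(\<Sum>s=1..n. commutator (gradient F x s) (x s)) = 0"
    if "invariant_extension m n r \<phi> V' f'" "x \<in> V'" "local_extension n V' f' x F" for \<phi> V' f' F
    by (rule invariant_gradient_moment[OF _ that(2,3)])
      (use that openin_imp_subset in \<open>auto simp: invariant_extension_def\<close>)
  have replace: "?tangent F H = ?tangent (angle_lift a (b - 1) b (angle_trace a (b - 1) b x)) H"
    if ab: "(a, b) \<in> angle_index m n" and h: "invariant_extension m n r (angle_var m r a b) V h"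
      and F: "local_extension n V h x F" and H: "\<And>s. s \<in> {1..n} \<Longrightarrow> skew_hermitian (gradient H x s)"
      and H0: "(\<Sum>s=1..n. commutator (gradient H x s) (x s)) = 0" for a b h F H
  proof -
    let ?q = "angle_trace a (b - 1) b x" and ?D = "angle_domain n a (b - 1) b (angle_trace a (b - 1) b x) :: 'd config set"
    have a1: "a + 1 \<le> n" using angle_index_bounds[OF ab] by simp
    have q: "?q \<noteq> 0" by (rule angle_trace_nonzero[OF ab])
    obtain W where W: "openin (top_of_set (Herm_n n)) W" "x \<in> W" "smooth_on n W F" "\<And>y. y \<in> W \<inter> V \<Longrightarrow> F y = h y"
      using F unfolding local_extension_def by blast
    define \<xi> where "\<xi> s = (if s \<in> {1..n} then gradient H x s else 0)" for s
    have sk: "skew_hermitian (\<xi> s)" for s using H by (simp add: \<xi>_def skew_hermitian_def)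
    have "(\<Sum>s=1..n. commutator (\<xi> s) (x s)) = (\<Sum>s=1..n. commutator (gradient H x s) (x s))"
      by (intro sum.cong refl) (simp add: \<xi>_def)
    then have \<xi>0: "(\<Sum>s=1..n. commutator (\<xi> s) (x s)) = 0" using H0 by simp
    have "(\<Sum>s=1..n. Im (trace (gradient F x s ** commutator (\<xi> s) (x s))))
        = (\<Sum>s=1..n. Im (trace (gradient (angle_lift a (b - 1) b ?q) x s ** commutator (\<xi> s) (x s))))"
    proof (rule level_set_derivative[OF angle_domain_open[OF a1 q] angle_lift_smooth[OF a1] in_angle_domain[OF ab] W(1,3,2) TV(1) _ _ sk \<xi>0])
      show "x \<in> TV" using x TV by simp
      fix y assume y: "y \<in> M_tilde0 m n r" "y \<in> TV" "y \<in> ?D" "y \<in> W"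
      have "y \<in> V" using y TV by (auto simp: M_tilde0_def M_tilde_def)
      then have "F y \<in> angle_var m r a b (U_orbit n y)"
        using W(4) y h by (auto simp: invariant_extension_def)
      then have "[F y = Arg (angle_trace a (b - 1) b y)] (rmod (2 * pi))"
        using angle_var_iff[OF card_d nm rpos y(1) ab] by simp
      moreover have "[angle_lift a (b - 1) b ?q y = Arg (angle_trace a (b - 1) b y)] (rmod (2 * pi))"
        using angle_domain_nonzero[OF y(3)] by (intro angle_lift_cong_Arg) auto
      ultimately show "[F y = angle_lift a (b - 1) b ?q y] (rmod (2 * pi))"
        using rcong_sym rcong_trans by blast
    qed
    then show ?thesis by (simp add: \<xi>_def)
  qed
  obtain F where F: "local_extension n V f x F" using f x unfolding invariant_extension_def by blast
  obtain G where G: "local_extension n V g x G" using g x unfolding invariant_extension_def by blast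
  let ?F = "angle_lift i (j - 1) j (angle_trace i (j - 1) j x) :: 'd config \<Rightarrow> real"
  let ?G = "angle_lift k (l - 1) l (angle_trace k (l - 1) l x) :: 'd config \<Rightarrow> real"
  have i1: "i + 1 \<le> n" using angle_index_bounds[OF ij] by simp
  have Hopen: "openin (top_of_set (Herm_n n)) (Herm_n n)" by simp
  \<comment> \<open>The second replacement pairs with the gradient of the first lift, so that lift
    too must satisfy the moment condition. It does so as an invariant extension on its own domain,
    whence the whole space is taken as the extra set.\<close>
  have inv: "invariant_extension m n r (angle_var m r i j)
      (N_tilde n r \<inter> (angle_domain n i (j - 1) j (angle_trace i (j - 1) j x) \<inter> Herm_n n)) ?F"
    by (rule angle_lift_invariant_extension[OF card_d nm rpos ij angle_trace_nonzero[OF ij] Hopen conj_by_Herm])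
  have xV: "x \<in> N_tilde n r \<inter> (angle_domain n i (j - 1) j (angle_trace i (j - 1) j x) \<inter> Herm_n n)"
    using x_N x_H in_angle_domain[OF ij] by blast
  have ext: "local_extension n V' ?F x ?F" for V'
    by (rule angle_lift_local_extension[OF i1 angle_trace_nonzero[OF ij] in_angle_domain[OF ij]])
  have "bracket n V f g x = (\<Sum>s=1..n. lie_pairing (x s) (gradient F x s) (gradient G x s))"
    by (rule bracket_eq[OF V x F G])
  also have "\<dots> = ?tangent F G" by (intro sum.cong refl lie_pairing_tangent(1))
  also have "\<dots> = ?tangent ?F G"
    by (rule replace[OF ij f F local_extension_gradient_skew[OF G] moment[OF g x G]])
  also have "\<dots> = - ?tangent G ?F"
    unfolding sum_negf[symmetric]
    by (intro sum.cong refl trans[OF lie_pairing_tangent(1)[symmetric] lie_pairing_tangent(2)])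
  also have "?tangent G ?F = ?tangent ?G ?F"
    by (rule replace[OF kl g G local_extension_gradient_skew[OF ext] moment[OF inv xV ext]])
  also have "- ?tangent ?G ?F = (\<Sum>s=1..n. lie_pairing (x s) (gradient ?F x s) (gradient ?G x s))"
    unfolding sum_negf[symmetric] by (intro sum.cong refl lie_pairing_tangent(2)[symmetric])
  also have "\<dots> = 0" by (rule lifts_commute[OF ij kl])
  finally show ?thesis .
qed

end

theorem proposition7p2p18:
  fixes m n :: nat and r :: "nat \<Rightarrow> real" and i j k l :: nat
    and p :: "'d::finite config set"
  assumes "CARD('d) = m + 1" and "m \<ge> 1" and "n \<ge> m + 2"
    and "\<And>s. s \<in> {1..n} \<Longrightarrow> r s > 0"
    and "(i, j) \<in> angle_index m n" and "(k, l) \<in> angle_index m n"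
    and "p \<in> M0 m n r"
  shows "reduced_bracket m n r (angle_var m r i j) (angle_var m r k l) p = 0"
proof -
  note ij = assms(5) and kl = assms(6)
  obtain x where x: "x \<in> M_tilde0 m n r" "p = U_orbit n x" using assms(7) by (auto simp: M0_def)
  have p: "interlacing m n r e" if "e \<in> p" for e
  proof -
    have "e \<in> U_orbit n x" using that x(2) by simp
    then obtain U where "unitary U" "e = conj_by n U x" unfolding U_orbit_def by blast
    then have "e \<in> M_tilde0 m n r" using conj_by_M_tilde0[OF _ x(1)] by simp
    then show ?thesis by unfold_locales (use assms in auto)
  qed
  have commute: "bracket n V f g e = 0"
    if "e \<in> p" "e \<in> V" "invariant_extension m n r (angle_var m r i j) V f" "invariant_extension m n r (angle_var m r k l) V g" for e V f g
    by (rule interlacing.invariant_extensions_commute[OF p[OF that(1)] ij kl that(3,4,2)])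
  interpret x: interlacing m n r x by unfold_locales (use assms x in auto)
  have "conj_by n (mat 1) x = x"
    using x.x_H by (auto simp: conj_by_def Herm_n_def PiE_iff extensional_def)
  moreover have "unitary (mat 1 :: complex ^ 'd ^ 'd)" by (simp add: unitary_def)
  ultimately have xp: "x \<in> p" unfolding x(2) U_orbit_def by (metis (mono_tags, lifting) mem_Collect_eq)
  let ?q = "angle_trace i (j - 1) j x" and ?q' = "angle_trace k (l - 1) l x"
  let ?D = "angle_domain n i (j - 1) j ?q :: 'd config set" and ?D' = "angle_domain n k (l - 1) l ?q' :: 'd config set"
  have b: "i + 2 \<le> n" "i + 1 \<le> n" "k + 2 \<le> n" "k + 1 \<le> n"
    using x.angle_index_bounds[OF ij] x.angle_index_bounds[OF kl] by auto
  have q: "?q \<noteq> 0" "?q' \<noteq> 0" using x.angle_trace_nonzero ij kl by auto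
  \<comment> \<open>Each lift is cut down by the domain of the other, so that both live on one
    invariant open set around \<open>x\<close>.\<close>
  have f: "invariant_extension m n r (angle_var m r i j) (N_tilde n r \<inter> (?D \<inter> ?D')) (angle_lift i (j - 1) j ?q)"
    by (rule angle_lift_invariant_extension[OF assms(1,3,4) ij q(1) angle_domain_open[OF b(4) q(2)] angle_domain_conj_by(1)[OF _ b(3)]])
  have g: "invariant_extension m n r (angle_var m r k l) (N_tilde n r \<inter> (?D' \<inter> ?D)) (angle_lift k (l - 1) l ?q')"
    by (rule angle_lift_invariant_extension[OF assms(1,3,4) kl q(2) angle_domain_open[OF b(2) q(1)] angle_domain_conj_by(1)[OF _ b(1)]])
  have g': "invariant_extension m n r (angle_var m r k l) (N_tilde n r \<inter> (?D \<inter> ?D')) (angle_lift k (l - 1) l ?q')"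
    using g by (simp only: Int_commute[of ?D' ?D])
  have xV: "x \<in> N_tilde n r \<inter> (?D \<inter> ?D')"
    using x.x_N x.in_angle_domain[OF ij] x.in_angle_domain[OF kl] by blast
  show ?thesis
    unfolding reduced_bracket_def
  \<comment> \<open>The pair of lifts witnesses that 0 is attained; every other admissible pair, at
    any representative of the orbit, gives 0 as well.\<close>
  proof (rule the_equality)
    show "\<exists>e\<in>p. \<exists>V f g. e \<in> V \<and> invariant_extension m n r (angle_var m r i j) V f \<and>
        invariant_extension m n r (angle_var m r k l) V g \<and> 0 = bracket n V f g e"
      by (intro bexI[OF _ xp] exI conjI, rule xV, rule f, rule g', rule commute[OF xp xV f g', symmetric])
  qed (use commute in blast)
qed

end
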